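(* Let $\Psi$ be a matrix-valued rational inner function on $\mathbb D$, written as $\Psi=F/q$ in lowest terms, let $\mathcal W_\Psi=\{(z_1,z_2)\in\mathbb C^2:\det(F(z_1)-z_2q(z_1)I)=0\}$, and let $\xi_\Psi$ be the polynomial obtained from $\det(F(z_1)-z_2q(z_1)I)$ by dividing out, for each zero $\alpha$ of $q$, the largest power of $(z_1-\alpha)$ dividing it. Then the following are equivalent: (i) $\mathcal W_\Psi$ is a distinguished variety with respect to $\mathbb D^2$; (ii) $\nu(\Psi(z))<1$ for all $z\in\mathbb D$; (iii) $Z(\xi_\Psi)\subset\mathbb D^2\cup\mathbb T^2\cup\mathbb E^2$; (iv) $Z(\xi_\Psi)$ is a distinguished variety with respect to $\mathbb D^2$. Conversely, if $\mathcal W$ is any distinguished variety with respect to $\mathbb D^2$ (the zero set of one polynomial in $\mathbb C[z_1,z_2]$), then there is a matrix-valued rational inner function $\Psi$ on $\mathbb D$ such that $$\mathcal W\cap\mathbb D^2=\mathcal W_\Psi\cap\mathbb D^2=Z(\xi_\Psi)\cap\mathbb D^2.$$ Moreover, (for such $\mathcal W$ and $\Psi$) $\mathcal W=Z(\xi_\Psi)$ if and only if both $\mathcal W$ and $Z(\xi_\Psi)$ are contained in $\mathbb D^2\cup\mathbb T^2\cup\mathbb E^2$.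
   Context: $\mathbb D$ is the open unit disc, $\mathbb T$ the unit circle, $\mathbb E=\mathbb C\setminus\overline{\mathbb D}$. $\nu(A)=\sup\{|\langle Ah,h\rangle|:\|h\|=1\}$ is the numerical radius. $Z(\xi)\subset\mathbb C^2$ denotes the zero set of a polynomial $\xi\in\mathbb C[z_1,z_2]$. An algebraic variety $\mathcal W=Z(\xi)\subset\mathbb C^2$ is a distinguished variety with respect to $\mathbb D^2$ if $\mathcal W\cap\mathbb D^2\neq\emptyset$ and $\mathcal W\cap\partial\mathbb D^2=\mathcal W\cap\mathbb T^2$, where $\partial\mathbb D^2$ is the topological boundary; varieties in $\mathbb C^2$ are taken here to be zero sets of a single polynomial. A (square) matrix-valued holomorphic function $\Psi$ on $\mathbb D$ is rational inner if there is a (finite) block unitary matrix $\begin{bmatrix}A&B\\C&D\end{bmatrix}$ such that $\Psi(z)=A+zB(I-zD)^{-1}C$; one may and does assume that the contractive matrix $D$ has no unimodular eigenvalue, so that $\Psi$ is analytic in a neighbourhood of $\overline{\mathbb D}$ and unitary-valued on $\mathbb T$. One writes $\Psi(z)=F(z)/q(z)$ with $F$ a matrix polynomial and $q$ a scalar polynomial such that no (nonconstant) factor of $q$ divides every entry of $F$; the zeros of $q$ lie in $\mathbb E$. The polynomial $\xi_\Psi$ is defined by $$\det(F(z_1)-z_2q(z_1)I)=\prod_{\alpha\in Z(q)}(z_1-\alpha)^{m_\alpha}\,\xi_\Psi(z_1,z_2),$$ where, for each zero $\alpha$ of $q$, $m_\alpha\ge 0$ is the largest integer such that $(z_1-\alpha)^{m_\alpha}$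 divides $\det(F(z_1)-z_2q(z_1)I)$. *)

theory Defs
  imports
    "HOL-Analysis.Elementary_Metric_Spaces"
    "HOL-Analysis.Product_Vector"
    "HOL-Computational_Algebra.Field_as_Ring"
    "Jordan_Normal_Form.Schur_Decomposition"
    "Jordan_Normal_Form.Gauss_Jordan_Elimination"
begin

abbreviation unit_disc :: "complex set" where
  "unit_disc \<equiv> ball 0 1"

abbreviation unit_circle :: "complex set" where
  "unit_circle \<equiv> sphere 0 1"

abbreviation exterior_disc :: "complex set" where
  "exterior_disc \<equiv> - cball 0 1"

abbreviation bidisc :: "(complex \<times> complex) set" where
  "bidisc \<equiv> unit_disc \<times> unit_disc"

abbreviation torus :: "(complex \<times> complex) set" where
  "torus \<equiv> unit_circle \<times> unit_circle"

abbreviation biexterior :: "(complex \<times> complex) set" where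
  "biexterior \<equiv> exterior_disc \<times> exterior_disc"

text \<open>
  The ring of polynomials in z1, z2 is represented by the type complex poly poly: polynomials in
  z2 (the outer variable) whose coefficients are polynomials in z1 (the inner variable).
\<close>

definition zero_set :: "complex poly poly \<Rightarrow> (complex \<times> complex) set" where
  "zero_set p = {(z1, z2). poly (poly p [:z2:]) z1 = 0}"

definition distinguished_variety :: "(complex \<times> complex) set \<Rightarrow> bool" where
  "distinguished_variety W \<longleftrightarrow>
     (\<exists>p. W = zero_set p) \<and> W \<inter> bidisc \<noteq> {} \<and> W \<inter> frontier bidisc = W \<inter> torus"

text \<open>
  The norm of h is 1 iff its inner product with itself is 1.  The supremum is only meaningful
  for square matrices of dimension at least 1.
\<close>

definition numerical_radius :: "complex mat \<Rightarrow> real" where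
  "numerical_radius A =
     Sup {cmod ((A *\<^sub>v h) \<bullet>c h) | h. h \<in> carrier_vec (dim_row A) \<and> h \<bullet>c h = 1}"

definition unitary_mat :: "complex mat \<Rightarrow> bool" where
  "unitary_mat U \<longleftrightarrow>
     square_mat U \<and> inverts_mat U (mat_adjoint U) \<and> inverts_mat (mat_adjoint U) U"

text \<open>
  Only the values of \<Psi> on the unit disc matter.  The state space dimension m may be 0, in which
  case \<Psi> is a constant unitary.  Since D is a contraction, I - z D is invertible for every z in
  the unit disc.  Discarding the unimodular eigenvalues of D does not change \<Psi>, so their
  absence is not required of the realization.
\<close>

definition rational_inner :: "nat \<Rightarrow> (complex \<Rightarrow> complex mat) \<Rightarrow> bool" where
  "rational_inner n \<Psi> \<longleftrightarrow> n \<ge> 1 \<and>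
     (\<exists>m A B C D. A \<in> carrier_mat n n \<and> B \<in> carrier_mat n m \<and>
        C \<in> carrier_mat m n \<and> D \<in> carrier_mat m m \<and>
        unitary_mat (four_block_mat A B C D) \<and>
        (\<forall>z\<in>unit_disc. \<exists>R. mat_inverse (1\<^sub>m m - z \<cdot>\<^sub>m D) = Some R \<and>
           \<Psi> z = A + z \<cdot>\<^sub>m (B * R * C)))"

text \<open>
  \<Psi> = F / q in lowest terms.  The identity is stated in the form q \<Psi> = F on the disc, so that
  no convention about division by zero is involved; that q has no zero in the closed disc is a
  consequence for rational inner \<Psi>.
\<close>

definition lowest_terms ::
  "nat \<Rightarrow> (complex \<Rightarrow> complex mat) \<Rightarrow> complex poly mat \<Rightarrow> complex poly \<Rightarrow> bool" where
  "lowest_terms n \<Psi> F q \<longleftrightarrow>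
     F \<in> carrier_mat n n \<and> q \<noteq> 0 \<and>
     (\<forall>z\<in>unit_disc. \<Psi> z \<in> carrier_mat n n \<and>
        poly q z \<cdot>\<^sub>m \<Psi> z = map_mat (\<lambda>f. poly f z) F) \<and>
     (\<forall>d. d dvd q \<and> (\<forall>i<n. \<forall>j<n. d dvd F $$ (i, j)) \<longrightarrow> degree d = 0)"

definition W_variety :: "nat \<Rightarrow> complex poly mat \<Rightarrow> complex poly \<Rightarrow> (complex \<times> complex) set" where
  "W_variety n F q =
     {(z1, z2). det (map_mat (\<lambda>f. poly f z1) F - (z2 * poly q z1) \<cdot>\<^sub>m 1\<^sub>m n) = 0}"

text \<open>
  In complex poly poly, a polynomial f in z1 alone is [:f:], and z2 times f is [:0, f:].
\<close>

definition det_poly :: "nat \<Rightarrow> complex poly mat \<Rightarrow> complex poly \<Rightarrow> complex poly poly" where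
  "det_poly n F q = det (map_mat (\<lambda>f. [:f:]) F - [:0, q:] \<cdot>\<^sub>m 1\<^sub>m n)"

definition pole_part :: "nat \<Rightarrow> complex poly mat \<Rightarrow> complex poly \<Rightarrow> complex poly poly" where
  "pole_part n F q =
     (\<Prod>\<alpha>\<in>{\<alpha>. poly q \<alpha> = 0}. [:[:- \<alpha>, 1:]:] ^ multiplicity [:[:- \<alpha>, 1:]:] (det_poly n F q))"

text \<open>The division is exact; see the lemma det_poly_eq below.\<close>

definition xi_poly :: "nat \<Rightarrow> complex poly mat \<Rightarrow> complex poly \<Rightarrow> complex poly poly" where
  "xi_poly n F q = det_poly n F q div pole_part n F q"

lemma poly_poly_dvd_const_prod:
  fixes p :: "complex poly poly" and e :: "complex \<Rightarrow> nat"
  assumes "finite S" and "\<And>\<alpha>. \<alpha> \<in> S \<Longrightarrow> [:[:- \<alpha>, 1:]:] ^ e \<alpha> dvd p"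
  shows "(\<Prod>\<alpha>\<in>S. [:[:- \<alpha>, 1:]:] ^ e \<alpha>) dvd p"
proof -
  have pw: "[:c:] ^ k = [:c ^ k:]" for c :: "complex poly" and k
    by (induction k) (auto simp: one_pCons)
  have pr: "(\<Prod>\<alpha>\<in>S. [:g \<alpha>:]) = [:\<Prod>\<alpha>\<in>S. g \<alpha>:]" for g :: "complex \<Rightarrow> complex poly"
    using assms(1) by (induction S rule: finite_induct) (auto simp: one_pCons)
  have "(\<Prod>\<alpha>\<in>T. [:- \<alpha>, 1:] ^ e \<alpha>) dvd c"
    if "finite T" "\<And>\<alpha>. \<alpha> \<in> T \<Longrightarrow> [:- \<alpha>, 1:] ^ e \<alpha> dvd c" for T and c :: "complex poly"
    using that
  proof (induction T rule: finite_induct)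
    case (insert a T)
    have "Rings.coprime ([:- a, 1:] ^ e a) (\<Prod>\<alpha>\<in>T. [:- \<alpha>, 1:] ^ e \<alpha>)"
    proof (rule prod_coprime_right)
      fix b assume "b \<in> T"
      hence ne: "a - b \<noteq> 0" using insert.hyps by auto
      have "Rings.coprime [:- a, 1:] [:- b, 1:]"
      proof (rule coprimeI)
        fix d assume d: "d dvd [:- a, 1:]" "d dvd [:- b, 1:]"
        have "d dvd [:- b, 1:] - [:- a, 1:]" using d by (intro dvd_diff)
        also have "[:- b, 1:] - [:- a, 1:] = [:a - b:]" by simp
        finally show "is_unit d"
          using ne by (meson dvd_trans is_unit_const_poly_iff dvd_field_iff)
      qed
      thus "Rings.coprime ([:- a, 1:] ^ e a) ([:- b, 1:] ^ e b)"
        by simp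
    qed
    thus ?case using insert by (auto intro: divides_mult)
  qed simp
  with assms show ?thesis
    by (auto simp: pw pr const_poly_dvd_iff)
qed

lemma det_poly_eq: "det_poly n F q = pole_part n F q * xi_poly n F q" if "q \<noteq> 0"
proof -
  have "pole_part n F q dvd det_poly n F q"
    unfolding pole_part_def
    using that by (intro poly_poly_dvd_const_prod poly_roots_finite multiplicity_dvd)
  thus ?thesis unfolding xi_poly_def by simp
qed

end

theory Submission
  imports
    Defs
    "HOL-Complex_Analysis.Cauchy_Integral_Formula"
    "Jordan_Normal_Form.Spectral_Radius"
begin

text \<open>
  Write (z, w) for the points of C^2, D for the disc and T for the circle.

  Let f be an irreducible factor, meeting the bidisc, of the equation of a distinguished variety.
  Over D no zero of f crosses |w| = 1, so the power sums of the roots w inside D are holomorphic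
  in z. At T these roots become unimodular, and Schwarz reflection shows that the power sums are
  rational; since f is irreducible, the roots inside D are then all the roots. Hence the
  product p of these factors has only unimodular roots over T, and its Schur-Cohn form S is
  positive definite at all but finitely many points of T. If C is the companion matrix of p and
  a the leading coefficient, then C S C^* = |a|^2 S on T. A factorization
  |d|^2 S = L L^* with L invertible over D makes L^-1 C L a unitary multiple of a on T, and its
  eigenvalues over D are those of C. A unitary realization of such a quotient F / q
  comes from the positive semidefinite kernel (q(z) cnj q(u) - F(z) F(u)^*) / (1 - z cnj u), whose Gram
  vectors define an isometry.

  For the equivalences, contractivity of Psi over D and unitarity over T reduce all conditions
  to the absence of points (z, w) of W_Psi with z in D and |w| = 1. A contraction has numerical
  radius 1 only if it has a unimodular eigenvalue, and the reflection
  (z, w) |-> (1 / cnj z, 1 / cnj w) maps W_Psi to itself away from the zeros of q. Near a zero of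
  q the exterior statement follows from continuity of the roots of xi.
\<close>

text \<open>The companion matrix has the coefficient vector v of p / (w - a) as eigenvector for each
  root a. When all roots are unimodular, the sum S of v v^* over the roots is therefore an inner
  product for which C is a multiple of a unitary. The entries of S can be written without the roots,
  by the coefficients of p alone, so on T they are trigonometric polynomials. Two obstacles shape
  what follows. Where roots collide, S degenerates; identities are proved off a finite subset of T
  and extended by density. And division would leave the trigonometric polynomials; the Cholesky
  factorization is therefore fraction-free, and the scalar d collects the spectral factors of its
  pivots. This scalar cancels in the similarity. Invertibility of L over D is what preserves the
  spectrum there, so the zeros of its determinant in D are moved out by Blaschke factors, which
  leave L L^* unchanged on T.\<close>

hide_const (open) Determinants.det Finite_Cartesian_Product.mat Finite_Cartesian_Product.row
  Finite_Cartesian_Product.column Finite_Cartesian_Product.transpose Finite_Cartesian_Product.vec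
hide_type (open) Finite_Cartesian_Product.vec
no_notation Finite_Cartesian_Product.vec_nth (infixl "$" 90)
no_notation inner (infix "\<bullet>" 70)

section \<open>Polynomials in two variables\<close>

text \<open>Write p as p(0) times the product of 1 - x / a over its roots a; the coefficients of
  each factor sum to at most 1 + 1 / e in modulus. Read backwards, a coefficient that is large
  compared with p(0) forces a root of modulus below e, which plays the part of Rouche's
  theorem.\<close>

lemma coeff_bound_by_roots:
  fixes p :: "complex poly"
  assumes "e > 0" and "\<And>x. poly p x = 0 \<Longrightarrow> norm x \<ge> e"
  shows "norm (coeff p k) \<le> norm (coeff p 0) * (1 + 1 / e) ^ degree p"
  using assms(2)
proof (induction "degree p" arbitrary: p k)
  case 0
  then have "coeff p k = 0 \<or> k = 0" by (metis le_degree bot_nat_0.extremum_uniqueI)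
  then show ?case using 0 by auto
next
  case (Suc d)
  then have "\<not> constant (poly p)" by (simp add: constant_degree)
  then obtain x where x: "poly p x = 0" using Fundamental_Theorem_Algebra.fundamental_theorem_of_algebra by blast
  then obtain g where g: "p = [:- x, 1:] * g" unfolding poly_eq_0_iff_dvd by auto
  have "p \<noteq> 0" using Suc.hyps(2) by auto
  then have "g \<noteq> 0" using g by auto
  then have "degree p = Suc (degree g)" unfolding g by (subst degree_mult_eq) auto
  then have dg: "d = degree g" using Suc by simp
  have IH: "norm (coeff g j) \<le> norm (coeff g 0) * (1 + 1 / e) ^ d" for j
    using Suc.hyps(1)[OF dg] Suc.prems dg unfolding g by auto
  have ex: "e \<le> norm x" using x Suc.prems by blast
  have c0: "norm (coeff p 0) = norm x * norm (coeff g 0)" unfolding g by (simp add: norm_mult)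
  define M where "M = norm (coeff g 0) * (1 + 1 / e) ^ d"
  have M0: "M \<ge> 0" unfolding M_def using assms(1) by simp
  have "norm (coeff p k) \<le> norm x * M + M"
  proof (cases k)
    case 0
    then show ?thesis unfolding g using IH[of 0] M0 by (auto simp: norm_mult M_def[symmetric] intro!: add_increasing2 mult_left_mono)
  next
    case (Suc i)
    then have "coeff p k = - x * coeff g k + coeff g i" unfolding g by simp
    then have "norm (coeff p k) \<le> norm x * norm (coeff g k) + norm (coeff g i)"
      by (metis norm_minus_cancel norm_mult norm_triangle_ineq)
    then show ?thesis using IH[of k] IH[of i] unfolding M_def[symmetric]
      by (smt (verit) mult_left_mono norm_ge_zero)
  qed
  moreover have "M \<le> norm x * M / e" using ex M0 assms(1) by (simp add: field_simps mult_left_mono)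
  ultimately have "norm (coeff p k) \<le> norm x * M + norm x * M / e" by linarith
  also have "\<dots> = norm x * M * (1 + 1 / e)" by (simp add: distrib_left)
  also have "\<dots> = norm (coeff p 0) * ((1 + 1 / e) * (1 + 1 / e) ^ d)"
    unfolding c0 M_def by (simp only: mult_ac)
  also have "(1 + 1 / e) * (1 + 1 / e) ^ d = (1 + 1 / e) ^ degree p"
    by (simp only: Suc.hyps(2)[symmetric] power_Suc)
  finally show ?case .
qed

lemma coeff_pcompose_linear:
  fixes p :: "'a::comm_ring_1 poly"
  assumes "degree p \<le> d"
  shows "coeff (pcompose p q) k = (\<Sum>i\<le>d. coeff p i * coeff (q ^ i) k)"
proof -
  have "pcompose p q = (\<Sum>i\<le>degree p. [:coeff p i:] * q ^ i)"
    unfolding pcompose_altdef poly_altdef by (simp add: degree_map_poly coeff_map_poly)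
  also have "\<dots> = (\<Sum>i\<le>d. [:coeff p i:] * q ^ i)"
    using assms by (intro sum.mono_neutral_left) (auto simp: coeff_eq_0)
  finally show ?thesis by (simp add: coeff_sum)
qed

text \<open>Move the root \<open>z0\<close> to the origin. The constant coefficient of the shifted
  polynomials then tends to 0 while some other coefficient stays away from 0, which
  \<open>coeff_bound_by_roots\<close> forbids if no root is near. Only a bound on the degrees of
  \<open>P t\<close> is fixed, because leading coefficients may tend to 0.\<close>

lemma root_continuity:
  fixes P :: "'a \<Rightarrow> complex poly"
  assumes lim: "\<And>k. ((\<lambda>t. coeff (P t) k) \<longlongrightarrow> coeff Q k) F"
    and deg: "\<And>t. degree (P t) \<le> d" and "Q \<noteq> 0" and root: "poly Q z0 = 0" and e: "e > 0"
  shows "\<forall>\<^sub>F t in F. \<exists>z. norm (z - z0) < e \<and> poly (P t) z = 0"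
proof -
  let ?s = "[:z0, 1:]"
  define D where "D = max d (degree Q)"
  have l: "((\<lambda>t. coeff (pcompose (P t) ?s) k) \<longlongrightarrow> coeff (pcompose Q ?s) k) F" for k
  proof -
    have "((\<lambda>t. \<Sum>i\<le>D. coeff (P t) i * coeff (?s ^ i) k) \<longlongrightarrow> (\<Sum>i\<le>D. coeff Q i * coeff (?s ^ i) k)) F"
      by (intro tendsto_intros lim)
    then show ?thesis
      using deg by (subst (1 2) coeff_pcompose_linear[where d = D]) (auto simp: D_def max.coboundedI1)
  qed
  have "pcompose Q ?s \<noteq> 0" using \<open>Q \<noteq> 0\<close> by (simp add: pcompose_eq_0_iff)
  then obtain k where k: "coeff (pcompose Q ?s) k \<noteq> 0" by (metis leading_coeff_0_iff)
  have c0: "coeff (pcompose Q ?s) 0 = 0" using root by simp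
  let ?C = "(1 + 1 / e) ^ d"
  have "((\<lambda>t. norm (coeff (pcompose (P t) ?s) k) - norm (coeff (pcompose (P t) ?s) 0) * ?C)
      \<longlongrightarrow> norm (coeff (pcompose Q ?s) k) - norm (coeff (pcompose Q ?s) 0) * ?C) F"
    by (intro tendsto_intros l)
  then have "\<forall>\<^sub>F t in F. norm (coeff (pcompose (P t) ?s) k) - norm (coeff (pcompose (P t) ?s) 0) * ?C > 0"
    using k c0 by (intro order_tendstoD) auto
  then show ?thesis
  proof eventually_elim
    case (elim t)
    show ?case
    proof (rule ccontr)
      assume *: "\<nexists>z. norm (z - z0) < e \<and> poly (P t) z = 0"
      have "norm x \<ge> e" if "poly (pcompose (P t) ?s) x = 0" for x
        using * that by (auto simp: poly_pcompose dest!: spec[of _ "z0 + x"])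
      then have "norm (coeff (pcompose (P t) ?s) k) \<le> norm (coeff (pcompose (P t) ?s) 0) * (1 + 1 / e) ^ degree (pcompose (P t) ?s)"
        using e by (intro coeff_bound_by_roots)
      also have "\<dots> \<le> norm (coeff (pcompose (P t) ?s) 0) * ?C"
        using deg[of t] e by (intro mult_left_mono power_increasing) (auto simp: degree_pcompose)
      finally show False using elim by simp
    qed
  qed
qed

section \<open>Evaluation and slices of polynomials in two variables\<close>

definition ev :: "complex poly poly \<Rightarrow> complex \<Rightarrow> complex \<Rightarrow> complex" where
  "ev p z w = poly (poly p [:w:]) z"

definition slice :: "complex \<Rightarrow> complex poly poly \<Rightarrow> complex poly" where
  "slice z p = map_poly (\<lambda>c. poly c z) p"

lemma mem_zero_set [simp]: "(z, w) \<in> zero_set p \<longleftrightarrow> ev p z w = 0"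
  by (simp add: zero_set_def ev_def)

lemma ev_simps [simp]:
  "ev 0 z w = 0" "ev 1 z w = 1" "ev (p + q) z w = ev p z w + ev q z w"
  "ev (p - q) z w = ev p z w - ev q z w" "ev (- p) z w = - ev p z w"
  "ev (p * q) z w = ev p z w * ev q z w" "ev (pCons c p) z w = poly c z + w * ev p z w"
  "ev (p ^ k) z w = ev p z w ^ k" "ev (Polynomial.smult c p) z w = poly c z * ev p z w"
  by (simp_all add: ev_def poly_power)

lemma ev_sum: "ev (\<Sum>i\<in>A. f i) z w = (\<Sum>i\<in>A. ev (f i) z w)"
  by (simp add: ev_def poly_sum)

lemma ev_prod: "ev (\<Prod>i\<in>A. f i) z w = (\<Prod>i\<in>A. ev (f i) z w)"
  by (simp add: ev_def poly_prod)

lemma ev_monom [simp]: "ev (monom c k) z w = poly c z * w ^ k"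
  by (simp add: ev_def poly_monom poly_power)

lemma coeff_slice [simp]: "coeff (slice z p) k = poly (coeff p k) z"
  by (simp add: slice_def coeff_map_poly)

lemma poly_slice [simp]: "poly (slice z p) w = ev p z w"
proof (induction p)
  case (pCons a p)
  have "slice z (pCons a p) = pCons (poly a z) (slice z p)"
    by (rule poly_eqI) (simp add: coeff_pCons split: nat.splits)
  then show ?case using pCons by simp
qed (simp add: slice_def)

lemma degree_slice_le: "degree (slice z p) \<le> degree p"
  by (rule degree_le) (simp add: coeff_eq_0)

lemma slice_mult [simp]: "slice z (p * q) = slice z p * slice z q"
proof -
  have "poly (slice z (p * q)) = poly (slice z p * slice z q)" by (rule ext) simp
  then show ?thesis by (simp only: poly_eq_poly_eq_iff)
qed

lemma ev_altdef: "ev p z w = (\<Sum>k\<le>degree p. poly (coeff p k) z * w ^ k)"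
  by (subst poly_slice[symmetric], subst poly_as_sum_of_monoms'[OF degree_slice_le, symmetric]) (simp add: poly_sum poly_monom)

lemma continuous_on_ev [continuous_intros]:
  assumes "continuous_on S f" "continuous_on S g"
  shows "continuous_on S (\<lambda>x. ev p (f x) (g x))"
  unfolding ev_altdef by (intro continuous_intros assms continuous_on_poly)

text \<open>Bezout's identity over C(z) with denominators cleared. By pseudo-division, an element h
  of least degree in w of the ideal of f and g divides both f and g up to factors in C[z]. As f is
  prime and does not divide g, this h has degree 0.\<close>

lemma irreducible_elimination:
  fixes f g :: "complex poly poly"
  assumes irr: "irreducible f" and deg: "degree f > 0" and nd: "\<not> f dvd g"
  shows "\<exists>u v r. r \<noteq> 0 \<and> u * f + v * g = [:r:]"
proof -
  define I where "I = {u * f + v * g | u v. True}"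
  have fI: "f \<in> I" unfolding I_def by (rule CollectI, intro exI[of _ 1] exI[of _ 0]) simp
  have gI: "g \<in> I" unfolding I_def by (rule CollectI, intro exI[of _ 0] exI[of _ 1]) simp
  have lin: "a * x + b * y \<in> I" if "x \<in> I" "y \<in> I" for a b x y
  proof -
    from that obtain u v u' v' where "x = u * f + v * g" "y = u' * f + v' * g" unfolding I_def by auto
    then have "a * x + b * y = (a * u + b * u') * f + (a * v + b * v') * g" by (simp add: algebra_simps)
    then show ?thesis unfolding I_def by blast
  qed
  have "\<exists>h. (h \<in> I \<and> h \<noteq> 0) \<and> (\<forall>h'. h' \<in> I \<and> h' \<noteq> 0 \<longrightarrow> degree h \<le> degree h')"
    by (rule ex_has_least_nat[of _ f]) (use fI irr in auto)
  then obtain h where h: "h \<in> I" "h \<noteq> 0" and min: "\<And>h'. h' \<in> I \<Longrightarrow> h' \<noteq> 0 \<Longrightarrow> degree h \<le> degree h'" by blast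
  have div: "\<exists>c a. c \<noteq> 0 \<and> [:c:] * x = h * a" if "x \<in> I" for x
  proof -
    obtain a b where ab: "pseudo_divmod x h = (a, b)" by force
    note pd = pseudo_divmod[OF h(2) ab]
    define c where "c = lead_coeff h ^ (Suc (degree x) - degree h)"
    have eq: "[:c:] * x = h * a + b" using pd(1) by (simp add: c_def)
    then have b: "b = [:c:] * x + (- a) * h" by (simp add: algebra_simps)
    have "b \<in> I" unfolding b by (rule lin[OF that h(1)])
    then have "b = 0" using pd(2) min by fastforce
    moreover have "c \<noteq> 0" unfolding c_def using h(2) by simp
    ultimately show ?thesis using eq by auto
  qed
  have pr: "prime_elem f" using irr by (rule irreducible_imp_prime_elem)
  have nc: "\<not> f dvd [:c:]" if "c \<noteq> 0" for c
    using dvd_imp_degree_le[of f "[:c:]"] deg that by auto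
  obtain c a where ca: "c \<noteq> 0" "[:c:] * f = h * a" using div[OF fI] by blast
  obtain c' a' where ca': "c' \<noteq> 0" "[:c':] * g = h * a'" using div[OF gI] by blast
  \<comment> \<open>Otherwise f would divide g up to a nonzero factor in z alone, and f cannot
    divide that factor because its own degree in w is positive.\<close>
  have "\<not> f dvd h"
  proof
    assume "f dvd h"
    then have "f dvd [:c':] * g" unfolding ca'(2) by simp
    then show False using prime_elem_dvd_multD[OF pr] nd nc[OF ca'(1)] by blast
  qed
  moreover have "f dvd h * a" by (metis ca(2) dvd_triv_right)
  ultimately have "f dvd a" using prime_elem_dvd_multD[OF pr] by blast
  then obtain b where "a = f * b" by auto
  then have "f * [:c:] = f * (h * b)" using ca(2) by (simp add: mult_ac)
  then have "[:c:] = h * b" using irr by (metis mult_cancel_left not_irreducible_zero)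
  then have "degree h = 0"
    using ca(1) by (metis degree_mult_eq_0 degree_pCons_0 mult_eq_0_iff pCons_eq_0_iff)
  then obtain r where r: "h = [:r:]" by (metis degree_eq_zeroE)
  obtain u v where uv: "h = u * f + v * g" using h(1) unfolding I_def by auto
  have "r \<noteq> 0 \<and> u * f + v * g = [:r:]" using h(2) r uv by simp
  then show ?thesis by (intro exI)
qed

text \<open>The eliminant vanishes at the z-coordinate of every common zero. The lemma serves to
  discard finitely many z and, contrapositively, to obtain \<open>f dvd g\<close> from infinitely
  many common zeros.\<close>

lemma irreducible_common_zeros:
  assumes "irreducible f" "degree f > 0" "\<not> f dvd g"
  shows "finite {z. \<exists>w. ev f z w = 0 \<and> ev g z w = 0}"
proof -
  obtain u v r where r: "r \<noteq> 0" "u * f + v * g = [:r:]" using irreducible_elimination[OF assms] by auto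
  have rz: "poly r z = 0" if "ev f z w = 0" "ev g z w = 0" for z w
    using arg_cong[OF r(2), of "\<lambda>p. ev p z w"] that by simp
  show ?thesis by (rule finite_subset[OF _ poly_roots_finite[OF r(1)]]) (use rz in blast)
qed

lemma ev_root_continuity_w:
  assumes "slice z0 p \<noteq> 0" "ev p z0 w0 = 0" "e > 0"
  shows "\<forall>\<^sub>F z in at z0. \<exists>w. norm (w - w0) < e \<and> ev p z w = 0"
proof -
  have "\<forall>\<^sub>F z in at z0. \<exists>w. norm (w - w0) < e \<and> poly (slice z p) w = 0"
  proof (rule root_continuity[where Q = "slice z0 p" and d = "degree p"])
    show "((\<lambda>z. coeff (slice z p) k) \<longlongrightarrow> coeff (slice z0 p) k) (at z0)" for k
      by (auto intro!: tendsto_intros)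
  qed (use assms degree_slice_le in auto)
  then show ?thesis by simp
qed

lemma ev_root_continuity_z:
  assumes "poly p [:w0:] \<noteq> 0" "ev p z0 w0 = 0" "e > 0"
  shows "\<forall>\<^sub>F w in at w0. \<exists>z. norm (z - z0) < e \<and> ev p z w = 0"
  unfolding ev_def
\<comment> \<open>The polynomial in z varies with w; the sum of the degrees of all coefficients
  bounds its degree for every w at once.\<close>
proof (rule root_continuity[where Q = "poly p [:w0:]" and d = "\<Sum>k\<le>degree p. degree (coeff p k)"])
  have c: "coeff (poly p [:w:]) k = (\<Sum>i\<le>degree p. coeff (coeff p i) k * w ^ i)" for w k
    unfolding poly_altdef coeff_sum by (simp add: mult.commute poly_const_pow)
  show "((\<lambda>w. coeff (poly p [:w:]) k) \<longlongrightarrow> coeff (poly p [:w0:]) k) (at w0)" for k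
    unfolding c by (intro tendsto_intros)
  show "degree (poly p [:w:]) \<le> (\<Sum>k\<le>degree p. degree (coeff p k))" for w
  proof (rule degree_le, intro allI impI)
    fix i assume i: "(\<Sum>k\<le>degree p. degree (coeff p k)) < i"
    have "coeff (coeff p k) i = 0" if "k \<le> degree p" for k
      using i member_le_sum[of k "{..degree p}" "\<lambda>k. degree (coeff p k)"] that by (intro coeff_eq_0) auto
    then show "coeff (poly p [:w:]) i = 0" unfolding c by simp
  qed
qed (use assms in \<open>auto simp: ev_def\<close>)

lemma frontier_bidisc:
  "(z, w) \<in> frontier bidisc \<longleftrightarrow> norm z \<le> 1 \<and> norm w \<le> 1 \<and> (norm z = 1 \<or> norm w = 1)"
proof -
  have "frontier bidisc = cball 0 1 \<times> cball 0 1 - unit_disc \<times> unit_disc"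
    unfolding frontier_def by (subst interior_open) (simp_all add: open_Times closure_Times)
  then show ?thesis by (auto simp: not_less)
qed

section \<open>Circle means\<close>

text \<open>With the factor 2 pi in the exponent, integrals over [0, 1] are means over the circle
  and need no normalisation.\<close>

definition circ :: "real \<Rightarrow> real \<Rightarrow> complex" where
  "circ r t = of_real r * exp (2 * of_real pi * \<i> * of_real t)"

lemma norm_circ [simp]: "norm (circ r t) = \<bar>r\<bar>"
  by (simp add: circ_def norm_mult norm_exp_eq_Re)

lemma continuous_on_circ [continuous_intros]: "continuous_on S (circ r)"
  unfolding circ_def by (intro continuous_intros)

lemma circ_nonzero: "r > 0 \<Longrightarrow> circ r t \<noteq> 0"
  by (simp add: circ_def)

text \<open>Along the circle dz = 2 pi i z dt, which accounts for the extra factor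
  \<open>circ r t\<close> in the integrand.\<close>

lemma contour_integral_circ:
  assumes "(g has_contour_integral (2 * pi * \<i> * I)) (circlepath 0 r)"
  shows "((\<lambda>t. circ r t * g (circ r t)) has_integral I) {0..1}"
proof -
  have "((\<lambda>x. g (circlepath 0 r x) * vector_derivative (circlepath 0 r) (at x within {0..1})) has_integral (2 * pi * \<i> * I)) {0..1}"
    using assms by (simp add: has_contour_integral_def)
  then have "((\<lambda>x. 2 * pi * \<i> * (circ r x * g (circ r x))) has_integral (2 * pi * \<i> * I)) {0..1}"
  proof (rule has_integral_eq[rotated])
    fix x :: real assume "x \<in> {0..1}"
    then show "g (circlepath 0 r x) * vector_derivative (circlepath 0 r) (at x within {0..1}) =
        2 * pi * \<i> * (circ r x * g (circ r x))"
      by (subst vector_derivative_circlepath01) (simp_all add: circ_def circlepath mult_ac)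
  qed
  from has_integral_mult_right[OF this, of "1 / (2 * pi * \<i>)"] show ?thesis by simp
qed

lemma circle_mean_coeff:
  assumes "r > 0" "continuous_on (cball 0 r) f" "f holomorphic_on ball 0 r"
  shows "((\<lambda>t. f (circ r t) / circ r t ^ k) has_integral ((deriv ^^ k) f 0 / fact k)) {0..1}"
proof -
  have "((\<lambda>u. f u / (u - 0) ^ Suc k) has_contour_integral ((2 * pi * \<i>) / (fact k) * (deriv ^^ k) f 0)) (circlepath 0 r)"
    using assms by (intro Cauchy_has_contour_integral_higher_derivative_circlepath) auto
  then have "((\<lambda>t. circ r t * (f (circ r t) / (circ r t - 0) ^ Suc k)) has_integral ((deriv ^^ k) f 0 / fact k)) {0..1}"
    by (intro contour_integral_circ) (simp add: field_simps)
  then show ?thesis using circ_nonzero[OF assms(1)] by (simp add: field_simps)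
qed

lemma circle_mean_power_mult:
  assumes "r > 0" "continuous_on (cball 0 r) f" "f holomorphic_on ball 0 r" "k > 0"
  shows "((\<lambda>t. circ r t ^ k * f (circ r t)) has_integral 0) {0..1}"
proof -
  have "((\<lambda>t. (\<lambda>z. z ^ k * f z) (circ r t) / circ r t ^ 0) has_integral ((deriv ^^ 0) (\<lambda>z. z ^ k * f z) 0 / fact 0)) {0..1}"
    using assms by (intro circle_mean_coeff) (auto intro!: continuous_intros holomorphic_intros)
  moreover have "(0::complex) ^ k = 0" using assms(4) by simp
  ultimately show ?thesis by simp
qed

lemma circle_mean_Cauchy:
  assumes "norm a \<noteq> 1"
  shows "((\<lambda>t. circ 1 t * poly p (circ 1 t) / (circ 1 t - a)) has_integral (if norm a < 1 then poly p a else 0)) {0..1}"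
proof (cases "norm a < 1")
  case True
  have "((\<lambda>u. poly p u / (u - a)) has_contour_integral (2 * of_real pi * \<i> * poly p a)) (circlepath 0 1)"
    by (rule Cauchy_integral_circlepath) (use True in \<open>auto intro!: continuous_intros holomorphic_intros\<close>)
  with True contour_integral_circ[of "\<lambda>u. poly p u / (u - a)" "poly p a" 1] show ?thesis by simp
next
  case False
  then have "norm a > 1" using assms by simp
  \<comment> \<open>For an outer pole the integrand is z times a function holomorphic in the disc,
    so its mean is the value at 0.\<close>
  then have "((\<lambda>t. circ 1 t ^ 1 * (\<lambda>z. poly p z / (z - a)) (circ 1 t)) has_integral 0) {0..1}"
    by (intro circle_mean_power_mult) (auto intro!: continuous_intros holomorphic_intros)
  then show ?thesis using False by simp
qed

text \<open>The argument principle weighted by \<phi>: for squarefree p the quotient p' / p is the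
  sum of 1 / (w - a) over the roots, and each term is a Cauchy integral.\<close>

lemma circle_mean_log_deriv:
  fixes p :: "complex poly"
  assumes sq: "rsquarefree p" and nz: "\<And>a. poly p a = 0 \<Longrightarrow> norm a \<noteq> 1"
  shows "((\<lambda>t. circ 1 t * poly \<phi> (circ 1 t) * poly (pderiv p) (circ 1 t) / poly p (circ 1 t))
    has_integral (\<Sum>a | poly p a = 0 \<and> norm a < 1. poly \<phi> a)) {0..1}"
proof -
  have "p \<noteq> 0" using sq by (auto simp: rsquarefree_def)
  define A where "A = {a. poly p a = 0}"
  have fin: "finite A" unfolding A_def using \<open>p \<noteq> 0\<close> by (rule poly_roots_finite)
  define P where "P = (\<lambda>a::complex. [:- a, 1:])"
  have p: "p = Polynomial.smult (lead_coeff p) (prod P A)"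
    using complex_poly_decompose_rsquarefree[OF sq] by (simp add: A_def P_def)
  have "pderiv p = Polynomial.smult (lead_coeff p) (\<Sum>a\<in>A. prod P (A - {a}))"
    by (subst p) (simp add: pderiv_smult pderiv_prod P_def pderiv_pCons)
  then have frac: "poly (pderiv p) w / poly p w = (\<Sum>a\<in>A. 1 / (w - a))" if "w \<notin> A" for w
  proof -
    have "poly p w = lead_coeff p * (\<Prod>a\<in>A. w - a)" by (subst p) (simp add: poly_prod P_def)
    moreover have "poly (pderiv p) w = lead_coeff p * (\<Sum>a\<in>A. \<Prod>b\<in>A - {a}. w - b)"
      using \<open>pderiv p = _\<close> by (simp add: poly_sum poly_prod P_def)
    ultimately have "poly (pderiv p) w / poly p w = (\<Sum>a\<in>A. (\<Prod>b\<in>A - {a}. w - b) / (\<Prod>a\<in>A. w - a))"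
      using \<open>p \<noteq> 0\<close> by (simp add: sum_divide_distrib)
    also have "\<dots> = (\<Sum>a\<in>A. 1 / (w - a))"
    proof (rule sum.cong[OF refl])
      fix a assume a: "a \<in> A"
      have "(\<Prod>b\<in>A. w - b) = (w - a) * (\<Prod>b\<in>A - {a}. w - b)" using fin a by (rule prod.remove)
      moreover have "(\<Prod>b\<in>A - {a}. w - b) \<noteq> 0" using fin that by auto
      ultimately show "(\<Prod>b\<in>A - {a}. w - b) / (\<Prod>b\<in>A. w - b) = 1 / (w - a)" by simp
    qed
    finally show ?thesis .
  qed
  have "((\<lambda>t. \<Sum>a\<in>A. circ 1 t * poly \<phi> (circ 1 t) / (circ 1 t - a)) has_integral
      (\<Sum>a\<in>A. if norm a < 1 then poly \<phi> a else 0)) {0..1}"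
    using nz by (intro has_integral_sum fin circle_mean_Cauchy) (auto simp: A_def)
  moreover have "(\<Sum>a\<in>A. if norm a < 1 then poly \<phi> a else 0) = (\<Sum>a | poly p a = 0 \<and> norm a < 1. poly \<phi> a)"
    using fin by (subst sum.inter_filter[symmetric]) (auto simp: A_def)
  moreover have "(\<Sum>a\<in>A. circ 1 t * poly \<phi> (circ 1 t) / (circ 1 t - a)) =
      circ 1 t * poly \<phi> (circ 1 t) * poly (pderiv p) (circ 1 t) / poly p (circ 1 t)" for t
  proof -
    have "circ 1 t \<notin> A" using nz[of "circ 1 t"] norm_circ[of 1 t] unfolding A_def by auto
    from frac[OF this] have "circ 1 t * poly \<phi> (circ 1 t) * poly (pderiv p) (circ 1 t) / poly p (circ 1 t) =
        circ 1 t * poly \<phi> (circ 1 t) * (\<Sum>a\<in>A. 1 / (circ 1 t - a))"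
      by (simp only: times_divide_eq_right[symmetric])
    then show ?thesis by (simp add: sum_distrib_left)
  qed
  ultimately show ?thesis by simp
qed

text \<open>On the circle of radius r, the function z ^ M * cnj (h z) has no Fourier coefficient of index above M.\<close>

lemma holomorphic_reflection_imp_poly:
  assumes g: "g holomorphic_on ball 0 1" and h: "h holomorphic_on ball 0 1"
    and near: "\<And>e. e > 0 \<Longrightarrow> \<exists>\<rho><1. \<forall>z. \<rho> < norm z \<and> norm z < 1 \<longrightarrow> norm (g z - z ^ M * cnj (h z)) \<le> e"
  shows "\<exists>P. \<forall>z\<in>ball 0 1. g z = poly P z"
proof -
  define a where "a = (\<lambda>l. (deriv ^^ l) g 0 / fact l)"
  have a0: "a l = 0" if l: "l > M" for l
  proof -
    have "norm (a l) \<le> e * 2 ^ l" if e: "e > 0" for e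
    proof -
      obtain \<rho> where \<rho>: "\<rho> < 1" "\<And>z. \<rho> < norm z \<Longrightarrow> norm z < 1 \<Longrightarrow> norm (g z - z ^ M * cnj (h z)) \<le> e"
        using near[OF e] by blast
      \<comment> \<open>This radius lies in the annulus where the estimate holds, and being at least
        1/2 it keeps 1 / r^l below 2^l, a bound independent of e.\<close>
      define r where "r = (max \<rho> (1/2) + 1) / 2"
      have r: "\<rho> < r" "r < 1" "r \<ge> 1/2" using \<rho>(1) by (auto simp: r_def max_def)
      have sub: "cball 0 r \<subseteq> ball (0::complex) 1" using r by auto
      have i1: "((\<lambda>t. g (circ r t) / circ r t ^ l) has_integral a l) {0..1}"
        unfolding a_def using r sub
        by (intro circle_mean_coeff) (auto intro: holomorphic_on_imp_continuous_on holomorphic_on_subset[OF g])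
      have "((\<lambda>t. circ r t ^ (l - M) * h (circ r t)) has_integral 0) {0..1}"
        using r sub l by (intro circle_mean_power_mult)
          (auto intro: holomorphic_on_imp_continuous_on holomorphic_on_subset[OF h])
      then have "(cnj \<circ> (\<lambda>t. circ r t ^ (l - M) * h (circ r t)) has_integral cnj 0) {0..1}"
        by (subst has_integral_cnj)
      from has_integral_mult_right[OF this, of "1 / r ^ (2 * (l - M))"]
      have "((\<lambda>t. circ r t ^ M * cnj (h (circ r t)) / circ r t ^ l) has_integral 0) {0..1}"
      proof (rule has_integral_eq_rhs[OF has_integral_eq, rotated])
        fix t :: real
        define c where "c = circ r t"
        have c: "c \<noteq> 0" "c * cnj c = r ^ 2"
          using r circ_nonzero[of r t] complex_norm_square[of c] by (auto simp: c_def)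
        \<comment> \<open>On the circle of radius r conjugation is z |-> r^2 / z, so the conjugate
          of z^(l - M) h is a constant multiple of z^M cnj (h z) / z^l.\<close>
        have "cnj c = r ^ 2 / c" using c by (simp add: field_simps)
        then have "cnj c ^ (l - M) / r ^ (2 * (l - M)) = 1 / c ^ (l - M)"
          using r by (simp add: power_divide power_mult)
        moreover have "c ^ l = c ^ M * c ^ (l - M)" using l by (simp flip: power_add)
        ultimately show "1 / r ^ (2 * (l - M)) * (cnj \<circ> (\<lambda>t. circ r t ^ (l - M) * h (circ r t))) t =
            circ r t ^ M * cnj (h (circ r t)) / circ r t ^ l"
          using c(1) by (simp add: c_def[symmetric] field_simps)
      qed simp
      from has_integral_diff[OF i1 this]
      have "((\<lambda>t. (g (circ r t) - circ r t ^ M * cnj (h (circ r t))) / circ r t ^ l) has_integral a l) (cbox 0 1)"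
        by (simp add: diff_divide_distrib)
      then have "norm (a l) \<le> (e * 2 ^ l) * content (cbox 0 (1::real))"
      proof (rule has_integral_bound[rotated])
        fix t :: real
        have "norm (g (circ r t) - circ r t ^ M * cnj (h (circ r t))) \<le> e"
          using r by (intro \<rho>) auto
        moreover have "1 / r ^ l \<le> 2 ^ l"
          using power_mono[of "1 / 2" r l] r by (simp add: field_simps power_divide)
        ultimately have "norm (g (circ r t) - circ r t ^ M * cnj (h (circ r t))) * (1 / r ^ l) \<le> e * 2 ^ l"
          using e r by (intro mult_mono) auto
        then show "norm ((g (circ r t) - circ r t ^ M * cnj (h (circ r t))) / circ r t ^ l) \<le> e * 2 ^ l"
          using r by (simp add: norm_divide norm_power)
      qed (use e in auto)
      then show ?thesis by simp
    qed
    then have "norm (a l) / 2 ^ l \<le> e" if "e > 0" for e using that by (simp add: field_simps)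
    then have "norm (a l) / 2 ^ l \<le> 0" by (rule field_le_epsilon) simp
    then show ?thesis by (simp add: field_simps)
  qed
  have "g z = poly (\<Sum>l\<le>M. monom (a l) l) z" if "z \<in> ball 0 1" for z
  proof -
    have "(\<lambda>n. a n * (z - 0) ^ n) sums g z"
      unfolding a_def using holomorphic_power_series[OF g that] .
    moreover have "(\<lambda>n. a n * (z - 0) ^ n) sums (\<Sum>n\<le>M. a n * (z - 0) ^ n)"
      by (rule sums_finite) (auto simp: a0)
    ultimately have "g z = (\<Sum>n\<le>M. a n * (z - 0) ^ n)" by (rule sums_unique2)
    then show ?thesis by (simp add: poly_sum poly_monom)
  qed
  then show ?thesis by blast
qed

definition dz :: "complex poly poly \<Rightarrow> complex poly poly" where
  "dz p = map_poly pderiv p"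

lemma ev_has_field_derivative [derivative_intros]:
  "((\<lambda>z. ev p z w) has_field_derivative ev (dz p) z w) (at z within S)"
proof (induction p)
  case (pCons a p)
  have "dz (pCons a p) = pCons (pderiv a) (dz p)"
    by (rule poly_eqI) (simp add: dz_def coeff_map_poly coeff_pCons split: nat.splits)
  then show ?case using pCons
    by (auto intro!: derivative_eq_intros has_field_derivative_at_within[OF poly_DERIV])
qed (simp add: dz_def)

text \<open>Differentiation under the integral sign. It gives holomorphy at every z in U, including
  those over which roots of p coincide.\<close>

lemma circle_mean_holomorphic:
  assumes nz: "\<And>z w. z \<in> U \<Longrightarrow> norm w = 1 \<Longrightarrow> ev p z w \<noteq> 0" and U: "convex U"
  shows "(\<lambda>z. integral {0..1} (\<lambda>t. ev a z (circ 1 t) / ev p z (circ 1 t))) holomorphic_on U"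
proof -
  have "(\<lambda>z. integral (cbox 0 1) (\<lambda>t. ev a z (circ 1 t) / ev p z (circ 1 t))) holomorphic_on U"
  proof (rule leibniz_rule_holomorphic[OF _ _ _ U])
    fix z t assume z: "z \<in> U" and t: "t \<in> cbox (0::real) 1"
    show "((\<lambda>z. ev a z (circ 1 t) / ev p z (circ 1 t)) has_field_derivative
        ((ev (dz a) z (circ 1 t) * ev p z (circ 1 t) - ev a z (circ 1 t) * ev (dz p) z (circ 1 t)) /
          (ev p z (circ 1 t) * ev p z (circ 1 t)))) (at z within U)"
      by (rule DERIV_divide) (auto intro!: derivative_intros simp: nz[OF z])
  next
    fix z assume z: "z \<in> U"
    show "(\<lambda>t. ev a z (circ 1 t) / ev p z (circ 1 t)) integrable_on cbox 0 1"
      by (rule integrable_continuous) (auto intro!: continuous_intros simp: nz[OF z])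
  next
    show "continuous_on (U \<times> cbox 0 1) (\<lambda>(z, t).
        (ev (dz a) z (circ 1 t) * ev p z (circ 1 t) - ev a z (circ 1 t) * ev (dz p) z (circ 1 t)) /
          (ev p z (circ 1 t) * ev p z (circ 1 t)))"
      unfolding case_prod_unfold
      by (auto intro!: continuous_intros continuous_on_compose2[OF continuous_on_circ[of UNIV]] simp: nz)
  qed
  then show ?thesis by simp
qed

section \<open>Irreducible equations of distinguished varieties\<close>

lemma eventually_at_avoid_finite:
  assumes "finite S"
  shows "\<forall>\<^sub>F z in at (z0::complex). z \<notin> S"
proof -
  have "open (- (S - {z0}))" using assms by (intro open_Compl finite_imp_closed) simp
  then show ?thesis unfolding eventually_at_topological by (intro exI[of _ "- (S - {z0})"]) simp
qed

lemma infinite_unit_circle: "infinite unit_circle"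
proof
  assume "finite unit_circle"
  moreover have "circ 1 ` {0<..<1} \<subseteq> unit_circle" by auto
  moreover have "inj_on (circ 1) {0<..<1}"
  proof (rule inj_onI)
    fix s t :: real assume st: "s \<in> {0<..<1}" "t \<in> {0<..<1}" and "circ 1 s = circ 1 t"
    then have "exp (2 * of_real pi * \<i> * of_real s) = exp (2 * of_real pi * \<i> * of_real t)" by (simp add: circ_def)
    then obtain k :: int where "2 * of_real pi * \<i> * of_real s = 2 * of_real pi * \<i> * of_real t + (of_int (2 * k) * pi) * \<i>"
      unfolding exp_eq by blast
    from arg_cong[OF this, of Im] have "pi * (2 * s) = pi * (2 * t + 2 * of_int k)" by (simp add: algebra_simps)
    then have "s = t + of_int k" by simp
    moreover from this st have "real_of_int k < 1" "real_of_int k > -1" by auto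
    then have "k = 0" by linarith
    ultimately show "s = t" by simp
  qed
  ultimately have "finite {0<..<1::real}" by (meson finite_imageD finite_subset)
  then show False by (simp add: infinite_Ioo)
qed

text \<open>The reciprocal polynomial for the formal degree m. Leaving m free allows polynomials of
  different degrees to be reflected with the same power of z.\<close>

definition cnj_reflect :: "nat \<Rightarrow> complex poly \<Rightarrow> complex poly" where
  "cnj_reflect m c = (\<Sum>i\<le>m. monom (cnj (coeff c (m - i))) i)"

lemma coeff_cnj_reflect: "coeff (cnj_reflect m c) i = (if i \<le> m then cnj (coeff c (m - i)) else 0)"
  unfolding cnj_reflect_def coeff_sum coeff_monom by (simp add: sum.delta)

lemma degree_cnj_reflect: "degree (cnj_reflect m c) \<le> m"
  by (rule degree_le) (simp add: coeff_cnj_reflect)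

lemma poly_altdef_bound:
  fixes c :: "complex poly"
  shows "degree c \<le> m \<Longrightarrow> poly c z = (\<Sum>i\<le>m. coeff c i * z ^ i)"
  unfolding poly_altdef by (rule sum.mono_neutral_left) (auto simp: coeff_eq_0)

lemma poly_cnj_reflect:
  assumes "degree c \<le> m" "z \<noteq> 0"
  shows "poly (cnj_reflect m c) z = z ^ m * cnj (poly c (1 / cnj z))"
proof -
  have "poly (cnj_reflect m c) z = (\<Sum>i\<le>m. cnj (coeff c (m - i)) * z ^ i)"
    by (simp add: cnj_reflect_def poly_sum poly_monom)
  also have "\<dots> = (\<Sum>i\<le>m. cnj (coeff c i) * z ^ (m - i))"
    by (rule sum.reindex_bij_witness[of _ "\<lambda>i. m - i" "\<lambda>i. m - i"]) auto
  also have "\<dots> = (\<Sum>i\<le>m. z ^ m * (cnj (coeff c i) * (1 / z) ^ i))"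
    using assms(2) by (intro sum.cong) (auto simp: power_diff power_divide)
  also have "\<dots> = z ^ m * cnj (poly c (1 / cnj z))"
    unfolding poly_altdef_bound[OF assms(1)] by (simp add: sum_distrib_left)
  finally show ?thesis .
qed

lemma inverse_cnj_circle: "norm z = 1 \<Longrightarrow> 1 / cnj z = z"
  using complex_norm_square[of z] by (cases "z = 0") (auto simp: divide_eq_eq)

lemma slice_pderiv: "slice z (pderiv p) = pderiv (slice z p)"
  by (rule poly_eqI) (simp add: coeff_pderiv)

lemma power_difference_sum:
  fixes x y :: "'a::comm_ring_1"
  shows "x ^ n - y ^ n = (x - y) * (\<Sum>k<n. x ^ k * y ^ (n - 1 - k))"
proof (cases n)
  case (Suc m)
  then show ?thesis using power_diff_sumr2[of x n y] by (simp add: mult_ac)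
qed simp

text \<open>At the frontier only an inclusion is demanded, because this is what an irreducible
  factor inherits from the whole variety.\<close>

locale boundary_curve =
  fixes f :: "complex poly poly"
  assumes irr: "irreducible f"
    and meets: "zero_set f \<inter> bidisc \<noteq> {}"
    and bd: "zero_set f \<inter> frontier bidisc \<subseteq> torus"
begin

abbreviation (input) "n \<equiv> degree f"

lemma bd_in: "norm z < 1 \<Longrightarrow> norm w = 1 \<Longrightarrow> ev f z w \<noteq> 0"
  using bd frontier_bidisc[of z w] by (auto simp: subset_iff)

lemma bd_out: "norm z = 1 \<Longrightarrow> norm w < 1 \<Longrightarrow> ev f z w \<noteq> 0"
  using bd frontier_bidisc[of z w] by (auto simp: subset_iff)

lemma f_nonzero: "f \<noteq> 0"
  using irr by auto

text \<open>A vertical line in the curve would pass through (z, 1) with z in the disc or through (z,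
  0) with z on the circle, and both are excluded.\<close>

lemma slice_nonzero:
  assumes "norm z \<le> 1"
  shows "slice z f \<noteq> 0"
proof
  assume "slice z f = 0"
  then have "ev f z w = 0" for w using poly_slice[of z f w] by simp
  then show False using bd_in[of z 1] bd_out[of z 0] assms by (cases "norm z = 1") auto
qed

lemma degree_pos: "n > 0"
proof (rule ccontr)
  assume "\<not> n > 0"
  then obtain c where c: "f = [:c:]" by (auto elim: degree_eq_zeroE)
  from meets obtain z w where "norm z < 1" "ev f z w = 0" by auto
  then show False using bd_in[of z 1] c by simp
qed

lemma compact_part: "compact (zero_set f \<inter> cball 0 1 \<times> cball 0 1)"
proof -
  have "zero_set f = {x. ev f (fst x) (snd x) = 0}" by auto
  moreover have "closed {x. ev f (fst x) (snd x) = 0}"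
    by (intro closed_Collect_eq continuous_on_ev continuous_intros)
  ultimately show ?thesis by (intro closed_Int_compact) (auto intro: compact_Times)
qed

text \<open>The points of the disc whose fibre meets the closed disc form a clopen set, since no root crosses the circle.\<close>

lemma closed_disc_root:
  assumes "norm z \<le> 1"
  shows "\<exists>w. norm w \<le> 1 \<and> ev f z w = 0"
proof -
  define A where "A = fst ` (zero_set f \<inter> cball 0 1 \<times> cball 0 1)"
  have A: "z \<in> A \<longleftrightarrow> norm z \<le> 1 \<and> (\<exists>w. norm w \<le> 1 \<and> ev f z w = 0)" for z
    unfolding A_def by (force simp: image_iff)
  have "closed A" unfolding A_def
    by (intro compact_imp_closed compact_continuous_image compact_part continuous_intros)
  have op: "open (ball 0 1 \<inter> A)"
  proof (subst open_subopen, intro ballI)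
    fix z0 assume "z0 \<in> ball 0 1 \<inter> A"
    then obtain w0 where z0: "norm z0 < 1" and w0: "norm w0 \<le> 1" "ev f z0 w0 = 0" using A by auto
    then have w1: "norm w0 < 1" using bd_in[of z0 w0] by fastforce
    have "\<forall>\<^sub>F z in at z0. \<exists>w. norm (w - w0) < 1 - norm w0 \<and> ev f z w = 0"
      using z0 w1 w0 slice_nonzero[of z0] by (intro ev_root_continuity_w) auto
    then obtain T where T: "open T" "z0 \<in> T"
      "\<And>z. z \<in> T \<Longrightarrow> z \<noteq> z0 \<Longrightarrow> \<exists>w. norm (w - w0) < 1 - norm w0 \<and> ev f z w = 0"
      unfolding eventually_at_topological by blast
    have "T \<inter> ball 0 1 \<subseteq> ball 0 1 \<inter> A"
    proof
      fix z assume z: "z \<in> T \<inter> ball 0 1"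
      have "\<exists>w. norm w \<le> 1 \<and> ev f z w = 0"
      proof (cases "z = z0")
        case True then show ?thesis using w0 by blast
      next
        case False
        then obtain w where "norm (w - w0) < 1 - norm w0" "ev f z w = 0" using T(3) z by blast
        then show ?thesis using norm_triangle_sub[of w w0] by (intro exI[of _ w]) auto
      qed
      then show "z \<in> ball 0 1 \<inter> A" using z A by auto
    qed
    then show "\<exists>T. open T \<and> z0 \<in> T \<and> T \<subseteq> ball 0 1 \<inter> A"
      using T z0 by (intro exI[of _ "T \<inter> ball 0 1"]) auto
  qed
  have "openin (top_of_set (ball 0 1)) (ball 0 1 \<inter> A)" using op by (simp add: openin_open_eq)
  moreover have "closedin (top_of_set (ball 0 1)) (ball 0 1 \<inter> A)"
    using \<open>closed A\<close> by (rule closedin_closed_Int)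
  moreover have "ball 0 1 \<inter> A \<noteq> {}"
  proof -
    from meets obtain z w where "norm z < 1" "norm w < 1" "ev f z w = 0" by auto
    then have "z \<in> ball 0 1 \<inter> A" using A[of z] by (auto intro!: exI[of _ w])
    then show ?thesis by blast
  qed
  ultimately have "ball 0 1 \<inter> A = ball (0::complex) 1"
    using connected_ball[of "0::complex" 1] unfolding connected_clopen by blast
  then have "ball 0 1 \<subseteq> A" by blast
  \<comment> \<open>Points of the circle are reached because \<open>A\<close> is closed, being the
    projection of a compact set.\<close>
  then have "closure (ball 0 1) \<subseteq> A" using \<open>closed A\<close> by (rule closure_minimal)
  then have "cball (0::complex) 1 \<subseteq> A" by simp
  then show ?thesis using A[of z] assms by auto
qed

lemma open_disc_root: "norm z < 1 \<Longrightarrow> \<exists>w. norm w < 1 \<and> ev f z w = 0"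
  using closed_disc_root[of z] bd_in[of z] by (metis less_eq_real_def)

definition "m = (MAX k\<in>{..n}. degree (coeff f k))"

lemma degree_coeff_le: "degree (coeff f k) \<le> m"
proof (cases "k \<le> n")
  case True
  then show ?thesis unfolding m_def by (intro Max_ge) auto
qed (simp add: coeff_eq_0)

text \<open>The reciprocal polynomial in both variables at once, for the bidegree (m, n).\<close>

definition "refl_f = (\<Sum>j\<le>n. monom (cnj_reflect m (coeff f (n - j))) j)"

lemma coeff_refl_f: "coeff refl_f j = (if j \<le> n then cnj_reflect m (coeff f (n - j)) else 0)"
  unfolding refl_f_def coeff_sum coeff_monom by (simp add: sum.delta)

lemma ev_refl_f:
  assumes "z \<noteq> 0" "w \<noteq> 0"
  shows "ev refl_f z w = z ^ m * w ^ n * cnj (ev f (1 / cnj z) (1 / cnj w))"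
proof -
  have "ev refl_f z w = (\<Sum>j\<le>n. z ^ m * cnj (poly (coeff f (n - j)) (1 / cnj z)) * w ^ j)"
    using assms degree_coeff_le by (simp add: refl_f_def ev_sum poly_cnj_reflect)
  also have "\<dots> = (\<Sum>j\<le>n. z ^ m * cnj (poly (coeff f j) (1 / cnj z)) * w ^ (n - j))"
    by (rule sum.reindex_bij_witness[of _ "\<lambda>i. n - i" "\<lambda>i. n - i"]) auto
  also have "\<dots> = (\<Sum>j\<le>n. z ^ m * w ^ n * (cnj (poly (coeff f j) (1 / cnj z)) * (1 / w) ^ j))"
    using assms(2) by (intro sum.cong) (auto simp: power_diff power_divide)
  also have "\<dots> = z ^ m * w ^ n * cnj (ev f (1 / cnj z) (1 / cnj w))"
    unfolding ev_altdef by (simp add: sum_distrib_left)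
  finally show ?thesis .
qed

text \<open>Over the circle f has roots in the closed disc; these are unimodular, so the reflection
  fixes the points (z, w). Thus f and its reflection share zeros over infinitely many z, and
  irreducibility gives \<open>f dvd refl_f\<close>. Comparing degrees in w and then in z leaves a
  constant quotient.\<close>

lemma reflection_symmetry: "\<exists>c. c \<noteq> 0 \<and> refl_f = [:[:c:]:] * f"
proof -
  have "ev refl_f z w = 0" if "norm z = 1" "ev f z w = 0" "norm w \<le> 1" for z w
  proof -
    have "norm w = 1" using that bd_out[of z w] by fastforce
    then show ?thesis using that ev_refl_f[of z w] inverse_cnj_circle by fastforce
  qed
  then have "unit_circle \<subseteq> {z. \<exists>w. ev f z w = 0 \<and> ev refl_f z w = 0}"
    using closed_disc_root by auto (metis order_refl)
  then have "f dvd refl_f"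
    using irreducible_common_zeros[OF irr degree_pos] infinite_unit_circle finite_subset by blast
  then obtain g where g: "refl_f = f * g" by (rule dvdE)
  have rz: "cnj_reflect m c \<noteq> 0" if "c \<noteq> 0" "degree c \<le> m" for c
  proof
    assume "cnj_reflect m c = 0"
    then have "coeff (cnj_reflect m c) (m - degree c) = 0" by simp
    then show False using that by (simp add: coeff_cnj_reflect)
  qed
  \<comment> \<open>The constant coefficient of \<open>refl_f\<close> is the reflected leading
    coefficient of f.\<close>
  have "coeff refl_f 0 \<noteq> 0" unfolding coeff_refl_f using rz[of "lead_coeff f"] f_nonzero degree_coeff_le by simp
  then have r0: "refl_f \<noteq> 0" by auto
  have "degree refl_f \<le> n" by (rule degree_le) (simp add: coeff_refl_f)
  moreover have "degree refl_f = n + degree g" unfolding g using r0 g by (intro degree_mult_eq) auto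
  ultimately obtain g0 where g0: "g = [:g0:]" by (auto elim: degree_eq_zeroE)
  then have g00: "g0 \<noteq> 0" using r0 g by auto
  \<comment> \<open>A coefficient of full z-degree m leaves no room for a nonconstant
    \<open>g0\<close>.\<close>
  have "\<exists>j\<in>{..n}. m = degree (coeff f j)"
    unfolding m_def using Max_in[of "(\<lambda>k. degree (coeff f k)) ` {..n}"] by fastforce
  then obtain j where j: "j \<le> n" "degree (coeff f j) = m" by auto
  have "cnj_reflect m (coeff f (n - j)) = g0 * coeff f j"
    using arg_cong[OF g, of "\<lambda>p. coeff p j"] j g0 by (simp add: coeff_refl_f mult.commute)
  moreover have "degree (cnj_reflect m (coeff f (n - j))) \<le> m" by (rule degree_cnj_reflect)
  ultimately have dg: "degree (g0 * coeff f j) \<le> m" by simp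
  have "degree g0 = 0"
  proof (cases "coeff f j = 0")
    case True
    then have "m = 0" using j by simp
    have "degree (cnj_reflect m (lead_coeff f)) = 0" using degree_cnj_reflect[of m] \<open>m = 0\<close> by simp
    moreover have "cnj_reflect m (lead_coeff f) = g0 * coeff f 0"
      using arg_cong[OF g, of "\<lambda>p. coeff p 0"] g0 by (simp add: coeff_refl_f mult.commute)
    moreover have "cnj_reflect m (lead_coeff f) \<noteq> 0" using rz[of "lead_coeff f"] f_nonzero degree_coeff_le by simp
    ultimately show ?thesis by (metis add_is_0 degree_mult_eq mult_zero_right mult_zero_left)
  next
    case False
    then show ?thesis using dg g00 j by (simp add: degree_mult_eq)
  qed
  then obtain c where "g0 = [:c:]" by (elim degree_eq_zeroE)
  then show ?thesis using g g0 g00 by (intro exI[of _ c]) (simp add: mult.commute)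
qed

definition "c = (SOME c. c \<noteq> 0 \<and> refl_f = [:[:c:]:] * f)"

lemma c_nonzero: "c \<noteq> 0" and refl_f_eq: "refl_f = [:[:c:]:] * f"
  using someI_ex[OF reflection_symmetry] unfolding c_def by auto

lemma circle_lead: "norm z = 1 \<Longrightarrow> z ^ m * cnj (poly (coeff f 0) z) = c * poly (lead_coeff f) z"
proof -
  assume z: "norm z = 1"
  have "cnj_reflect m (coeff f 0) = [:c:] * lead_coeff f"
    using arg_cong[OF refl_f_eq, of "\<lambda>p. coeff p n"] by (simp add: coeff_refl_f)
  from arg_cong[OF this, of "\<lambda>p. poly p z"] show ?thesis
    using z degree_coeff_le[of 0] inverse_cnj_circle[OF z] by (subst (asm) poly_cnj_reflect) auto
qed

text \<open>By \<open>circle_lead\<close>, a zero of the leading coefficient on the circle is also a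
  zero of f(z, 0), and the boundary condition excludes those.\<close>

lemma circle_lead_nonzero: "norm z = 1 \<Longrightarrow> poly (lead_coeff f) z \<noteq> 0"
proof
  assume z: "norm z = 1" and "poly (lead_coeff f) z = 0"
  then have "poly (coeff f 0) z = 0" using circle_lead[OF z] z by auto
  moreover have "ev f z 0 = poly (coeff f 0) z" by (metis coeff_slice poly_0_coeff_0 poly_slice)
  ultimately show False using bd_out[of z 0] z by simp
qed

text \<open>An outer root over the circle would be reflected to a root inside, contrary to the
  boundary condition.\<close>

lemma circle_roots: "norm z = 1 \<Longrightarrow> ev f z w = 0 \<Longrightarrow> norm w = 1"
proof (rule ccontr)
  assume z: "norm z = 1" and w: "ev f z w = 0" and "norm w \<noteq> 1"
  then have w1: "norm w > 1" using bd_out[of z w] by fastforce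
  have "ev refl_f z w = 0" using w by (simp add: refl_f_eq)
  then have "ev f z (1 / cnj w) = 0"
    using z w1 ev_refl_f[of z w] inverse_cnj_circle[OF z] by (cases "z = 0"; cases "w = 0") auto
  moreover have "norm (1 / cnj w) < 1" using w1 by (simp add: norm_divide divide_less_eq)
  ultimately show False using bd_out[OF z] by blast
qed

text \<open>The points of the curve in the closed bidisc that violate the estimate form a compact
  set. None of them lies over the circle, so the maximum of |z| on this set serves as
  \<rho>.\<close>

lemma near_circle:
  fixes \<Phi> :: "complex \<Rightarrow> complex \<Rightarrow> real"
  assumes cont: "continuous_on UNIV (\<lambda>x. \<Phi> (fst x) (snd x))"
    and zero: "\<And>z w. norm z = 1 \<Longrightarrow> norm w = 1 \<Longrightarrow> ev f z w = 0 \<Longrightarrow> \<Phi> z w < e"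
  shows "\<exists>\<rho><1. \<forall>z w. \<rho> < norm z \<longrightarrow> norm z < 1 \<longrightarrow> norm w < 1 \<longrightarrow> ev f z w = 0 \<longrightarrow> \<Phi> z w < e"
proof -
  define K where "K = (zero_set f \<inter> cball 0 1 \<times> cball 0 1) \<inter> {x. \<Phi> (fst x) (snd x) \<ge> e}"
  have "compact K" unfolding K_def
    by (intro compact_Int_closed compact_part closed_Collect_le continuous_intros cont)
  have K: "(z, w) \<in> K" if "norm z < 1" "norm w < 1" "ev f z w = 0" "\<not> \<Phi> z w < e" for z w
    using that by (auto simp: K_def)
  show ?thesis
  proof (cases "K = {}")
    case True
    then show ?thesis using K by (intro exI[of _ 0]) auto
  next
    case False
    have "continuous_on K (\<lambda>x. norm (fst x))" by (intro continuous_intros)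
    from continuous_attains_sup[OF \<open>compact K\<close> False this]
    obtain x where x: "x \<in> K" "\<And>y. y \<in> K \<Longrightarrow> norm (fst y) \<le> norm (fst x)" by auto
    have "norm (fst x) < 1"
    proof (rule ccontr)
      assume "\<not> norm (fst x) < 1"
      then have n1: "norm (fst x) = 1" using x(1) by (auto simp: K_def)
      have "ev f (fst x) (snd x) = 0" using x(1) by (cases x) (auto simp: K_def)
      then show False using zero[of "fst x" "snd x"] circle_roots n1 x(1) by (auto simp: K_def)
    qed
    then show ?thesis using K x(2) by (intro exI[of _ "norm (fst x)"]) fastforce
  qed
qed

section \<open>Sums over the roots in the disc\<close>

definition "bad = {z. poly (lead_coeff f) z = 0} \<union> {z. \<exists>w. ev f z w = 0 \<and> ev (pderiv f) z w = 0}"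

lemma finite_bad: "finite bad"
proof -
  have "\<not> f dvd pderiv f"
  proof
    assume "f dvd pderiv f"
    moreover have "pderiv f \<noteq> 0" using degree_pos pderiv_eq_0_iff[of f] by auto
    ultimately have "degree f \<le> degree (pderiv f)" by (rule dvd_imp_degree_le)
    then show False using degree_pos by (simp add: degree_pderiv)
  qed
  from irreducible_common_zeros[OF irr degree_pos this] show ?thesis
    unfolding bad_def using f_nonzero by (auto intro: poly_roots_finite)
qed

lemma rsquarefree_slice: "z \<notin> bad \<Longrightarrow> rsquarefree (slice z f)"
  unfolding rsquarefree_roots slice_pderiv[symmetric] poly_slice bad_def by auto

text \<open>An argument-principle integral for the sum of \<phi> over the roots in the disc. In this
  form it is holomorphic on the whole disc, also at the points of \<open>bad\<close>, where roots
  may collide.\<close>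

definition "rtrace \<phi> z = integral {0..1} (\<lambda>t. ev ([:0, 1:] * \<phi> * pderiv f) z (circ 1 t) / ev f z (circ 1 t))"

lemma rtrace_holomorphic: "rtrace \<phi> holomorphic_on ball 0 1"
  unfolding rtrace_def by (rule circle_mean_holomorphic) (auto dest: bd_in)

abbreviation "inner_roots z \<equiv> {a. ev f z a = 0 \<and> norm a < 1}"

lemma rtrace_eq:
  assumes "norm z < 1" "z \<notin> bad"
  shows "rtrace \<phi> z = (\<Sum>a\<in>inner_roots z. ev \<phi> z a)"
proof -
  have "((\<lambda>t. circ 1 t * poly (slice z \<phi>) (circ 1 t) * poly (pderiv (slice z f)) (circ 1 t) / poly (slice z f) (circ 1 t))
    has_integral (\<Sum>a | poly (slice z f) a = 0 \<and> norm a < 1. poly (slice z \<phi>) a)) {0..1}"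
    using assms bd_in by (intro circle_mean_log_deriv rsquarefree_slice) auto
  then show ?thesis unfolding rtrace_def
    by (intro integral_unique) (simp add: slice_pderiv[symmetric] mult_ac)
qed

lemma finite_inner_roots: "norm z \<le> 1 \<Longrightarrow> finite (inner_roots z)"
  using poly_roots_finite[OF slice_nonzero[of z]] by (auto intro: finite_subset)

lemma card_inner_roots:
  assumes "norm z \<le> 1"
  shows "card (inner_roots z) \<le> n"
proof -
  have "card (inner_roots z) \<le> card {a. poly (slice z f) a = 0}"
    using poly_roots_finite[OF slice_nonzero[OF assms]] by (intro card_mono) auto
  also have "\<dots> \<le> degree (slice z f)" using slice_nonzero[OF assms] by (rule card_poly_roots_bound)
  finally show ?thesis using degree_slice_le[of z f] by simp
qed

text \<open>A root a over z also satisfies a * rho(z, a) = f(z, 0). Hence z ^ m * cnj (rho(z, a)) tends to c * lead_coeff f * a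
  as z tends to the circle, where a becomes unimodular.\<close>

lemma power_sum_poly: "\<exists>P. \<forall>z\<in>ball 0 1. rtrace (monom 1 j) z * (c * poly (lead_coeff f) z) ^ j = poly P z"
proof -
  obtain f0 f1 where f01: "f = pCons f0 f1" by (cases f)
  define \<rho> where "\<rho> = - f1"
  have \<rho>: "a * ev \<rho> z a = poly f0 z" if "ev f z a = 0" for a z
    using that by (simp add: f01 \<rho>_def eq_neg_iff_add_eq_0[symmetric])
  let ?g = "\<lambda>z. rtrace (monom 1 j) z * (c * poly (lead_coeff f) z) ^ j"
  let ?h = "rtrace (\<rho> ^ j)"
  show ?thesis
  proof (rule holomorphic_reflection_imp_poly[where M = "m * j" and h = ?h])
    show "?g holomorphic_on ball 0 1" by (intro holomorphic_intros rtrace_holomorphic)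
    show "?h holomorphic_on ball 0 1" by (rule rtrace_holomorphic)
  next
    fix e :: real assume e: "e > 0"
    \<comment> \<open>\<open>Suc n\<close> bounds the number of roots, and 2^j the loss from
      dividing by \<open>cnj a ^ j\<close> when |a| > 1/2.\<close>
    define \<delta> where "\<delta> = e / (real (Suc n) * 2 ^ j)"
    have \<delta>: "\<delta> > 0" using e by (simp add: \<delta>_def)
    \<comment> \<open>The j-th powers of the two sides of \<open>circle_lead\<close>, with w cnj w
      inserted on the right. The difference vanishes on the curve over the circle and is small near
      it.\<close>
    define D where "D = (\<lambda>z w. (z ^ m * cnj (poly f0 z)) ^ j - (c * poly (lead_coeff f) z) ^ j * (w * cnj w) ^ j)"
    have "\<exists>\<rho><1. \<forall>z w. \<rho> < norm z \<longrightarrow> norm z < 1 \<longrightarrow> norm w < 1 \<longrightarrow> ev f z w = 0 \<longrightarrow> norm (D z w) < \<delta>"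
    proof (rule near_circle)
      show "continuous_on UNIV (\<lambda>x. norm (D (fst x) (snd x)))" unfolding D_def by (intro continuous_intros)
      fix z w :: complex assume zw: "norm z = 1" "norm w = 1"
      then have "w * cnj w = 1" by (simp add: complex_norm_square[symmetric])
      then have "D z w = 0" using circle_lead[OF zw(1)] by (simp add: D_def f01)
      then show "norm (D z w) < \<delta>" using \<delta> by simp
    qed
    then obtain r1 where r1: "r1 < 1"
      "\<And>z w. r1 < norm z \<Longrightarrow> norm z < 1 \<Longrightarrow> norm w < 1 \<Longrightarrow> ev f z w = 0 \<Longrightarrow> norm (D z w) < \<delta>" by blast
    \<comment> \<open>Near the circle every root in the disc has modulus above 1/2, since the roots
      over the circle are unimodular.\<close>
    have "\<exists>\<rho><1. \<forall>z w. \<rho> < norm z \<longrightarrow> norm z < 1 \<longrightarrow> norm w < 1 \<longrightarrow> ev f z w = 0 \<longrightarrow> - norm w < - (1 / 2)"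
      by (rule near_circle) (auto intro!: continuous_intros)
    then obtain r2 where r2: "r2 < 1"
      "\<And>z w. r2 < norm z \<Longrightarrow> norm z < 1 \<Longrightarrow> norm w < 1 \<Longrightarrow> ev f z w = 0 \<Longrightarrow> - norm w < - (1 / 2)" by blast
    \<comment> \<open>Including the moduli of the bad points in the disc makes the annulus beyond r
      free of them.\<close>
    define S where "S = insert (max r1 r2) (norm ` {b \<in> bad. norm b < 1})"
    have fS: "finite S" unfolding S_def using finite_bad by simp
    define r where "r = Max S"
    have "r < 1" unfolding r_def using fS r1(1) r2(1) by (subst Max_less_iff) (auto simp: S_def)
    moreover have "norm (?g z - z ^ (m * j) * cnj (?h z)) \<le> e" if z: "r < norm z" "norm z < 1" for z
    proof -
      have "r1 \<le> r" "r2 \<le> r" using Max_ge[OF fS, of "max r1 r2"] by (auto simp: r_def S_def)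
      then have zr: "r1 < norm z" "r2 < norm z" using z by auto
      have "z \<notin> bad"
      proof
        assume "z \<in> bad"
        then have "norm z \<in> S" using z by (auto simp: S_def)
        then have "norm z \<le> Max S" by (rule Max_ge[OF fS])
        then show False using z(1) unfolding r_def by linarith
      qed
      note tr = rtrace_eq[OF z(2) this]
      have "norm (?g z - z ^ (m * j) * cnj (?h z)) =
          norm (\<Sum>a\<in>inner_roots z. a ^ j * (c * poly (lead_coeff f) z) ^ j - z ^ (m * j) * cnj (ev \<rho> z a ^ j))"
        unfolding tr by (simp add: sum_subtractf sum_distrib_left sum_distrib_right)
      also have "\<dots> \<le> (\<Sum>a\<in>inner_roots z. norm (a ^ j * (c * poly (lead_coeff f) z) ^ j - z ^ (m * j) * cnj (ev \<rho> z a ^ j)))"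
        by (rule norm_sum)
      also have "\<dots> \<le> (\<Sum>a\<in>inner_roots z. \<delta> * 2 ^ j)"
      proof (rule sum_mono)
        fix a assume a: "a \<in> inner_roots z"
        then have a2: "norm a > 1 / 2" using r2(2)[OF zr(2) z(2)] by fastforce
        then have a0: "a \<noteq> 0" by auto
        have "cnj a * cnj (ev \<rho> z a) = cnj (poly f0 z)" using \<rho>[of z a] a by (metis (mono_tags, lifting) complex_cnj_mult mem_Collect_eq)
        then have "D z a = cnj a ^ j * (z ^ (m * j) * cnj (ev \<rho> z a ^ j) - a ^ j * (c * poly (lead_coeff f) z) ^ j)"
          unfolding D_def power_mult by (simp only: power_mult_distrib complex_cnj_power right_diff_distrib mult_ac flip: \<open>cnj a * cnj (ev \<rho> z a) = cnj (poly f0 z)\<close>)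
        then have "a ^ j * (c * poly (lead_coeff f) z) ^ j - z ^ (m * j) * cnj (ev \<rho> z a ^ j) = - (D z a / cnj a ^ j)"
          using a0 by (simp add: field_simps)
        then have "norm (a ^ j * (c * poly (lead_coeff f) z) ^ j - z ^ (m * j) * cnj (ev \<rho> z a ^ j)) = norm (D z a) * (1 / norm a ^ j)"
          by (simp add: norm_divide norm_power)
        also have "\<dots> \<le> \<delta> * 2 ^ j"
        proof (rule mult_mono)
          show "norm (D z a) \<le> \<delta>" using r1(2)[OF zr(1) z(2), of a] a by auto
          show "1 / norm a ^ j \<le> 2 ^ j"
            using power_mono[of "1 / 2" "norm a" j] a2 a0 by (simp add: field_simps power_divide)
        qed (use \<delta> in auto)
        finally show "norm (a ^ j * (c * poly (lead_coeff f) z) ^ j - z ^ (m * j) * cnj (ev \<rho> z a ^ j)) \<le> \<delta> * 2 ^ j" .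
      qed
      also have "\<dots> = real (card (inner_roots z)) * (\<delta> * 2 ^ j)" by simp
      also have "\<dots> \<le> real (Suc n) * (\<delta> * 2 ^ j)"
        using card_inner_roots[of z] z \<delta> by (intro mult_right_mono) auto
      also have "\<dots> = e" by (simp add: \<delta>_def)
      finally show ?thesis .
    qed
    ultimately show "\<exists>\<rho><1. \<forall>z. \<rho> < norm z \<and> norm z < 1 \<longrightarrow> norm (?g z - z ^ (m * j) * cnj (?h z)) \<le> e" by blast
  qed
qed

text \<open>Up to a factor in z, N is the sum of f / (w - a) over the roots a in the disc. It has lower degree
  than f and vanishes at the roots outside the disc.\<close>

lemma no_outer_roots_generic: "\<exists>B. finite B \<and> (\<forall>z w. norm z < 1 \<longrightarrow> z \<notin> B \<longrightarrow> ev f z w = 0 \<longrightarrow> norm w < 1)"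
proof -
  obtain P where P: "\<And>j z. z \<in> ball 0 1 \<Longrightarrow> rtrace (monom 1 j) z * (c * poly (lead_coeff f) z) ^ j = poly (P j) z"
    using power_sum_poly by metis
  \<comment> \<open>The power sums of index up to n, brought to the common denominator
    \<open>(c * lead_coeff f) ^ n\<close>.\<close>
  define s where "s = (\<lambda>i. P i * ([:c:] * lead_coeff f) ^ (n - i))"
  have s: "poly (s i) z = rtrace (monom 1 i) z * (c * poly (lead_coeff f) z) ^ n" if "norm z < 1" "i \<le> n" for i z
    using that P[of z i, symmetric] by (simp add: s_def flip: power_add)
  define N where "N = (\<Sum>l\<le>n. \<Sum>k<l. monom (coeff f l * s (l - 1 - k)) k)"
  \<comment> \<open>The divided difference (f(z, w) - f(z, a)) / (w - a) written as a polynomial; on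
    the diagonal it is the derivative in w.\<close>
  define q where "q = (\<lambda>z w a. \<Sum>l\<le>n. poly (coeff f l) z * (\<Sum>k<l. w ^ k * a ^ (l - 1 - k)))"
  have q1: "(w - a) * q z w a = ev f z w - ev f z a" for z w a
  proof -
    have "(w - a) * (poly (coeff f l) z * (\<Sum>k<l. w ^ k * a ^ (l - 1 - k))) =
        poly (coeff f l) z * w ^ l - poly (coeff f l) z * a ^ l" for l
      unfolding right_diff_distrib[symmetric] power_difference_sum[of w l a] by (simp only: mult_ac)
    then show ?thesis
      unfolding q_def ev_altdef by (subst sum_distrib_left) (simp only: sum_subtractf)
  qed
  have q2: "q z w w = ev (pderiv f) z w" for z w
  proof -
    have "q z w w = (\<Sum>l\<le>n. poly (coeff f l) z * (of_nat l * w ^ (l - 1)))"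
      unfolding q_def
    proof (rule sum.cong[OF refl])
      fix l
      have "(\<Sum>k<l. w ^ k * w ^ (l - 1 - k)) = (\<Sum>k<l. w ^ (l - 1))"
        by (rule sum.cong) (auto simp flip: power_add)
      then show "poly (coeff f l) z * (\<Sum>k<l. w ^ k * w ^ (l - 1 - k)) = poly (coeff f l) z * (of_nat l * w ^ (l - 1))" by simp
    qed
    also have "\<dots> = poly (pderiv (slice z f)) w"
    proof -
      have "slice z f = (\<Sum>l\<le>n. monom (poly (coeff f l) z) l)"
        using poly_as_sum_of_monoms'[OF degree_slice_le[of z f]] by simp
      then show ?thesis by (simp add: pderiv_sum pderiv_monom poly_sum poly_monom mult_ac)
    qed
    finally show ?thesis by (simp add: slice_pderiv[symmetric])
  qed
  have evN: "ev N z w = (c * poly (lead_coeff f) z) ^ n * (\<Sum>a\<in>inner_roots z. q z w a)"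
    if z: "norm z < 1" "z \<notin> bad" for z w
  proof -
    have "ev N z w = (\<Sum>l\<le>n. \<Sum>k<l. poly (coeff f l) z * ((c * poly (lead_coeff f) z) ^ n * (\<Sum>a\<in>inner_roots z. a ^ (l - 1 - k))) * w ^ k)"
      unfolding N_def ev_sum using s z rtrace_eq[OF z] by (intro sum.cong refl) (simp add: mult_ac)
    also have "\<dots> = (\<Sum>l\<le>n. \<Sum>k<l. \<Sum>a\<in>inner_roots z. (c * poly (lead_coeff f) z) ^ n * (poly (coeff f l) z * (w ^ k * a ^ (l - 1 - k))))"
      by (intro sum.cong refl) (simp add: sum_distrib_left sum_distrib_right mult_ac)
    also have "\<dots> = (\<Sum>a\<in>inner_roots z. \<Sum>l\<le>n. \<Sum>k<l. (c * poly (lead_coeff f) z) ^ n * (poly (coeff f l) z * (w ^ k * a ^ (l - 1 - k))))"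
      by (subst sum.swap[of _ "inner_roots z"], subst sum.swap[of _ "inner_roots z"]) (rule refl)
    finally show ?thesis unfolding q_def by (simp add: sum_distrib_left)
  qed
  have degN: "degree N < n \<or> N = 0"
  proof -
    have "degree N \<le> n - 1" unfolding N_def
    proof (intro degree_sum_le finite_atMost finite_lessThan)
      fix l k assume "l \<in> {..n}" "k \<in> {..<l}"
      then show "degree (monom (coeff f l * s (l - 1 - k)) k) \<le> n - 1"
        by (intro order.trans[OF degree_monom_le]) auto
    qed
    then show ?thesis using degree_pos by auto
  qed
  have "\<not> f dvd N"
  proof
    assume "f dvd N"
    then have N0: "N = 0" using degN dvd_imp_degree_le[of f N] by (metis not_less)
    have "\<forall>\<^sub>F z in at 0. z \<notin> bad \<and> z \<in> ball (0::complex) 1"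
      by (intro eventually_conj eventually_at_avoid_finite finite_bad eventually_at_in_open') auto
    then obtain z where z: "z \<notin> bad" "norm z < 1" using eventually_happens'[OF at_neq_bot] by fastforce
    obtain w where w: "norm w < 1" "ev f z w = 0" using open_disc_root[OF z(2)] by blast
    \<comment> \<open>At an inner root w only the term a = w survives. It is the derivative of f,
      which is nonzero off \<open>bad\<close>.\<close>
    have "(\<Sum>a\<in>inner_roots z. q z w a) = (\<Sum>a\<in>{w}. q z w a)"
    proof (rule sum.mono_neutral_right)
      show "\<forall>a\<in>inner_roots z - {w}. q z w a = 0"
      proof
        fix a assume a: "a \<in> inner_roots z - {w}"
        then show "q z w a = 0" using q1[of w a z] w by auto
      qed
    qed (use w finite_inner_roots[of z] z in auto)
    then have "(c * poly (lead_coeff f) z) ^ n * ev (pderiv f) z w = 0"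
      using evN[OF z(2,1), of w] N0 q2 by simp
    then show False using z w c_nonzero by (auto simp: bad_def)
  qed
  from irreducible_common_zeros[OF irr degree_pos this]
  have "finite (bad \<union> {z. \<exists>w. ev f z w = 0 \<and> ev N z w = 0})" using finite_bad by simp
  moreover have "norm w < 1" if "norm z < 1" "z \<notin> bad \<union> {z. \<exists>w. ev f z w = 0 \<and> ev N z w = 0}" "ev f z w = 0" for z w
  proof (rule ccontr)
    assume nw: "\<not> norm w < 1"
    \<comment> \<open>Each inner root differs from the outer root w, so the divided difference of
      these two roots is 0.\<close>
    have "q z w a = 0" if "a \<in> inner_roots z" for a
      using q1[of w a z] that \<open>ev f z w = 0\<close> nw by auto
    then have "(\<Sum>a\<in>inner_roots z. q z w a) = 0" by (rule sum.neutral[OF ballI])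
    then have "ev N z w = 0" using evN[of z w] that by simp
    then show False using that by blast
  qed
  ultimately show ?thesis by blast
qed

text \<open>An outer root over an exceptional z0 would persist, by continuity of roots, over nearby
  z where there is none.\<close>

lemma disc_roots:
  assumes "norm z0 < 1" "ev f z0 w0 = 0"
  shows "norm w0 < 1"
proof (rule ccontr)
  assume "\<not> norm w0 < 1"
  then have w0: "norm w0 > 1" using bd_in[of z0 w0] assms by fastforce
  obtain B where B: "finite B" "\<And>z w. norm z < 1 \<Longrightarrow> z \<notin> B \<Longrightarrow> ev f z w = 0 \<Longrightarrow> norm w < 1"
    using no_outer_roots_generic by blast
  have "\<forall>\<^sub>F z in at z0. (\<exists>w. norm (w - w0) < norm w0 - 1 \<and> ev f z w = 0) \<and> z \<notin> B \<and> z \<in> ball 0 1"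
    using assms w0 slice_nonzero[of z0]
    by (intro eventually_conj ev_root_continuity_w eventually_at_avoid_finite B eventually_at_in_open') auto
  then obtain z w where zw: "norm (w - w0) < norm w0 - 1" "ev f z w = 0" "z \<notin> B" "norm z < 1"
    using eventually_happens'[OF at_neq_bot] by fastforce
  then have "norm w < 1" using B(2) by blast
  then show False using zw(1) norm_triangle_ineq2[of w0 w] by (simp add: norm_minus_commute)
qed

text \<open>A zero of the leading coefficient is a root w at infinity. The reversed slice has it as
  the root 0, and continuity of roots yields nearby slices whose reversal has a root x with |x| < 1.
  Then 1 / x is a root of f outside the disc.\<close>

lemma disc_lead_nonzero:
  assumes "norm z0 < 1"
  shows "poly (lead_coeff f) z0 \<noteq> 0"
proof
  assume l0: "poly (lead_coeff f) z0 = 0"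
  define P where "P = (\<lambda>z. \<Sum>j\<le>n. monom (poly (coeff f (n - j)) z) j)"
  have cP: "coeff (P z) j = (if j \<le> n then poly (coeff f (n - j)) z else 0)" for z j
    unfolding P_def coeff_sum coeff_monom by (simp add: sum.delta)
  have evP: "poly (P z) x = x ^ n * ev f z (1 / x)" if "x \<noteq> 0" for z x
  proof -
    have "poly (P z) x = (\<Sum>j\<le>n. poly (coeff f j) z * x ^ (n - j))"
      unfolding P_def poly_sum poly_monom
      by (rule sum.reindex_bij_witness[of _ "\<lambda>i. n - i" "\<lambda>i. n - i"]) auto
    also have "\<dots> = x ^ n * ev f z (1 / x)"
      unfolding ev_altdef sum_distrib_left using that
      by (intro sum.cong) (auto simp: power_diff power_divide)
    finally show ?thesis .
  qed
  obtain k where "poly (coeff f k) z0 \<noteq> 0" using slice_nonzero[of z0] assms by (auto simp: poly_eq_iff[of "slice z0 f"])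
  then have "k \<le> n" using le_degree[of f k] by (metis poly_0)
  then have "coeff (P z0) (n - k) \<noteq> 0" using \<open>poly (coeff f k) z0 \<noteq> 0\<close> by (simp add: cP)
  then have Pz: "P z0 \<noteq> 0" by auto
  have ball: "\<forall>\<^sub>F z in at z0. z \<in> ball 0 1"
    by (rule eventually_at_in_open') (use assms in auto)
  have "\<forall>\<^sub>F z in at z0. (\<exists>x. norm (x - 0) < 1 \<and> poly (P z) x = 0) \<and> z \<notin> bad \<and> z \<in> ball 0 1"
  proof (intro eventually_conj root_continuity[where Q = "P z0" and d = n])
    show "((\<lambda>z. coeff (P z) k) \<longlongrightarrow> coeff (P z0) k) (at z0)" for k
      by (auto simp: cP intro!: tendsto_intros)
    show "degree (P z) \<le> n" for z by (rule degree_le) (simp add: cP)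
    show "poly (P z0) 0 = 0" using l0 by (simp add: poly_0_coeff_0 cP)
  qed (use Pz finite_bad ball in \<open>auto intro!: eventually_at_avoid_finite\<close>)
  then obtain z x where zx: "norm x < 1" "poly (P z) x = 0" "z \<notin> bad" "norm z < 1"
    using eventually_happens'[OF at_neq_bot] by fastforce
  have "x \<noteq> 0"
  proof
    assume "x = 0"
    then have "poly (lead_coeff f) z = 0" using zx(2) by (simp add: poly_0_coeff_0 cP)
    then show False using zx(3) by (simp add: bad_def)
  qed
  then have "ev f z (1 / x) = 0" using zx(2) evP by simp
  from disc_roots[OF zx(4) this] show False using \<open>x \<noteq> 0\<close> zx(1) by (simp add: norm_divide field_simps)
qed

end

text \<open>What the irreducible factors pass on to their product. By the last condition multiple
  roots occur over finitely many z only, so the slices are squarefree at almost all points of the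
  circle.\<close>

definition inner_poly :: "complex poly poly \<Rightarrow> bool" where
  "inner_poly p \<longleftrightarrow> degree p > 0 \<and> (\<forall>z. norm z \<le> 1 \<longrightarrow> poly (lead_coeff p) z \<noteq> 0) \<and>
    (\<forall>z w. norm z < 1 \<longrightarrow> ev p z w = 0 \<longrightarrow> norm w < 1) \<and>
    (\<forall>z w. norm z = 1 \<longrightarrow> ev p z w = 0 \<longrightarrow> norm w = 1) \<and>
    finite {z. \<exists>w. ev p z w = 0 \<and> ev (pderiv p) z w = 0}"

lemma (in boundary_curve) lead_nonzero: "norm z \<le> 1 \<Longrightarrow> poly (lead_coeff f) z \<noteq> 0"
  using disc_lead_nonzero[of z] circle_lead_nonzero[of z] by (cases "norm z = 1") auto

lemma zero_set_prime_factors: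
  assumes "p \<noteq> 0"
  shows "ev p z w = 0 \<longleftrightarrow> (\<exists>f\<in>prime_factors p. ev f z w = 0)"
proof
  assume "ev p z w = 0"
  have "p dvd prod_mset (prime_factorization p)"
    using prod_mset_prime_factorization_weak[OF assms] by (metis dvd_normalize_iff dvd_refl)
  then obtain k where "prod_mset (prime_factorization p) = p * k" by (rule dvdE)
  then have "ev (prod_mset (prime_factorization p)) z w = 0" using \<open>ev p z w = 0\<close> by simp
  moreover have "ev (prod_mset M) z w = 0 \<Longrightarrow> \<exists>f\<in>#M. ev f z w = 0" for M
    by (induction M) auto
  ultimately show "\<exists>f\<in>prime_factors p. ev f z w = 0" by blast
next
  assume "\<exists>f\<in>prime_factors p. ev f z w = 0"
  then obtain f where "f dvd p" "ev f z w = 0" using prime_factors_dvd by blast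
  then show "ev p z w = 0" by (auto elim!: dvdE)
qed

text \<open>Factors that miss the bidisc are discarded: they do not contribute to the trace on it,
  and their roots over the disc have modulus above 1. Every remaining prime is taken once, which
  makes the product squarefree.\<close>

lemma distinguished_variety_inner_poly:
  assumes W: "distinguished_variety W"
  obtains p where "inner_poly p" "W \<inter> bidisc = zero_set p \<inter> bidisc"
proof -
  obtain P where P: "W = zero_set P" and meets: "W \<inter> bidisc \<noteq> {}" and fr: "W \<inter> frontier bidisc = W \<inter> torus"
    using W unfolding distinguished_variety_def by blast
  have "P \<noteq> 0"
  proof
    assume "P = 0"
    then have "(0, 1) \<in> W \<inter> frontier bidisc" using P frontier_bidisc[of 0 1] by simp
    then show False using fr by auto
  qed
  define \<F> where "\<F> = {f \<in> prime_factors P. zero_set f \<inter> bidisc \<noteq> {}}"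
  have fin: "finite \<F>" unfolding \<F>_def by simp
  define p where "p = \<Prod>\<F>"
  have ZP: "(z, w) \<in> W \<longleftrightarrow> (\<exists>f\<in>prime_factors P. ev f z w = 0)" for z w
    unfolding P using zero_set_prime_factors[OF \<open>P \<noteq> 0\<close>] by simp
  have prime: "prime f" if "f \<in> \<F>" for f using that by (auto simp: \<F>_def intro: in_prime_factors_imp_prime)
  have bc: "boundary_curve f" if f: "f \<in> \<F>" for f
  proof
    show "irreducible f" using prime[OF f] by (simp add: prime_elem_imp_irreducible)
    show "zero_set f \<inter> bidisc \<noteq> {}" using f by (simp add: \<F>_def)
    have "zero_set f \<subseteq> W" using f ZP by (auto simp: \<F>_def)
    then show "zero_set f \<inter> frontier bidisc \<subseteq> torus" using fr by blast
  qed
  have evp: "ev p z w = 0 \<longleftrightarrow> (\<exists>f\<in>\<F>. ev f z w = 0)" for z w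
    unfolding p_def using fin by (simp add: ev_prod)
  have Wp: "W \<inter> bidisc = zero_set p \<inter> bidisc"
  proof (rule Set.set_eqI)
    fix x :: "complex \<times> complex"
    obtain z w where x: "x = (z, w)" by force
    have "f \<in> \<F>" if "f \<in> prime_factors P" "ev f z w = 0" "(z, w) \<in> bidisc" for f
    proof -
      have "(z, w) \<in> zero_set f \<inter> bidisc" using that by simp
      then show ?thesis using that(1) unfolding \<F>_def by blast
    qed
    then show "x \<in> W \<inter> bidisc \<longleftrightarrow> x \<in> zero_set p \<inter> bidisc"
      unfolding x using ZP[of z w] evp[of z w] by (auto simp: \<F>_def)
  qed
  then have "\<F> \<noteq> {}" using meets evp by auto
  then obtain f0 where f0: "f0 \<in> \<F>" by blast
  have nz: "f \<noteq> 0" if "f \<in> \<F>" for f using prime[OF that] by auto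
  have p0: "p \<noteq> 0" unfolding p_def using fin nz by auto
  have "f0 dvd p" unfolding p_def using f0 fin by (rule dvd_prodI[rotated])
  then have "degree f0 \<le> degree p" using p0 by (rule dvd_imp_degree_le)
  then have deg: "degree p > 0" using boundary_curve.degree_pos[OF bc[OF f0]] by simp
  have lead: "poly (lead_coeff p) z \<noteq> 0" if "norm z \<le> 1" for z
    unfolding p_def lead_coeff_prod poly_prod using fin boundary_curve.lead_nonzero[OF bc that] by simp
  have "finite {z. \<exists>w. ev f z w = 0 \<and> ev (pderiv p) z w = 0}" if f: "f \<in> \<F>" for f
  proof (rule irreducible_common_zeros)
    show irr: "irreducible f" using prime[OF f] by (simp add: prime_elem_imp_irreducible)
    show dp: "degree f > 0" using boundary_curve.degree_pos[OF bc[OF f]] .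
    have pe: "prime_elem f" using prime[OF f] by simp
    show "\<not> f dvd pderiv p"
    proof
      assume "f dvd pderiv p"
      have pf: "p = f * \<Prod>(\<F> - {f})" unfolding p_def by (rule prod.remove[OF fin f])
      \<comment> \<open>By the product rule f would divide another of the primes or its own
        derivative.\<close>
      have "pderiv p = f * pderiv (\<Prod>(\<F> - {f})) + \<Prod>(\<F> - {f}) * pderiv f"
        by (subst pf) (simp add: pderiv_mult)
      then have "f dvd \<Prod>(\<F> - {f}) * pderiv f" using \<open>f dvd pderiv p\<close> by (metis dvd_add_times_triv_left_iff mult.commute dvd_add_right_iff dvd_triv_left)
      then have "f dvd \<Prod>(\<F> - {f}) \<or> f dvd pderiv f" using pe by (rule prime_elem_dvd_multD[rotated])
      then show False
      proof
        assume "f dvd \<Prod>(\<F> - {f})"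
        then obtain g where g: "g \<in> \<F>" "g \<noteq> f" "f dvd g"
          using prime_dvd_prod_iff[OF _ prime[OF f], of "\<F> - {f}" id] fin by auto
        then show False using primes_dvd_imp_eq[OF prime[OF f] prime[OF g(1)]] by simp
      next
        assume "f dvd pderiv f"
        moreover have "pderiv f \<noteq> 0" using dp pderiv_eq_0_iff[of f] by auto
        ultimately have "degree f \<le> degree (pderiv f)" by (rule dvd_imp_degree_le)
        then show False using dp by (simp add: degree_pderiv)
      qed
    qed
  qed
  then have "finite (\<Union>f\<in>\<F>. {z. \<exists>w. ev f z w = 0 \<and> ev (pderiv p) z w = 0})" using fin by blast
  moreover have "{z. \<exists>w. ev p z w = 0 \<and> ev (pderiv p) z w = 0} \<subseteq> (\<Union>f\<in>\<F>. {z. \<exists>w. ev f z w = 0 \<and> ev (pderiv p) z w = 0})"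
    using evp by blast
  ultimately have "finite {z. \<exists>w. ev p z w = 0 \<and> ev (pderiv p) z w = 0}" by (rule finite_subset[rotated])
  then have "inner_poly p"
    unfolding inner_poly_def using deg lead evp
      boundary_curve.disc_roots[OF bc] boundary_curve.circle_roots[OF bc] by blast
  then show ?thesis using Wp that by blast
qed

section \<open>Trigonometric polynomials\<close>

text \<open>Laurent polynomials restricted to the circle, encoded as functions whose values
  elsewhere are irrelevant. On the circle conjugation acts as z |-> 1 / z, so the class is closed
  under \<open>cnj\<close>.\<close>

definition trig :: "(complex \<Rightarrow> complex) \<Rightarrow> bool" where
  "trig f \<longleftrightarrow> (\<exists>g M. \<forall>z. norm z = 1 \<longrightarrow> f z = poly g z / z ^ M)"

lemma trigI: "(\<And>z. norm z = 1 \<Longrightarrow> f z = poly g z / z ^ M) \<Longrightarrow> trig f"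
  unfolding trig_def by blast

lemma trig_poly [intro]: "trig (poly g)"
  by (rule trigI[of _ g 0]) simp

lemma trig_const [intro]: "trig (\<lambda>z. c)"
  by (rule trigI[of _ "[:c:]" 0]) simp

lemma trig_add [intro]:
  assumes "trig f" "trig g"
  shows "trig (\<lambda>z. f z + g z)"
proof -
  from assms obtain p M q N where f: "\<And>z. norm z = 1 \<Longrightarrow> f z = poly p z / z ^ M"
    and g: "\<And>z. norm z = 1 \<Longrightarrow> g z = poly q z / z ^ N" unfolding trig_def by blast
  show ?thesis
  proof (rule trigI[of _ "p * monom 1 N + q * monom 1 M" "M + N"])
    fix z :: complex assume z: "norm z = 1"
    then have "z \<noteq> 0" by auto
    then show "f z + g z = poly (p * monom 1 N + q * monom 1 M) z / z ^ (M + N)"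
      by (simp add: f[OF z] g[OF z] poly_monom power_add add_frac_eq)
  qed
qed

lemma trig_mult [intro]:
  assumes "trig f" "trig g"
  shows "trig (\<lambda>z. f z * g z)"
proof -
  from assms obtain p M q N where f: "\<And>z. norm z = 1 \<Longrightarrow> f z = poly p z / z ^ M"
    and g: "\<And>z. norm z = 1 \<Longrightarrow> g z = poly q z / z ^ N" unfolding trig_def by blast
  show ?thesis
    by (rule trigI[of _ "p * q" "M + N"]) (simp add: f g power_add)
qed

lemma trig_minus [intro]: "trig f \<Longrightarrow> trig (\<lambda>z. - f z)"
  using trig_mult[OF trig_const[of "-1"], of f] by simp

lemma trig_diff [intro]: "trig f \<Longrightarrow> trig g \<Longrightarrow> trig (\<lambda>z. f z - g z)"
  using trig_add[of f "\<lambda>z. - g z"] by auto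

lemma trig_sum [intro]: "(\<And>i. i \<in> A \<Longrightarrow> trig (f i)) \<Longrightarrow> trig (\<lambda>z. \<Sum>i\<in>A. f i z)"
  by (induction A rule: infinite_finite_induct) auto

lemma cnj_circle: "norm z = 1 \<Longrightarrow> cnj z = 1 / z"
  using complex_norm_square[of z] by (cases "z = 0") (auto simp: eq_divide_eq mult.commute)

lemma trig_cnj [intro]:
  assumes "trig f"
  shows "trig (\<lambda>z. cnj (f z))"
proof -
  from assms obtain p M where f: "\<And>z. norm z = 1 \<Longrightarrow> f z = poly p z / z ^ M" unfolding trig_def by blast
  show ?thesis
  proof (rule trigI[of _ "cnj_reflect (degree p) p * monom 1 M" "degree p"])
    fix z :: complex assume z: "norm z = 1"
    then have "z \<noteq> 0" by auto
    have "poly (cnj_reflect (degree p) p) z = z ^ degree p * cnj (poly p z)"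
      using poly_cnj_reflect[of p "degree p" z] \<open>z \<noteq> 0\<close> inverse_cnj_circle[OF z] by simp
    then show "cnj (f z) = poly (cnj_reflect (degree p) p * monom 1 M) z / z ^ degree p"
      using \<open>z \<noteq> 0\<close> by (simp add: f[OF z] poly_monom cnj_circle[OF z] power_divide)
  qed
qed

lemma trig_common:
  fixes f :: "nat \<Rightarrow> complex \<Rightarrow> complex"
  assumes "\<And>i. i < n \<Longrightarrow> trig (f i)"
  shows "\<exists>M p. \<forall>i<n. \<forall>z. norm z = 1 \<longrightarrow> z ^ M * f i z = poly (p i) z"
proof -
  have "\<forall>i. \<exists>g M. i < n \<longrightarrow> (\<forall>z. norm z = 1 \<longrightarrow> f i z = poly g z / z ^ M)"
    using assms unfolding trig_def by blast
  then obtain g N where gN: "\<And>i z. i < n \<Longrightarrow> norm z = 1 \<Longrightarrow> f i z = poly (g i) z / z ^ N i" by metis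
  show ?thesis
  proof (intro exI[of _ "\<Sum>i<n. N i"] exI[of _ "\<lambda>i. g i * monom 1 ((\<Sum>i<n. N i) - N i)"] allI impI)
    fix i and z :: complex assume i: "i < n" and z: "norm z = 1"
    then have "z \<noteq> 0" by auto
    have "N i \<le> (\<Sum>i<n. N i)" using i by (intro member_le_sum) auto
    then have "z ^ (\<Sum>i<n. N i) = z ^ N i * z ^ ((\<Sum>i<n. N i) - N i)" by (simp flip: power_add)
    then show "z ^ (\<Sum>i<n. N i) * f i z = poly (g i * monom 1 ((\<Sum>i<n. N i) - N i)) z"
      using \<open>z \<noteq> 0\<close> by (simp add: gN[OF i z] poly_monom)
  qed
qed

text \<open>The circle is perfect, so each of its points is a limit of points outside B. This fills
  in the finitely many exceptional points left by arguments on the circle.\<close>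

lemma circle_closed_extend:
  fixes \<phi> :: "complex \<Rightarrow> 'b::metric_space"
  assumes "closed S" "finite B" "continuous_on unit_circle \<phi>"
    and "\<And>z. norm z = 1 \<Longrightarrow> z \<notin> B \<Longrightarrow> \<phi> z \<in> S" and z0: "norm z0 = 1"
  shows "\<phi> z0 \<in> S"
proof -
  have "z0 islimpt unit_circle"
  proof -
    have "connected unit_circle" by (intro connected_sphere) simp
    moreover have "unit_circle \<noteq> {x}" for x using infinite_unit_circle by auto
    moreover have "z0 \<in> unit_circle" using z0 by simp
    ultimately show ?thesis using connected_imp_perfect[of unit_circle z0] by blast
  qed
  then have "z0 islimpt (unit_circle - B)" using assms(2) by (metis Diff_eq Un_Diff_Int islimpt_Un islimpt_finite finite_Int inf_commute Diff_Diff_Int)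
  then obtain x where x: "\<And>n::nat. x n \<in> unit_circle - B - {z0}" "x \<longlonglongrightarrow> z0"
    unfolding islimpt_sequential by blast
  have "(\<lambda>n. \<phi> (x n)) \<longlonglongrightarrow> \<phi> z0"
    using x z0 by (intro continuous_on_tendsto_compose[OF assms(3)]) (auto intro!: always_eventually)
  moreover have "\<forall>n. \<phi> (x n) \<in> S" using x assms(4) by auto
  ultimately show ?thesis using assms(1) closed_sequentially by metis
qed

lemma trig_continuous: "trig f \<Longrightarrow> continuous_on unit_circle f"
proof -
  assume "trig f"
  then obtain g M where f: "\<And>z. norm z = 1 \<Longrightarrow> f z = poly g z / z ^ M" unfolding trig_def by blast
  have "continuous_on unit_circle (\<lambda>z. poly g z / z ^ M)" by (intro continuous_intros) auto
  then show ?thesis by (rule continuous_on_eq) (simp add: f)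
qed

lemma trig_eq_extend:
  assumes "trig f" "trig g" "finite B" "\<And>z. norm z = 1 \<Longrightarrow> z \<notin> B \<Longrightarrow> f z = g z" "norm z = 1"
  shows "f z = g z"
proof -
  have "f z - g z \<in> {0}"
    by (rule circle_closed_extend[where \<phi> = "\<lambda>z. f z - g z" and B = B])
      (use assms in \<open>auto intro!: trig_continuous\<close>)
  then show ?thesis by simp
qed

section \<open>Fejer-Riesz factorization of nonnegative trigonometric polynomials\<close>

abbreviation nonneg_real :: "complex set" where
  "nonneg_real \<equiv> \<real>\<^sub>\<ge>\<^sub>0"

lemma norm_sq_circle: "norm z = 1 \<Longrightarrow> (z - \<alpha>) * (1 - cnj \<alpha> * z) = z * of_real ((norm (z - \<alpha>))\<^sup>2)"
proof -
  assume z: "norm z = 1"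
  then have "z \<noteq> 0" by auto
  have "of_real ((norm (z - \<alpha>))\<^sup>2) = (z - \<alpha>) * (1 / z - cnj \<alpha>)"
    unfolding complex_norm_square using cnj_circle[OF z] by simp
  then show ?thesis using \<open>z \<noteq> 0\<close> by (simp add: field_simps)
qed

lemma nonneg_RealsI: "r \<ge> 0 \<Longrightarrow> of_real r \<in> nonneg_real"
  by simp

lemma nonneg_eq_norm: "x \<in> nonneg_real \<Longrightarrow> x = of_real (norm x)"
  by (auto elim!: nonneg_Reals_cases)

text \<open>Nonnegativity makes the nonzero roots symmetric under \<alpha> |-> 1 / cnj \<alpha> and
  of even multiplicity on the circle. Each induction step removes one such pair, which contributes a
  multiple of |z - \<alpha>|^2 on the circle, and puts z - \<alpha> into h.\<close>

lemma Fejer_Riesz_poly: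
  fixes g :: "complex poly"
  assumes "\<And>z. norm z = 1 \<Longrightarrow> poly g z / z ^ M \<in> nonneg_real"
  shows "\<exists>h. \<forall>z. norm z = 1 \<longrightarrow> poly g z / z ^ M = poly h z * cnj (poly h z)"
  using assms
proof (induction "degree g" arbitrary: g rule: less_induct)
  case less
  note pos = less.prems
  show ?case
  proof (cases "\<exists>\<alpha>. \<alpha> \<noteq> 0 \<and> poly g \<alpha> = 0 \<and> g \<noteq> 0")
    case False
    \<comment> \<open>Without nonzero roots g is 0 or a monomial with a coefficient, so its modulus
      is constant on the circle and a constant h suffices.\<close>
    have "\<exists>c. \<forall>z. norm z = 1 \<longrightarrow> norm (poly g z) = c"
    proof (cases "g = 0")
      case True
      then show ?thesis by auto
    next
      case g0: False
      obtain k h where h: "g = monom 1 k * h" "poly h 0 \<noteq> 0"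
      proof -
        obtain h where h: "g = [:- 0, 1:] ^ order 0 g * h" "\<not> [:- 0, 1:] dvd h"
          using order_decomp[OF g0, of 0] by blast
        have "poly h 0 \<noteq> 0" using h(2) poly_eq_0_iff_dvd by blast
        moreover have "g = monom 1 (order 0 g) * h" using h(1) by (simp add: monom_altdef)
        ultimately show ?thesis using that by blast
      qed
      have "poly h x \<noteq> 0" for x using False g0 h by (cases "x = 0") auto
      then have "constant (poly h)" using Fundamental_Theorem_Algebra.fundamental_theorem_of_algebra by blast
      then obtain c where "h = [:c:]" by (auto simp: constant_degree elim: degree_eq_zeroE)
      then show ?thesis using h by (auto simp: poly_monom norm_mult norm_power)
    qed
    then obtain c where c: "\<And>z. norm z = 1 \<Longrightarrow> norm (poly g z) = c" by blast
    have "c \<ge> 0" using c[of 1] by auto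
    have "poly g z / z ^ M = poly [:of_real (sqrt c):] z * cnj (poly [:of_real (sqrt c):] z)" if z: "norm z = 1" for z
      using nonneg_eq_norm[OF pos[OF z]] c[OF z] z \<open>c \<ge> 0\<close> by (simp add: norm_divide norm_power flip: of_real_mult)
    then show ?thesis by blast
  next
    case True
    then obtain \<alpha> where \<alpha>: "\<alpha> \<noteq> 0" "poly g \<alpha> = 0" and g0: "g \<noteq> 0" by blast
    obtain g1 where g1: "g = [:- \<alpha>, 1:] * g1" using \<alpha>(2) unfolding poly_eq_0_iff_dvd by (elim dvdE)
    define \<beta> where "\<beta> = 1 / cnj \<alpha>"
    have "poly g1 \<beta> = 0"
    proof (cases "norm \<alpha> = 1")
      case False
      define d where "d = degree g"
      \<comment> \<open>A real value equals its conjugate; on the circle this becomes a polynomial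
        identity between g and its reflection.\<close>
      have eq: "poly (monom 1 d * g) z = poly (monom 1 (2 * M) * cnj_reflect d g) z" if z: "norm z = 1" for z
      proof -
        have z0: "z \<noteq> 0" using z by auto
        have "poly g z / z ^ M = cnj (poly g z / z ^ M)"
          using nonneg_eq_norm[OF pos[OF z]] by (metis complex_cnj_complex_of_real)
        also have "\<dots> = z ^ M * cnj (poly g z)" by (simp add: cnj_circle[OF z] power_divide)
        finally have "poly g z = z ^ M * (z ^ M * cnj (poly g z))" using z0 by (simp add: field_simps)
        moreover have "poly (cnj_reflect d g) z = z ^ d * cnj (poly g z)"
          using poly_cnj_reflect[of g d z] z0 inverse_cnj_circle[OF z] by (simp add: d_def)
        ultimately show ?thesis by (simp add: poly_monom mult_2 power_add)
      qed
      have "monom 1 d * g = monom 1 (2 * M) * cnj_reflect d g"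
      proof (rule ccontr)
        assume "monom 1 d * g \<noteq> monom 1 (2 * M) * cnj_reflect d g"
        then have "finite {z. poly (monom 1 d * g - monom 1 (2 * M) * cnj_reflect d g) z = 0}"
          by (intro poly_roots_finite) simp
        then have "finite unit_circle" by (rule finite_subset[rotated]) (use eq in \<open>auto simp del: poly_mult\<close>)
        then show False using infinite_unit_circle by simp
      qed
      then have "poly (monom 1 d * g) \<beta> = poly (monom 1 (2 * M) * cnj_reflect d g) \<beta>" by simp
      moreover have b0: "\<beta> \<noteq> 0" using \<alpha> by (simp add: \<beta>_def)
      moreover have "1 / cnj \<beta> = \<alpha>" by (simp add: \<beta>_def)
      ultimately have "poly g \<beta> = 0"
        using poly_cnj_reflect[of g d \<beta>] \<alpha>(2) by (simp add: d_def poly_monom)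
      moreover have "\<beta> \<noteq> \<alpha>"
      proof
        assume "\<beta> = \<alpha>"
        then have "\<alpha> * cnj \<alpha> = 1" using \<alpha>(1) unfolding \<beta>_def by (simp add: field_simps)
        then have "(norm \<alpha>)\<^sup>2 = 1" by (metis complex_norm_square of_real_eq_1_iff)
        then show False using False norm_ge_zero[of \<alpha>] by (auto simp: power2_eq_1_iff)
      qed
      ultimately show ?thesis by (simp add: g1)
    next
      case True
      have \<beta>\<alpha>: "\<beta> = \<alpha>" using inverse_cnj_circle[OF True] by (simp add: \<beta>_def)
      \<comment> \<open>Run along the circle through \<alpha>. At a simple zero g / z^M would change
        sign: its derivative \<kappa> along the curve is a limit of nonnegative quotients from the
        right and of nonpositive ones from the left, hence 0.\<close>
      define Z where "Z = (\<lambda>t::real. \<alpha> * exp (\<i> * of_real t))"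
      define \<kappa> where "\<kappa> = (\<i> * \<alpha>) * (poly g1 \<alpha> / \<alpha> ^ M)"
      have nZ: "norm (Z t) = 1" for t using True by (simp add: Z_def norm_mult norm_exp_eq_Re)
      have Z0: "Z 0 = \<alpha>" by (simp add: Z_def)
      have dZ: "((\<lambda>t. (Z t - \<alpha>) / of_real t) \<longlongrightarrow> \<i> * \<alpha>) (at 0)"
      proof -
        have "DERIV (\<lambda>s. \<alpha> * exp (\<i> * s)) 0 :> \<i> * \<alpha>" by (auto intro!: derivative_eq_intros)
        then have "((\<lambda>h. (\<alpha> * exp (\<i> * h) - \<alpha>) / h) \<longlongrightarrow> \<i> * \<alpha>) (at 0)" by (simp add: DERIV_def)
        moreover have "filterlim complex_of_real (at 0) (at 0)"
          unfolding filterlim_at by (auto intro!: tendsto_eq_intros simp: eventually_at_filter)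
        ultimately show ?thesis unfolding Z_def by (rule filterlim_compose)
      qed
      have cZ: "isCont Z 0" unfolding Z_def by (intro continuous_intros)
      have lim: "((\<lambda>t. (Z t - \<alpha>) / of_real t * (poly g1 (Z t) / Z t ^ M)) \<longlongrightarrow> \<kappa>) (at 0)"
        unfolding \<kappa>_def using cZ \<alpha>(1) Z0
        by (intro tendsto_intros dZ) (auto simp: isCont_def)
      have ev: "(Z t - \<alpha>) / of_real t * (poly g1 (Z t) / Z t ^ M) = (poly g (Z t) / Z t ^ M) / of_real t" for t
        by (simp add: g1 field_simps)
      have div: "x / of_real t \<in> nonneg_real" if "x \<in> nonneg_real" "t > 0" for x t
        using that by (auto elim!: nonneg_Reals_cases simp flip: of_real_divide)
      have "\<kappa> \<in> nonneg_real"
      proof (rule Lim_in_closed_set[OF closed_nonneg_Reals_complex])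
        show "((\<lambda>t. (Z t - \<alpha>) / of_real t * (poly g1 (Z t) / Z t ^ M)) \<longlongrightarrow> \<kappa>) (at_right 0)"
          using lim by (simp only: filterlim_at_split)
        show "\<forall>\<^sub>F t in at_right 0. (Z t - \<alpha>) / of_real t * (poly g1 (Z t) / Z t ^ M) \<in> nonneg_real"
          unfolding ev using eventually_at_right_less[of 0] by eventually_elim (intro div pos nZ)
      qed simp
      moreover have "- \<kappa> \<in> nonneg_real"
      proof (rule Lim_in_closed_set[OF closed_nonneg_Reals_complex])
        show "((\<lambda>t. - ((Z t - \<alpha>) / of_real t * (poly g1 (Z t) / Z t ^ M))) \<longlongrightarrow> - \<kappa>) (at_left 0)"
          using lim by (intro tendsto_minus) (simp only: filterlim_at_split)
        have "- (x / of_real t) = x / of_real (- t)" for x :: complex and t by simp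
        then show "\<forall>\<^sub>F t in at_left 0. - ((Z t - \<alpha>) / of_real t * (poly g1 (Z t) / Z t ^ M)) \<in> nonneg_real"
          unfolding ev using eventually_at_left_field[of _ "0::real"] div[OF pos[OF nZ]]
          by (metis (mono_tags, lifting) less_add_one neg_0_less_iff_less add_0 eventually_at_left zero_less_one neg_less_0_iff_less)
      qed simp
      ultimately have "\<kappa> = 0" by (auto elim!: nonneg_Reals_cases simp: complex_eq_iff)
      then show ?thesis using \<alpha>(1) by (simp add: \<kappa>_def \<beta>\<alpha>)
    qed
    then obtain g2 where g2: "g1 = [:- \<beta>, 1:] * g2" unfolding poly_eq_0_iff_dvd by (elim dvdE)
    define g3 where "g3 = Polynomial.smult (- 1 / cnj \<alpha>) g2"
    have gz: "poly g z = (z - \<alpha>) * (1 - cnj \<alpha> * z) * poly g3 z" for z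
      unfolding g1 g2 g3_def \<beta>_def using \<alpha>(1) by (simp add: field_simps)
    \<comment> \<open>The factor z is the one that appears in \<open>norm_sq_circle\<close>. Two
      roots are removed and one at 0 is added, so the degree drops while M stays the same.\<close>
    define g' where "g' = pCons 0 g3"
    have g30: "g3 \<noteq> 0" using gz g0 by (auto simp: g1 g2 g3_def \<alpha>(1))
    have "degree g = Suc (Suc (degree g3))"
    proof -
      have "g2 \<noteq> 0" using g0 g1 g2 by auto
      then have "degree ([:- \<beta>, 1:] * g2) = Suc (degree g2)" by (subst degree_mult_eq) auto
      moreover have "degree g = Suc (degree g1)" using g0 unfolding g1 by (subst degree_mult_eq) auto
      ultimately have "degree g = Suc (Suc (degree g2))" unfolding g2 by simp
      then show ?thesis using \<alpha>(1) by (simp add: g3_def)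
    qed
    then have deg: "degree g' < degree g" by (simp add: g'_def g30)
    have gg': "poly g z / z ^ M = of_real ((norm (z - \<alpha>))\<^sup>2) * (poly g' z / z ^ M)" if "norm z = 1" for z
      unfolding gz norm_sq_circle[OF that] by (simp add: g'_def)
    have "poly g' z / z ^ M \<in> nonneg_real" if "norm z = 1" for z
    proof (rule circle_closed_extend[OF closed_nonneg_Reals_complex, where B = "{\<alpha>}" and \<phi> = "\<lambda>z. poly g' z / z ^ M"])
      show "continuous_on unit_circle (\<lambda>z. poly g' z / z ^ M)" by (intro continuous_intros) auto
      fix z :: complex assume z: "norm z = 1" "z \<notin> {\<alpha>}"
      then have "poly g' z / z ^ M = (poly g z / z ^ M) / of_real ((norm (z - \<alpha>))\<^sup>2)"
        unfolding gg'[OF z(1)] by simp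
      then show "poly g' z / z ^ M \<in> nonneg_real"
        using nonneg_Reals_divide_I[OF pos[OF z(1)] nonneg_RealsI[of "(norm (z - \<alpha>))\<^sup>2"]] by simp
    qed (use that in auto)
    from less.hyps[OF deg this] obtain h where h: "\<And>z. norm z = 1 \<Longrightarrow> poly g' z / z ^ M = poly h z * cnj (poly h z)" by blast
    have "poly g z / z ^ M = poly ([:- \<alpha>, 1:] * h) z * cnj (poly ([:- \<alpha>, 1:] * h) z)" if z: "norm z = 1" for z
      unfolding gg'[OF z] h[OF z] complex_norm_square by (simp add: algebra_simps)
    then show ?thesis by blast
  qed
qed

lemma Fejer_Riesz:
  assumes "trig a" "finite B" "\<And>z. norm z = 1 \<Longrightarrow> z \<notin> B \<Longrightarrow> a z \<in> nonneg_real"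
  shows "\<exists>h. \<forall>z. norm z = 1 \<longrightarrow> a z = poly h z * cnj (poly h z)"
proof -
  obtain g M where g: "\<And>z. norm z = 1 \<Longrightarrow> a z = poly g z / z ^ M" using assms(1) unfolding trig_def by blast
  have "a z \<in> nonneg_real" if "norm z = 1" for z
    using circle_closed_extend[OF closed_nonneg_Reals_complex assms(2) trig_continuous[OF assms(1)]] assms(3) that by blast
  then have "\<exists>h. \<forall>z. norm z = 1 \<longrightarrow> poly g z / z ^ M = poly h z * cnj (poly h z)"
    using g by (intro Fejer_Riesz_poly) auto
  then show ?thesis using g by auto
qed

section \<open>Fraction-free Cholesky factorization over the circle\<close>

definition sesq :: "nat \<Rightarrow> (nat \<Rightarrow> nat \<Rightarrow> complex) \<Rightarrow> (nat \<Rightarrow> complex) \<Rightarrow> complex" where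
  "sesq n A x = (\<Sum>j<n. \<Sum>k<n. cnj (x j) * A j k * x k)"

definition posdef :: "nat \<Rightarrow> (nat \<Rightarrow> nat \<Rightarrow> complex) \<Rightarrow> bool" where
  "posdef n A \<longleftrightarrow> (\<forall>j<n. \<forall>k<n. A j k = cnj (A k j)) \<and> (\<forall>x. (\<exists>i<n. x i \<noteq> 0) \<longrightarrow> Re (sesq n A x) > 0)"

lemma posdef_pos: "posdef n A \<Longrightarrow> i < n \<Longrightarrow> x i \<noteq> 0 \<Longrightarrow> Re (sesq n A x) > 0"
  unfolding posdef_def by blast

lemma sesq_Suc:
  "sesq (Suc n) A x = cnj (x 0) * A 0 0 * x 0 + cnj (x 0) * (\<Sum>k<n. A 0 (Suc k) * x (Suc k))
    + (\<Sum>j<n. cnj (x (Suc j)) * A (Suc j) 0) * x 0 + sesq n (\<lambda>j k. A (Suc j) (Suc k)) (\<lambda>j. x (Suc j))"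
  unfolding sesq_def
  by (simp add: sum.lessThan_Suc_shift sum.distrib sum_distrib_left sum_distrib_right mult.assoc del: sum.lessThan_Suc)

lemma posdef_diag:
  assumes "posdef (Suc n) A"
  shows "A 0 0 = of_real (Re (A 0 0))" "Re (A 0 0) > 0"
proof -
  have "A 0 0 = cnj (A 0 0)" using assms unfolding posdef_def by blast
  then show "A 0 0 = of_real (Re (A 0 0))" by (simp add: complex_eq_iff)
  have "Re (sesq (Suc n) A (\<lambda>i. if i = 0 then 1 else 0)) > 0"
    by (rule posdef_pos[OF assms, of 0]) auto
  then show "Re (A 0 0) > 0" unfolding sesq_Suc by (simp add: sesq_def)
qed

text \<open>This is the Schur complement times the pivot \<open>A 0 0\<close>; without division,
  trigonometric polynomials stay such. For positivity, the first coordinate is chosen to minimise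
  the form for the given remaining ones.\<close>

lemma posdef_Schur:
  assumes pd: "posdef (Suc n) A"
  shows "posdef n (\<lambda>j k. A 0 0 * A (Suc j) (Suc k) - A (Suc j) 0 * cnj (A (Suc k) 0))"
proof -
  have herm: "A j k = cnj (A k j)" if "j < Suc n" "k < Suc n" for j k using pd that unfolding posdef_def by blast
  note a = posdef_diag[OF pd]
  define a where "a = Re (A 0 0)"
  have a': "A 0 0 = of_real a" "a > 0" using a by (simp_all add: a_def)
  show ?thesis unfolding posdef_def
  proof (intro conjI allI impI)
    fix j k assume "j < n" "k < n"
    then show "A 0 0 * A (Suc j) (Suc k) - A (Suc j) 0 * cnj (A (Suc k) 0) =
        cnj (A 0 0 * A (Suc k) (Suc j) - A (Suc k) 0 * cnj (A (Suc j) 0))"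
      using herm[of "Suc j" "Suc k"] by (simp add: a')
  next
    fix y :: "nat \<Rightarrow> complex" assume y: "\<exists>i<n. y i \<noteq> 0"
    define s where "s = (\<Sum>k<n. A 0 (Suc k) * y k)"
    have cs: "(\<Sum>j<n. cnj (y j) * A (Suc j) 0) = cnj s"
      unfolding s_def cnj_sum using herm[of 0] by (intro sum.cong) (auto simp: mult.commute)
    define x where "x = (\<lambda>i. case i of 0 \<Rightarrow> - s / of_real a | Suc k \<Rightarrow> y k)"
    from y obtain i where "i < n" "y i \<noteq> 0" by blast
    then have "Re (sesq (Suc n) A x) > 0"
      by (intro posdef_pos[OF pd, of "Suc i"]) (auto simp: x_def)
    then have "Re (of_real a * sesq (Suc n) A x) > 0" using a' by simp
    also have "of_real a * sesq (Suc n) A x = of_real a * sesq n (\<lambda>j k. A (Suc j) (Suc k)) y - cnj s * s"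
    proof -
      have x: "x 0 = - s / of_real a" "\<And>k. x (Suc k) = y k" by (simp_all add: x_def)
      show ?thesis unfolding sesq_Suc x s_def[symmetric] cs a' using a'(2) by (simp add: field_simps)
    qed
    also have "\<dots> = sesq n (\<lambda>j k. A 0 0 * A (Suc j) (Suc k) - A (Suc j) 0 * cnj (A (Suc k) 0)) y"
    proof -
      have "cnj s * s = (\<Sum>j<n. \<Sum>k<n. cnj (y j) * (A (Suc j) 0 * cnj (A (Suc k) 0)) * y k)"
      proof -
        have "cnj s * s = (\<Sum>j<n. cnj (y j) * A (Suc j) 0) * (\<Sum>k<n. cnj (A (Suc k) 0) * y k)"
          using cs herm[of 0] unfolding s_def by (auto intro!: arg_cong2[where f = "(*)"] sum.cong)
        then show ?thesis by (simp only: sum_product mult.assoc)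
      qed
      then show ?thesis unfolding sesq_def a'
        by (simp add: sum_distrib_left sum_subtractf[symmetric] algebra_simps)
    qed
    finally show "Re (sesq n (\<lambda>j k. A 0 0 * A (Suc j) (Suc k) - A (Suc j) 0 * cnj (A (Suc k) 0)) y) > 0" .
  qed
qed

text \<open>By Fejer-Riesz the pivot a is |g|^2 on the circle, and a S is the rank one matrix of the
  first column plus the fraction-free Schur complement. Multiplying by the |d|^2 of the smaller
  problem gives both summands polynomial factors, with the new scalar d g.\<close>

lemma trig_Cholesky:
  assumes "\<And>j k. j < n \<Longrightarrow> k < n \<Longrightarrow> trig (S j k)" "finite B"
    "\<And>z. norm z = 1 \<Longrightarrow> z \<notin> B \<Longrightarrow> posdef n (\<lambda>j k. S j k z)"
  shows "\<exists>d L. d \<noteq> 0 \<and> (\<forall>z. norm z = 1 \<longrightarrow> z \<notin> B \<longrightarrow> (\<forall>j<n. \<forall>k<n.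
    poly d z * cnj (poly d z) * S j k z = (\<Sum>l<n. poly (L j l) z * cnj (poly (L k l) z))))"
  using assms
proof (induction n arbitrary: S)
  case 0
  then show ?case by (intro exI[of _ 1]) simp
next
  case (Suc n)
  define a where "a = S 0 0"
  have a: "a z = of_real (Re (a z))" "Re (a z) > 0" if "norm z = 1" "z \<notin> B" for z
    using posdef_diag[OF Suc.prems(3)[OF that]] by (simp_all add: a_def)
  have ta: "trig a" unfolding a_def by (rule Suc.prems(1)) auto
  have "a z \<in> nonneg_real" if "norm z = 1" "z \<notin> B" for z
    using a[OF that] by (metis nonneg_RealsI less_imp_le)
  from Fejer_Riesz[OF ta Suc.prems(2) this] obtain g
    where g: "\<And>z. norm z = 1 \<Longrightarrow> a z = poly g z * cnj (poly g z)" by blast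
  define S' where "S' = (\<lambda>j k z. a z * S (Suc j) (Suc k) z - S (Suc j) 0 z * cnj (S (Suc k) 0 z))"
  have "\<exists>d L. d \<noteq> 0 \<and> (\<forall>z. norm z = 1 \<longrightarrow> z \<notin> B \<longrightarrow> (\<forall>j<n. \<forall>k<n.
    poly d z * cnj (poly d z) * S' j k z = (\<Sum>l<n. poly (L j l) z * cnj (poly (L k l) z))))"
  proof (rule Suc.IH)
    show "trig (S' j k)" if "j < n" "k < n" for j k
      unfolding S'_def using that by (intro trig_diff trig_mult trig_cnj ta Suc.prems(1)) auto
    show "posdef n (\<lambda>j k. S' j k z)" if "norm z = 1" "z \<notin> B" for z
      unfolding S'_def a_def by (rule posdef_Schur[OF Suc.prems(3)[OF that]])
  qed (rule Suc.prems)
  then obtain d L where d: "d \<noteq> 0" and L: "\<And>z j k. norm z = 1 \<Longrightarrow> z \<notin> B \<Longrightarrow> j < n \<Longrightarrow> k < n \<Longrightarrow>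
    poly d z * cnj (poly d z) * S' j k z = (\<Sum>l<n. poly (L j l) z * cnj (poly (L k l) z))" by blast
  \<comment> \<open>A common power of z turns the first column into polynomials; having modulus 1 on
    the circle, it drops out of the products.\<close>
  obtain M p where p: "\<And>j z. j < Suc n \<Longrightarrow> norm z = 1 \<Longrightarrow> z ^ M * S j 0 z = poly (p j) z"
    using trig_common[of "Suc n" "\<lambda>j. S j 0"] Suc.prems(1) by blast
  define K where "K = (\<lambda>j l. case l of 0 \<Rightarrow> d * p j | Suc l' \<Rightarrow> (case j of 0 \<Rightarrow> 0 | Suc j' \<Rightarrow> L j' l'))"
  have "g \<noteq> 0"
  proof
    assume "g = 0"
    have "infinite (unit_circle - B)" using infinite_unit_circle Suc.prems(2) by simp
    then obtain z where "z \<in> unit_circle - B" by (metis finite.emptyI ex_in_conv)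
    then show False using a[of z] g[of z] \<open>g = 0\<close> by auto
  qed
  have "poly (d * g) z * cnj (poly (d * g) z) * S j k z = (\<Sum>l<Suc n. poly (K j l) z * cnj (poly (K k l) z))"
    if z: "norm z = 1" "z \<notin> B" and jk: "j < Suc n" "k < Suc n" for z j k
  proof -
    define D where "D = poly d z * cnj (poly d z)"
    have herm: "S j k z = cnj (S k j z)" if "j < Suc n" "k < Suc n" for j k
      using Suc.prems(3)[OF z] that unfolding posdef_def by blast
    have zz: "z ^ M * cnj (z ^ M) = 1" using z(1) by (metis complex_norm_square norm_power of_real_1 power_one)
    have "poly (p j) z * cnj (poly (p k) z) = z ^ M * cnj (z ^ M) * (S j 0 z * cnj (S k 0 z))"
      unfolding p[OF jk(1) z(1), symmetric] p[OF jk(2) z(1), symmetric] by simp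
    then have p0: "poly (K j 0) z * cnj (poly (K k 0) z) = D * (S j 0 z * cnj (S k 0 z))"
      unfolding zz by (simp add: K_def D_def mult_ac)
    have LHS: "poly (d * g) z * cnj (poly (d * g) z) * S j k z = D * (a z * S j k z)"
      unfolding g[OF z(1)] by (simp add: D_def mult_ac)
    have ca: "cnj (a z) = a z" using a[OF z] by (metis complex_cnj_complex_of_real)
    show ?thesis
    proof (cases "j = 0 \<or> k = 0")
      case True
      then have "(\<Sum>l<n. poly (K j (Suc l)) z * cnj (poly (K k (Suc l)) z)) = 0"
        by (auto simp: K_def)
      moreover have "S j 0 z * cnj (S k 0 z) = a z * S j k z"
        using True ca herm[OF jk] herm[OF _ jk(2), of 0] by (auto simp: a_def)
      ultimately show ?thesis unfolding LHS sum.lessThan_Suc_shift p0 by simp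
    next
      case False
      then obtain j' k' where j': "j = Suc j'" "k = Suc k'" "j' < n" "k' < n" using jk by (metis not0_implies_Suc Suc_less_eq)
      have "(\<Sum>l<n. poly (K j (Suc l)) z * cnj (poly (K k (Suc l)) z)) = D * S' j' k' z"
        unfolding D_def L[OF z j'(3,4)] by (simp add: K_def j')
      then show ?thesis unfolding LHS sum.lessThan_Suc_shift p0 by (simp add: S'_def j' algebra_simps)
    qed
  qed
  then show ?case using d \<open>g \<noteq> 0\<close> by (intro exI[of _ "d * g"] exI[of _ K]) auto
qed

section \<open>Unitary matrices\<close>

lemma mat_adjoint_dim [simp]:
  fixes A :: "complex mat"
  shows "dim_row (mat_adjoint A) = dim_col A" "dim_col (mat_adjoint A) = dim_row A"
  by (simp_all add: mat_adjoint_def)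

lemma mat_adjoint_index [simp]:
  fixes A :: "complex mat"
  shows "i < dim_col A \<Longrightarrow> j < dim_row A \<Longrightarrow> mat_adjoint A $$ (i, j) = cnj (A $$ (j, i))"
  by (simp add: mat_adjoint_def mat_of_rows_def)

lemma mat_adjoint_carrier [simp]:
  fixes A :: "complex mat"
  shows "A \<in> carrier_mat n m \<Longrightarrow> mat_adjoint A \<in> carrier_mat m n"
  by auto

lemma mat_adjoint_mult:
  fixes A B :: "complex mat"
  assumes "A \<in> carrier_mat n m" "B \<in> carrier_mat m k"
  shows "mat_adjoint (A * B) = mat_adjoint B * mat_adjoint A"
  by (rule eq_matI) (use assms in \<open>auto simp: scalar_prod_def mult.commute\<close>)

lemma mat_adjoint_adjoint [simp]:
  fixes A :: "complex mat"
  shows "mat_adjoint (mat_adjoint A) = A"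
  by (rule eq_matI) auto

lemma unitary_matI:
  assumes "U \<in> carrier_mat n n" "U * mat_adjoint U = 1\<^sub>m n"
  shows "unitary_mat U"
  using assms mat_mult_left_right_inverse[OF assms(1) _ assms(2)]
  by (auto simp: unitary_mat_def inverts_mat_def)

lemma unitary_matD:
  assumes "unitary_mat U" "U \<in> carrier_mat n n"
  shows "U * mat_adjoint U = 1\<^sub>m n" "mat_adjoint U * U = 1\<^sub>m n"
  using assms by (auto simp: unitary_mat_def inverts_mat_def)

lemma unitary_mat_mult:
  assumes U: "unitary_mat U" "U \<in> carrier_mat n n" and V: "unitary_mat V" "V \<in> carrier_mat n n"
  shows "unitary_mat (U * V)"
proof (rule unitary_matI)
  have "U * V * mat_adjoint (U * V) = U * V * (mat_adjoint V * mat_adjoint U)"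
    using U V by (subst mat_adjoint_mult) auto
  also have "\<dots> = U * (V * mat_adjoint V) * mat_adjoint U"
  proof -
    have c: "mat_adjoint U \<in> carrier_mat n n" "mat_adjoint V \<in> carrier_mat n n" using U V by auto
    have "U * V * (mat_adjoint V * mat_adjoint U) = U * (V * (mat_adjoint V * mat_adjoint U))"
      by (rule assoc_mult_mat[OF U(2) V(2) mult_carrier_mat[OF c(2,1)]])
    also have "V * (mat_adjoint V * mat_adjoint U) = V * mat_adjoint V * mat_adjoint U"
      by (rule assoc_mult_mat[symmetric, OF V(2) c(2,1)])
    also have "U * (V * mat_adjoint V * mat_adjoint U) = U * (V * mat_adjoint V) * mat_adjoint U"
      by (rule assoc_mult_mat[symmetric, OF U(2) _ c(1)]) (use V c in auto)
    finally show ?thesis .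
  qed
  also have "\<dots> = 1\<^sub>m n" using U V by (simp add: unitary_matD)
  finally show "U * V * mat_adjoint (U * V) = 1\<^sub>m n" .
qed (use U V in auto)

lemma cscalar_prod_sum: "dim_vec w = n \<Longrightarrow> v \<bullet>c w = (\<Sum>i<n. v $ i * cnj (w $ i))"
  for v w :: "complex vec"
  by (simp add: scalar_prod_def lessThan_atLeast0)

lemma adjoint_cscalar_prod:
  fixes A :: "complex mat"
  assumes "A \<in> carrier_mat n m" "v \<in> carrier_vec m" "w \<in> carrier_vec n"
  shows "(A *\<^sub>v v) \<bullet>c w = v \<bullet>c (mat_adjoint A *\<^sub>v w)"
proof -
  have "(A *\<^sub>v v) \<bullet>c w = (\<Sum>i<n. (\<Sum>j<m. A $$ (i, j) * v $ j) * cnj (w $ i))"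
    using assms by (simp add: cscalar_prod_sum[of _ n] scalar_prod_def lessThan_atLeast0)
  also have "\<dots> = (\<Sum>i<n. \<Sum>j<m. v $ j * cnj (cnj (A $$ (i, j)) * w $ i))"
    by (simp add: sum_distrib_right sum_distrib_left mult_ac)
  also have "\<dots> = (\<Sum>j<m. \<Sum>i<n. v $ j * cnj (cnj (A $$ (i, j)) * w $ i))" by (rule sum.swap)
  also have "\<dots> = v \<bullet>c (mat_adjoint A *\<^sub>v w)"
    using assms by (simp add: cscalar_prod_sum[of _ m] scalar_prod_def lessThan_atLeast0 sum_distrib_left)
  finally show ?thesis .
qed

lemma unitary_preserves:
  fixes U :: "complex mat"
  assumes "unitary_mat U" "U \<in> carrier_mat n n" "v \<in> carrier_vec n" "w \<in> carrier_vec n"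
  shows "(U *\<^sub>v v) \<bullet>c (U *\<^sub>v w) = v \<bullet>c w"
proof -
  have "(U *\<^sub>v v) \<bullet>c (U *\<^sub>v w) = v \<bullet>c (mat_adjoint U *\<^sub>v (U *\<^sub>v w))"
    using assms by (intro adjoint_cscalar_prod) auto
  also have "mat_adjoint U *\<^sub>v (U *\<^sub>v w) = (mat_adjoint U * U) *\<^sub>v w"
    using assms by (intro assoc_mult_mat_vec[symmetric]) auto
  also have "\<dots> = w" using assms by (simp add: unitary_matD)
  finally show ?thesis .
qed

lemma cscalar_prod_self: "v \<in> carrier_vec n \<Longrightarrow> v \<bullet>c v = of_real (\<Sum>i<n. (norm (v $ i))\<^sup>2)"
  for v :: "complex vec"
  by (simp add: cscalar_prod_sum[of _ n] complex_norm_square[symmetric] del: of_real_power flip: of_real_power)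

lemma cscalar_prod_self_eq_0:
  fixes v :: "complex vec"
  assumes "v \<in> carrier_vec n" "v \<bullet>c v = 0"
  shows "v = 0\<^sub>v n"
  using assms by (metis conjugate_square_eq_0_vec)

lemma cscalar_prod_cnj:
  fixes v w :: "complex vec"
  assumes "v \<in> carrier_vec n" "w \<in> carrier_vec n"
  shows "cnj (v \<bullet>c w) = w \<bullet>c v"
  using assms by (simp add: cscalar_prod_sum[of _ n] mult.commute)

text \<open>The Householder-type reflection I - d d^* / (d^* x) with d = x - y is unitary, maps x to y, and fixes
  the orthogonal complement of d.\<close>

lemma unitary_reflection:
  fixes x y :: "complex vec"
  assumes x: "x \<in> carrier_vec n" and y: "y \<in> carrier_vec n" and eq: "x \<bullet>c x = y \<bullet>c y"
  shows "\<exists>H. H \<in> carrier_mat n n \<and> unitary_mat H \<and> H *\<^sub>v x = y \<and>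
    (\<forall>v\<in>carrier_vec n. x \<bullet>c v = y \<bullet>c v \<longrightarrow> H *\<^sub>v v = v)"
proof (cases "x = y")
  case True
  have "unitary_mat (1\<^sub>m n)" by (rule unitary_matI[of _ n]) (auto intro!: eq_matI simp: scalar_prod_def sum.delta)
  then show ?thesis using True x y by (intro exI[of _ "1\<^sub>m n"]) auto
next
  case False
  define d where "d = x - y"
  have d: "d \<in> carrier_vec n" using x y by (simp add: d_def)
  define \<tau> where "\<tau> = x \<bullet>c d"
  define \<sigma> where "\<sigma> = 1 / \<tau>"
  have idx: "d $ i = x $ i - y $ i" if "i < n" for i using that x y by (simp add: d_def)
  have \<tau>: "\<tau> = x \<bullet>c x - x \<bullet>c y" unfolding \<tau>_def
    using x y d by (simp add: idx cscalar_prod_sum[of _ n] right_diff_distrib sum_subtractf)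
  \<comment> \<open>This identity, a consequence of x and y having equal norms, is what makes the
    reflection unitary.\<close>
  have dd: "d \<bullet>c d = \<tau> + cnj \<tau>"
  proof -
    have "d \<bullet>c d = x \<bullet>c x - x \<bullet>c y - y \<bullet>c x + y \<bullet>c y"
      using x y d by (simp add: idx cscalar_prod_sum[of _ n] algebra_simps sum_subtractf sum.distrib)
    then show ?thesis unfolding \<tau> using cscalar_prod_cnj[OF x y] cscalar_prod_cnj[OF x x] eq by simp
  qed
  have "\<tau> \<noteq> 0"
  proof
    assume "\<tau> = 0"
    then have d0: "d = 0\<^sub>v n" using dd by (intro cscalar_prod_self_eq_0[OF d]) simp
    have "x $ i = y $ i" if "i < n" for i using idx[OF that] that unfolding d0 by simp
    then have "x = y" using x y by (intro eq_vecI) auto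
    then show False using False by contradiction
  qed
  define H where "H = mat n n (\<lambda>(i, j). (if i = j then 1 else 0) - \<sigma> * d $ i * cnj (d $ j))"
  have H: "H \<in> carrier_mat n n" by (simp add: H_def)
  have Hv: "H *\<^sub>v v = v - (\<sigma> * (v \<bullet>c d)) \<cdot>\<^sub>v d" if v: "v \<in> carrier_vec n" for v
  proof (rule eq_vecI)
    fix i assume "i < dim_vec (v - (\<sigma> * (v \<bullet>c d)) \<cdot>\<^sub>v d)"
    then have i: "i < n" using d by simp
    have "(H *\<^sub>v v) $ i = (\<Sum>j<n. ((if i = j then 1 else 0) - \<sigma> * d $ i * cnj (d $ j)) * v $ j)"
      using i v by (simp add: H_def scalar_prod_def lessThan_atLeast0)
    also have "\<dots> = (\<Sum>j<n. (if i = j then v $ j else 0)) - (\<Sum>j<n. \<sigma> * d $ i * cnj (d $ j) * v $ j)"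
      unfolding sum_subtractf[symmetric] by (intro sum.cong) (auto simp: algebra_simps)
    also have "\<dots> = v $ i - \<sigma> * (v \<bullet>c d) * d $ i"
      using i d by (simp add: sum.delta' cscalar_prod_sum[of _ n] sum_distrib_left sum_distrib_right mult_ac)
    finally show "(H *\<^sub>v v) $ i = (v - (\<sigma> * (v \<bullet>c d)) \<cdot>\<^sub>v d) $ i" using i v d by simp
  qed (use d in \<open>simp add: H_def\<close>)
  have "H * mat_adjoint H = 1\<^sub>m n"
  proof (rule eq_matI)
    fix i j assume "i < dim_row (1\<^sub>m n)" "j < dim_col (1\<^sub>m n)"
    then have ij: "i < n" "j < n" by auto
    let ?\<delta> = "\<lambda>i j. if i = j then 1 else 0 :: complex"
    have "(H * mat_adjoint H) $$ (i, j) =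
        (\<Sum>k<n. (?\<delta> i k - \<sigma> * d $ i * cnj (d $ k)) * (?\<delta> j k - cnj \<sigma> * cnj (d $ j) * d $ k))"
      using ij H by (simp add: scalar_prod_def lessThan_atLeast0) (auto simp: H_def intro!: sum.cong)
    also have "\<dots> = (\<Sum>k<n. (if i = k then ?\<delta> j k else 0)) - (\<Sum>k<n. if i = k then cnj \<sigma> * cnj (d $ j) * d $ k else 0)
        - (\<Sum>k<n. if j = k then \<sigma> * d $ i * cnj (d $ k) else 0)
        + (\<Sum>k<n. \<sigma> * cnj \<sigma> * (d $ i * cnj (d $ j)) * (d $ k * cnj (d $ k)))"
      unfolding sum_subtractf[symmetric] sum.distrib[symmetric]
      by (intro sum.cong refl) (simp add: algebra_simps)
    also have "\<dots> = ?\<delta> j i - cnj \<sigma> * cnj (d $ j) * d $ i - \<sigma> * d $ i * cnj (d $ j)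
        + \<sigma> * cnj \<sigma> * (d $ i * cnj (d $ j)) * (d \<bullet>c d)"
      using ij d by (simp add: sum.delta' cscalar_prod_sum[of _ n] sum_distrib_left)
    also have "\<dots> = ?\<delta> j i" unfolding dd \<sigma>_def using \<open>\<tau> \<noteq> 0\<close> by (simp add: field_simps)
    finally show "(H * mat_adjoint H) $$ (i, j) = 1\<^sub>m n $$ (i, j)" using ij by simp
  qed (simp_all add: H_def)
  then have "unitary_mat H" by (rule unitary_matI[OF H])
  moreover have "H *\<^sub>v x = y"
    unfolding Hv[OF x] \<tau>_def[symmetric] \<sigma>_def using \<open>\<tau> \<noteq> 0\<close> x y by (intro eq_vecI) (auto simp: d_def)
  moreover have "H *\<^sub>v v = v" if v: "v \<in> carrier_vec n" and xv: "x \<bullet>c v = y \<bullet>c v" for v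
  proof -
    have "v \<bullet>c x = v \<bullet>c y" using xv cscalar_prod_cnj[OF x v] cscalar_prod_cnj[OF y v] by simp
    then have "v \<bullet>c d = 0" using x y v
      by (simp add: d_def cscalar_prod_sum[of _ n] right_diff_distrib sum_subtractf)
    then show ?thesis unfolding Hv[OF v] using v d by (intro eq_vecI) auto
  qed
  ultimately show ?thesis using H by blast
qed

text \<open>Vectors are matched one at a time, by composing with a reflection that takes U x_k to
  y_k. By equality of the Gram matrices, each earlier y_i has the same product with both and stays
  fixed.\<close>

lemma unitary_extension:
  fixes x y :: "nat \<Rightarrow> complex vec"
  assumes "\<And>i. i < k \<Longrightarrow> x i \<in> carrier_vec n" "\<And>i. i < k \<Longrightarrow> y i \<in> carrier_vec n"
    and "\<And>i j. i < k \<Longrightarrow> j < k \<Longrightarrow> x i \<bullet>c x j = y i \<bullet>c y j"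
  shows "\<exists>U. U \<in> carrier_mat n n \<and> unitary_mat U \<and> (\<forall>i<k. U *\<^sub>v x i = y i)"
  using assms
proof (induction k)
  case 0
  have "unitary_mat (1\<^sub>m n)" by (rule unitary_matI[of _ n]) (auto intro!: eq_matI simp: scalar_prod_def sum.delta)
  then show ?case by (intro exI[of _ "1\<^sub>m n"]) auto
next
  case (Suc k)
  have "\<exists>U. U \<in> carrier_mat n n \<and> unitary_mat U \<and> (\<forall>i<k. U *\<^sub>v x i = y i)"
    by (rule Suc.IH) (use Suc.prems in auto)
  then obtain U where U: "U \<in> carrier_mat n n" "unitary_mat U" "\<And>i. i < k \<Longrightarrow> U *\<^sub>v x i = y i" by blast
  have xk: "x k \<in> carrier_vec n" and yk: "y k \<in> carrier_vec n" using Suc.prems by auto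
  have Uk: "U *\<^sub>v x k \<in> carrier_vec n" using U xk by auto
  have "(U *\<^sub>v x k) \<bullet>c (U *\<^sub>v x k) = y k \<bullet>c y k"
    using unitary_preserves[OF U(2,1) xk xk] Suc.prems(3)[of k k] by simp
  from unitary_reflection[OF Uk yk this] obtain H where H: "H \<in> carrier_mat n n" "unitary_mat H"
    "H *\<^sub>v (U *\<^sub>v x k) = y k" "\<And>v. v \<in> carrier_vec n \<Longrightarrow> (U *\<^sub>v x k) \<bullet>c v = y k \<bullet>c v \<Longrightarrow> H *\<^sub>v v = v" by blast
  have HU: "(H * U) *\<^sub>v v = H *\<^sub>v (U *\<^sub>v v)" if "v \<in> carrier_vec n" for v
    using H(1) U(1) that by (rule assoc_mult_mat_vec)
  have "(H * U) *\<^sub>v x i = y i" if i: "i < Suc k" for i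
  proof (cases "i = k")
    case True
    then show ?thesis using HU[OF xk] H(3) by simp
  next
    case False
    then have ik: "i < k" using i by simp
    then have xi: "x i \<in> carrier_vec n" and yi: "y i \<in> carrier_vec n" using Suc.prems by auto
    have "(U *\<^sub>v x k) \<bullet>c y i = y k \<bullet>c y i"
      using unitary_preserves[OF U(2,1) xk xi] U(3)[OF ik] Suc.prems(3)[of k i] ik by simp
    then show ?thesis using HU[OF xi] U(3)[OF ik] H(4)[OF yi] by simp
  qed
  then show ?case using H U unitary_mat_mult[OF H(2,1) U(2,1)] by (intro exI[of _ "H * U"]) auto
qed

section \<open>Spectral factorization of trigonometric matrices\<close>

abbreviation evm :: "complex \<Rightarrow> complex poly mat \<Rightarrow> complex mat" where
  "evm z \<equiv> map_mat (\<lambda>p. poly p z)"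

lemma comm_ring_hom_poly: "comm_ring_hom (\<lambda>p::complex poly. poly p z)"
  by unfold_locales auto

lemma det_evm: "det (evm z A) = poly (det A) z"
  by (rule comm_ring_hom.hom_det[OF comm_ring_hom_poly])

lemma evm_mult: "A \<in> carrier_mat n m \<Longrightarrow> B \<in> carrier_mat m k \<Longrightarrow> evm z (A * B) = evm z A * evm z B"
  by (intro eq_matI) (auto simp: scalar_prod_def poly_sum)

lemma evm_smult: "evm z (c \<cdot>\<^sub>m A) = poly c z \<cdot>\<^sub>m evm z A"
  by (rule eq_matI) auto

lemma evm_const: "evm z (map_mat (\<lambda>c. [:c:]) V) = V"
  by (rule eq_matI) auto

lemma circle_factor:
  assumes "norm z = 1"
  shows "(1 - cnj \<alpha> * z) * cnj (1 - cnj \<alpha> * z) = (z - \<alpha>) * cnj (z - \<alpha>)"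
proof -
  have "z * cnj z = 1" using assms by (simp add: complex_norm_square[symmetric])
  then have "z * cnj z * (\<alpha> * cnj \<alpha>) = \<alpha> * cnj \<alpha>" by simp
  with \<open>z * cnj z = 1\<close> show ?thesis by (simp add: algebra_simps)
qed

text \<open>Zeros in the disc with multiplicity, the induction measure of
  \<open>outer_factor\<close>.\<close>

definition disc_root_count :: "complex poly \<Rightarrow> nat" where
  "disc_root_count p = size (filter_mset (\<lambda>a. norm a < 1) (proots p))"

lemma disc_root_count_mult: "p \<noteq> 0 \<Longrightarrow> q \<noteq> 0 \<Longrightarrow> disc_root_count (p * q) = disc_root_count p + disc_root_count q"
  by (simp add: disc_root_count_def proots_mult)

lemma disc_root_count_smult: "c \<noteq> 0 \<Longrightarrow> disc_root_count (Polynomial.smult c p) = disc_root_count p"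
  by (simp add: disc_root_count_def)

lemma disc_root_count_0:
  assumes "disc_root_count p = 0" "p \<noteq> 0" "norm z < 1"
  shows "poly p z \<noteq> 0"
proof
  assume "poly p z = 0"
  then have "z \<in># filter_mset (\<lambda>a. norm a < 1) (proots p)" using assms by simp
  then show False using assms(1) unfolding disc_root_count_def by auto
qed

lemma disc_root_count_linear: "norm \<alpha> < 1 \<Longrightarrow> disc_root_count [:- \<alpha>, 1:] = 1"
  by (simp add: disc_root_count_def proots_linear_factor)

text \<open>The reflected factor vanishes at most at 1 / cnj \<alpha>, which lies outside the
  disc.\<close>

lemma disc_root_count_reflected:
  assumes "norm \<alpha> < 1"
  shows "disc_root_count [:1, - cnj \<alpha>:] = 0"
proof -
  have "norm a \<ge> 1" if "a \<in># proots [:1, - cnj \<alpha>:]" for a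
  proof (rule ccontr)
    assume "\<not> norm a \<ge> 1"
    have "poly [:1, - cnj \<alpha>:] a = 0" using that by (subst (asm) set_count_proots) auto
    then have "norm (a * cnj \<alpha>) = 1" by (simp add: algebra_simps)
    moreover have "norm a * norm \<alpha> < 1 * 1" using \<open>\<not> norm a \<ge> 1\<close> assms by (intro mult_strict_mono') auto
    ultimately show False by (simp add: norm_mult)
  qed
  then have out: "\<not> norm a < 1" if "a \<in># proots [:1, - cnj \<alpha>:]" for a using that by fastforce
  show ?thesis
  proof (rule ccontr)
    assume "disc_root_count [:1, - cnj \<alpha>:] \<noteq> 0"
    then have "filter_mset (\<lambda>a. norm a < 1) (proots [:1, - cnj \<alpha>:]) \<noteq> {#}" unfolding disc_root_count_def by (metis size_empty)
    then obtain a where "a \<in># filter_mset (\<lambda>a. norm a < 1) (proots [:1, - cnj \<alpha>:])" by (rule multiset_nonemptyE)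
    then have "a \<in># proots [:1, - cnj \<alpha>:]" "norm a < 1" unfolding set_mset_filter by blast+
    then show False using out by blast
  qed
qed

text \<open>After a constant unitary, the first row of K vanishes at \<open>\<alpha>\<close>; multiply it by the
  inverse of a Blaschke factor.\<close>

lemma reflect_disc_zero:
  fixes K :: "complex poly mat"
  assumes K: "K \<in> carrier_mat n n" and \<alpha>: "poly (det K) \<alpha> = 0"
  shows "\<exists>K' c. K' \<in> carrier_mat n n \<and> c \<noteq> 0 \<and>
    det K' * [:- \<alpha>, 1:] = Polynomial.smult c ([:1, - cnj \<alpha>:] * det K) \<and>
    (\<forall>z. norm z = 1 \<longrightarrow> (\<forall>j<n. \<forall>k<n. col (evm z K') j \<bullet>c col (evm z K') k = col (evm z K) j \<bullet>c col (evm z K) k))"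
proof -
  have "det (transpose_mat (evm \<alpha> K)) = 0"
    using K \<alpha> by (subst Determinant.det_transpose[of _ n]) (auto simp: det_evm)
  \<comment> \<open>A vector in the left kernel of K(\<alpha>).\<close>
  then obtain u where u: "u \<in> carrier_vec n" "u \<noteq> 0\<^sub>v n" "transpose_mat (evm \<alpha> K) *\<^sub>v u = 0\<^sub>v n"
    using det_0_iff_vec_prod_zero[of "transpose_mat (evm \<alpha> K)" n] K by auto
  have n0: "n > 0"
  proof (rule ccontr)
    assume "\<not> n > 0"
    then have "u = 0\<^sub>v n" using u(1) by (intro eq_vecI) auto
    then show False using u(2) by simp
  qed
  define s where "s = (\<Sum>i<n. (norm (u $ i))\<^sup>2)"
  have us: "u \<bullet>c u = of_real s" unfolding s_def by (rule cscalar_prod_self[OF u(1)])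
  have "u \<bullet>c u \<noteq> 0" using cscalar_prod_self_eq_0[OF u(1)] u(2) by blast
  then have "s \<noteq> 0" using us by auto
  moreover have "s \<ge> 0" unfolding s_def by (simp add: sum_nonneg)
  ultimately have s: "s > 0" by simp
  \<comment> \<open>If a unitary has first column y, the conjugated and normalised u, then its
    adjoint has a first row proportional to u, and this row annihilates K(\<alpha>).\<close>
  define y where "y = vec n (\<lambda>i. cnj (u $ i) / of_real (sqrt s))"
  define x' where "x' = vec n (\<lambda>i. if i = 0 then 1 else 0 :: complex)"
  have x': "x' \<in> carrier_vec n" and y: "y \<in> carrier_vec n" by (simp_all add: x'_def y_def)
  have "y \<bullet>c y = (\<Sum>i<n. (norm (u $ i))\<^sup>2 / s)"
    unfolding cscalar_prod_self[OF y] using s by (simp add: y_def norm_divide power_divide)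
  also have "\<dots> = 1" using s by (simp add: sum_divide_distrib[symmetric] s_def[symmetric] flip: of_real_power)
  finally have yy: "y \<bullet>c y = 1" .
  have "x' \<bullet>c x' = 1"
    unfolding cscalar_prod_self[OF x'] using n0 by (simp add: x'_def if_distrib[where f = norm] if_distrib[where f = "\<lambda>x. x ^ 2"] sum.delta cong: if_cong)
  then have "\<exists>U. U \<in> carrier_mat n n \<and> unitary_mat U \<and> (\<forall>i<1::nat. U *\<^sub>v x' = y)"
    by (intro unitary_extension[where x = "\<lambda>_. x'" and y = "\<lambda>_. y"]) (simp_all add: x' y yy)
  then obtain U where U: "U \<in> carrier_mat n n" "unitary_mat U" "U *\<^sub>v x' = y" by auto
  have U0: "U $$ (i, 0) = y $ i" if i: "i < n" for i
  proof -
    have "y $ i = (\<Sum>j<n. U $$ (i, j) * (if j = 0 then 1 else 0))"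
      unfolding U(3)[symmetric] using i U(1) by (simp add: x'_def scalar_prod_def lessThan_atLeast0)
    also have "\<dots> = (\<Sum>j<n. if j = 0 then U $$ (i, j) else 0)" by (intro sum.cong) auto
    also have "\<dots> = U $$ (i, 0)" using n0 by (simp add: sum.delta)
    finally show ?thesis by simp
  qed
  define V where "V = mat_adjoint U"
  have V: "V \<in> carrier_mat n n" using U by (simp add: V_def)
  have Vu: "unitary_mat V" using U by (intro unitary_matI[OF V]) (simp add: V_def unitary_matD)
  have "det V * det (mat_adjoint V) = 1"
    using det_mult[OF V, of "mat_adjoint V"] V unitary_matD(1)[OF Vu V] by simp
  then have dV: "det V \<noteq> 0" by auto
  define V' where "V' = map_mat (\<lambda>c. [:c:]) V"
  have V': "V' \<in> carrier_mat n n" using V by (simp add: V'_def)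
  define K1 where "K1 = V' * K"
  have K1: "K1 \<in> carrier_mat n n" unfolding K1_def using V' K by simp
  have eK1: "evm z K1 = V * evm z K" for z
    unfolding K1_def using evm_mult[OF V' K] by (simp add: V'_def evm_const)
  have "[:- \<alpha>, 1:] dvd K1 $$ (0, j)" if j: "j < n" for j
  proof -
    have "poly (K1 $$ (0, j)) \<alpha> = evm \<alpha> K1 $$ (0, j)" using K1 j n0 by simp
    also have "\<dots> = (\<Sum>l<n. V $$ (0, l) * poly (K $$ (l, j)) \<alpha>)"
      unfolding eK1 using V K j n0 by (simp add: scalar_prod_def lessThan_atLeast0)
    also have "\<dots> = (\<Sum>l<n. u $ l * poly (K $$ (l, j)) \<alpha>) / of_real (sqrt s)"
      unfolding sum_divide_distrib using U n0 by (intro sum.cong) (auto simp: V_def U0 y_def)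
    also have "(\<Sum>l<n. u $ l * poly (K $$ (l, j)) \<alpha>) = (transpose_mat (evm \<alpha> K) *\<^sub>v u) $ j"
      using K j u(1) by (simp add: scalar_prod_def lessThan_atLeast0 mult.commute)
    finally show ?thesis using u(3) j by (simp add: poly_eq_0_iff_dvd)
  qed
  then have "\<forall>j. \<exists>r. j < n \<longrightarrow> K1 $$ (0, j) = [:- \<alpha>, 1:] * r" by (metis dvdE)
  then obtain r where r: "\<And>j. j < n \<Longrightarrow> K1 $$ (0, j) = [:- \<alpha>, 1:] * r j" by metis
  define M where "M = mat n n (\<lambda>(i, j). if i = 0 then r j else K1 $$ (i, j))"
  have M: "M \<in> carrier_mat n n" by (simp add: M_def)
  have K1M: "K1 = multrow 0 [:- \<alpha>, 1:] M"
    by (rule eq_matI) (use K1 r in \<open>auto simp: M_def\<close>)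
  \<comment> \<open>Exchanging z - \<alpha> for 1 - cnj \<alpha> z moves the zero out of the disc.
    Both have the same modulus on the circle by \<open>circle_factor\<close>, so the Gram matrix of
    the columns is unchanged there.\<close>
  define K' where "K' = multrow 0 [:1, - cnj \<alpha>:] M"
  have K': "K' \<in> carrier_mat n n" by (simp add: K'_def M)
  have e1: "det K1 = [:- \<alpha>, 1:] * det M" unfolding K1M by (rule det_multrow[OF n0 M])
  have e2: "det K' = [:1, - cnj \<alpha>:] * det M" unfolding K'_def by (rule det_multrow[OF n0 M])
  have e3: "det K1 = [:det V:] * det K"
  proof (rule iffD1[OF poly_eq_poly_eq_iff], rule ext)
    fix z
    show "poly (det K1) z = poly ([:det V:] * det K) z"
      using det_mult[OF V, of "evm z K"] K by (simp add: det_evm[symmetric] eK1)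
  qed
  have const_mult: "[:c:] * p = Polynomial.smult c p" for c :: complex and p by simp
  have "det K' * [:- \<alpha>, 1:] = [:1, - cnj \<alpha>:] * ([:- \<alpha>, 1:] * det M)"
    unfolding e2 by (simp only: mult_ac)
  also have "\<dots> = [:det V:] * ([:1, - cnj \<alpha>:] * det K)"
    unfolding e1[symmetric] e3 by (simp only: mult_ac)
  finally have "det K' * [:- \<alpha>, 1:] = Polynomial.smult (det V) ([:1, - cnj \<alpha>:] * det K)"
    unfolding const_mult .
  moreover have "col (evm z K') j \<bullet>c col (evm z K') k = col (evm z K) j \<bullet>c col (evm z K) k"
    if z: "norm z = 1" and jk: "j < n" "k < n" for z j k
  proof -
    have c: "col (V * evm z K) j = V *\<^sub>v col (evm z K) j" if "j < n" for j
      using V K that by (intro col_mult2) auto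
    have "col (evm z K') j \<bullet>c col (evm z K') k = (\<Sum>i<n. evm z K' $$ (i, j) * cnj (evm z K' $$ (i, k)))"
      using K' jk by (simp add: cscalar_prod_sum[of _ n])
    also have "\<dots> = (\<Sum>i<n. evm z K1 $$ (i, j) * cnj (evm z K1 $$ (i, k)))"
    proof (rule sum.cong[OF refl])
      fix i assume i: "i \<in> {..<n}"
      show "evm z K' $$ (i, j) * cnj (evm z K' $$ (i, k)) = evm z K1 $$ (i, j) * cnj (evm z K1 $$ (i, k))"
      proof (cases "i = 0")
        case True
        have "evm z K' $$ (i, j) * cnj (evm z K' $$ (i, k)) =
            ((1 - cnj \<alpha> * z) * cnj (1 - cnj \<alpha> * z)) * (poly (r j) z * cnj (poly (r k) z))"
          using K' jk i True by (simp add: K'_def M_def algebra_simps)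
        also have "\<dots> = evm z K1 $$ (i, j) * cnj (evm z K1 $$ (i, k))"
        proof -
          have "poly (K1 $$ (0, j)) z = (z - \<alpha>) * poly (r j) z" "poly (K1 $$ (0, k)) z = (z - \<alpha>) * poly (r k) z"
            by (simp_all add: r[OF jk(1)] r[OF jk(2)] algebra_simps)
          then show ?thesis unfolding circle_factor[OF z] using K1 jk i True by (simp add: mult_ac)
        qed
        finally show ?thesis .
      next
        case False
        then show ?thesis using K1 K' jk i unfolding K1M K'_def by (simp add: M_def)
      qed
    qed
    also have "\<dots> = col (evm z K1) j \<bullet>c col (evm z K1) k"
      using K1 jk by (simp add: cscalar_prod_sum[of _ n])
    also have "\<dots> = col (evm z K) j \<bullet>c col (evm z K) k"
      unfolding eK1 c[OF jk(1)] c[OF jk(2)] using K jk by (intro unitary_preserves[OF Vu V] carrier_vecI) simp_all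
    finally show ?thesis .
  qed
  ultimately show ?thesis using K' dV by blast
qed

text \<open>Each use of \<open>reflect_disc_zero\<close> takes one zero of the determinant out of
  the disc and adds none inside, so finitely many uses suffice.\<close>

lemma outer_factor:
  fixes K :: "complex poly mat"
  assumes "K \<in> carrier_mat n n" "det K \<noteq> 0"
  shows "\<exists>K'. K' \<in> carrier_mat n n \<and> (\<forall>z. norm z < 1 \<longrightarrow> poly (det K') z \<noteq> 0) \<and>
    (\<forall>z. norm z = 1 \<longrightarrow> (\<forall>j<n. \<forall>k<n. col (evm z K') j \<bullet>c col (evm z K') k = col (evm z K) j \<bullet>c col (evm z K) k))"
  using assms
proof (induction "disc_root_count (det K)" arbitrary: K)
  case 0
  then show ?case using disc_root_count_0[of "det K"] by (intro exI[of _ K]) auto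
next
  case (Suc N)
  have "filter_mset (\<lambda>a. norm a < 1) (proots (det K)) \<noteq> {#}" using Suc.hyps(2) unfolding disc_root_count_def by (metis nat.distinct(1) size_empty)
  then obtain \<alpha> where "\<alpha> \<in># filter_mset (\<lambda>a. norm a < 1) (proots (det K))" by (rule multiset_nonemptyE)
  then have \<alpha>: "\<alpha> \<in># proots (det K)" "norm \<alpha> < 1" by simp_all
  then have "poly (det K) \<alpha> = 0" using Suc.prems by simp
  from reflect_disc_zero[OF Suc.prems(1) this] obtain K' c where K': "K' \<in> carrier_mat n n" "c \<noteq> 0"
    "det K' * [:- \<alpha>, 1:] = Polynomial.smult c ([:1, - cnj \<alpha>:] * det K)"
    "\<And>z j k. norm z = 1 \<Longrightarrow> j < n \<Longrightarrow> k < n \<Longrightarrow> col (evm z K') j \<bullet>c col (evm z K') k = col (evm z K) j \<bullet>c col (evm z K) k"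
    by blast
  have nz: "[:1, - cnj \<alpha>:] \<noteq> 0" "[:- \<alpha>, 1:] \<noteq> 0" by simp_all
  have "Polynomial.smult c ([:1, - cnj \<alpha>:] * det K) \<noteq> 0" using K'(2) nz Suc.prems(2) by (simp del: mult_pCons_left)
  then have d': "det K' \<noteq> 0" using K'(3) by (metis mult_zero_left)
  have "disc_root_count (det K' * [:- \<alpha>, 1:]) = disc_root_count ([:1, - cnj \<alpha>:] * det K)"
    unfolding K'(3) by (rule disc_root_count_smult[OF K'(2)])
  then have "disc_root_count (det K') + 1 = disc_root_count (det K)"
    unfolding disc_root_count_mult[OF d' nz(2)] disc_root_count_mult[OF nz(1) Suc.prems(2)]
      disc_root_count_linear[OF \<alpha>(2)] disc_root_count_reflected[OF \<alpha>(2)] by simp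
  then have "N = disc_root_count (det K')" using Suc.hyps(2) by simp
  from Suc.hyps(1)[OF this K'(1) d'] K'(4) show ?case by metis
qed

lemma spectral_factorization:
  assumes "\<And>j k. j < n \<Longrightarrow> k < n \<Longrightarrow> trig (S j k)" "finite B"
    "\<And>z. norm z = 1 \<Longrightarrow> z \<notin> B \<Longrightarrow> posdef n (\<lambda>j k. S j k z)"
  obtains d K where "d \<noteq> 0" "K \<in> carrier_mat n n" "\<And>z. norm z < 1 \<Longrightarrow> poly (det K) z \<noteq> 0"
    "\<And>z j k. norm z = 1 \<Longrightarrow> z \<notin> B \<Longrightarrow> j < n \<Longrightarrow> k < n \<Longrightarrow>
      poly d z * cnj (poly d z) * S j k z = (\<Sum>l<n. poly (K $$ (l, j)) z * cnj (poly (K $$ (l, k)) z))"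
proof -
  obtain d L where d: "d \<noteq> 0" and L: "\<And>z j k. norm z = 1 \<Longrightarrow> z \<notin> B \<Longrightarrow> j < n \<Longrightarrow> k < n \<Longrightarrow>
    poly d z * cnj (poly d z) * S j k z = (\<Sum>l<n. poly (L j l) z * cnj (poly (L k l) z))"
    using trig_Cholesky[OF assms] by blast
  \<comment> \<open>Transposed, since the reflections multiply from the left and preserve the Gram
    matrix of the columns.\<close>
  define K0 where "K0 = mat n n (\<lambda>(l, j). L j l)"
  have K0: "K0 \<in> carrier_mat n n" by (simp add: K0_def)
  have "det K0 \<noteq> 0"
  proof
    assume "det K0 = 0"
    have "infinite (unit_circle - (B \<union> {z. poly d z = 0}))"
      using infinite_unit_circle assms(2) poly_roots_finite[OF d] by simp
    then obtain z where "z \<in> unit_circle - (B \<union> {z. poly d z = 0})" by (metis finite.emptyI ex_in_conv)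
    then have z: "norm z = 1" "z \<notin> B" "poly d z \<noteq> 0" by auto
    have "det (evm z K0) = 0" using \<open>det K0 = 0\<close> by (simp add: det_evm)
    then obtain x where x: "x \<in> carrier_vec n" "x \<noteq> 0\<^sub>v n" "evm z K0 *\<^sub>v x = 0\<^sub>v n"
      using det_0_iff_vec_prod_zero[of "evm z K0" n] K0 by auto
    have x0: "(\<Sum>j<n. poly (L j l) z * x $ j) = 0" if "l < n" for l
      using arg_cong[OF x(3), of "\<lambda>v. v $ l"] that K0 x(1)
      by (simp add: scalar_prod_def lessThan_atLeast0 K0_def)
    obtain i where i: "i < n" "x $ i \<noteq> 0"
    proof (rule ccontr)
      assume "\<not> thesis"
      then have "x = 0\<^sub>v n" using that x(1) by (intro eq_vecI) auto
      then show False using x(2) by simp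
    qed
    \<comment> \<open>The null vector is conjugated because \<open>sesq\<close> conjugates its left
      argument; the form then vanishes at y, against positivity.\<close>
    define y where "y = (\<lambda>j. cnj (x $ j))"
    have "poly d z * cnj (poly d z) * sesq n (\<lambda>j k. S j k z) y =
        (\<Sum>j<n. \<Sum>k<n. x $ j * (poly d z * cnj (poly d z) * S j k z) * y k)"
      unfolding sesq_def by (simp add: sum_distrib_left y_def mult_ac)
    also have "\<dots> = (\<Sum>j<n. \<Sum>k<n. \<Sum>l<n. (poly (L j l) z * x $ j) * (cnj (poly (L k l) z) * y k))"
      using L[OF z(1,2)] by (intro sum.cong refl) (simp add: sum_distrib_left sum_distrib_right mult_ac)
    also have "\<dots> = (\<Sum>j<n. \<Sum>l<n. \<Sum>k<n. (poly (L j l) z * x $ j) * (cnj (poly (L k l) z) * y k))"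
      by (intro sum.cong refl sum.swap)
    also have "\<dots> = (\<Sum>l<n. \<Sum>j<n. \<Sum>k<n. (poly (L j l) z * x $ j) * (cnj (poly (L k l) z) * y k))"
      by (rule sum.swap)
    also have "\<dots> = (\<Sum>l<n. (\<Sum>j<n. poly (L j l) z * x $ j) * (\<Sum>k<n. cnj (poly (L k l) z) * y k))"
      by (simp add: sum_product)
    also have "\<dots> = 0" using x0 by simp
    finally have "sesq n (\<lambda>j k. S j k z) y = 0" using z(3) by simp
    moreover have "Re (sesq n (\<lambda>j k. S j k z) y) > 0"
      using i by (intro posdef_pos[OF assms(3)[OF z(1,2)], of i]) (auto simp: y_def)
    ultimately show False by simp
  qed
  from outer_factor[OF K0 this] obtain K where K: "K \<in> carrier_mat n n" "\<And>z. norm z < 1 \<Longrightarrow> poly (det K) z \<noteq> 0"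
    "\<And>z j k. norm z = 1 \<Longrightarrow> j < n \<Longrightarrow> k < n \<Longrightarrow> col (evm z K) j \<bullet>c col (evm z K) k = col (evm z K0) j \<bullet>c col (evm z K0) k"
    by blast
  show ?thesis
  proof (rule that[OF d K(1,2)])
    fix z j k assume z: "norm z = 1" "z \<notin> B" and jk: "j < n" "k < n"
    have "col (evm z K) j \<bullet>c col (evm z K) k = (\<Sum>l<n. poly (K $$ (l, j)) z * cnj (poly (K $$ (l, k)) z))"
      using K(1) jk by (simp add: cscalar_prod_sum[of _ n])
    moreover have "col (evm z K0) j \<bullet>c col (evm z K0) k = (\<Sum>l<n. poly (L j l) z * cnj (poly (L k l) z))"
      using jk by (simp add: cscalar_prod_sum[of _ n] K0_def)
    ultimately show "poly d z * cnj (poly d z) * S j k z = (\<Sum>l<n. poly (K $$ (l, j)) z * cnj (poly (K $$ (l, k)) z))"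
      using L[OF z jk] K(3)[OF z(1) jk] by simp
  qed
qed

section \<open>Schur-Cohn forms and companion matrices\<close>

text \<open>Schur-Cohn matrix: if p has degree n and simple unimodular roots a, then
  schur_cohn n c is the sum over a of the rank one matrices built from the coefficients of p / (x - a).\<close>

fun schur_cohn :: "nat \<Rightarrow> (nat \<Rightarrow> complex) \<Rightarrow> nat \<Rightarrow> nat \<Rightarrow> complex" where
  "schur_cohn n c 0 k = (of_nat n - of_nat k) * c 0 * cnj (c k)"
| "schur_cohn n c (Suc j) 0 = (of_nat n - of_nat (Suc j)) * c (Suc j) * cnj (c 0)"
| "schur_cohn n c (Suc j) (Suc k) = schur_cohn n c j k +
    (of_nat n - of_nat (Suc j) - of_nat (Suc k)) * c (Suc j) * cnj (c (Suc k))"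

lemma trig_schur_cohn:
  assumes "\<And>j. trig (\<lambda>z. c z j)"
  shows "trig (\<lambda>z. schur_cohn n (c z) j k)"
proof (induction j arbitrary: k)
  case 0
  show ?case by (auto intro!: trig_mult trig_cnj assms)
next
  case (Suc j)
  show ?case by (cases k) (auto intro!: trig_mult trig_add trig_cnj assms Suc)
qed

text \<open>Put h_a = w g_a, so that h_a = p + a g_a. As |a| = 1, the coefficient products of h_a
  and of g_a differ only by terms in p and a g_a, and the sum of the a g_a is known because the g_a
  sum to p'. Since h_a is a shift of g_a, this is the recursion of \<open>schur_cohn\<close> along
  diagonals.\<close>

lemma schur_cohn_eq:
  fixes p :: "complex poly"
  assumes A: "finite A" "card A = n" and g: "\<And>a. a \<in> A \<Longrightarrow> p = [:- a, 1:] * g a"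
    and u: "\<And>a. a \<in> A \<Longrightarrow> norm a = 1" and gsum: "(\<Sum>a\<in>A. g a) = pderiv p"
  shows "schur_cohn n (coeff p) j k = (\<Sum>a\<in>A. coeff (g a) j * cnj (coeff (g a) k))"
proof -
  define G where "G = (\<lambda>j k. \<Sum>a\<in>A. coeff (g a) j * cnj (coeff (g a) k))"
  define h where "h = (\<lambda>a. pCons 0 (g a))"
  have ha: "coeff (h a) j = coeff p j + a * coeff (g a) j" if "a \<in> A" for a j
    using arg_cong[OF g[OF that], of "\<lambda>q. coeff q j"] by (simp add: h_def)
  have s1: "(\<Sum>a\<in>A. a * coeff (g a) j) = (of_nat j - of_nat n) * coeff p j" for j
  proof -
    have "(\<Sum>a\<in>A. coeff (h a) j) = coeff (pCons 0 (pderiv p)) j"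
      unfolding gsum[symmetric] by (cases j) (simp_all add: h_def coeff_sum)
    also have "\<dots> = of_nat j * coeff p j" by (cases j) (simp_all add: coeff_pderiv)
    finally have "(\<Sum>a\<in>A. coeff (h a) j) = of_nat j * coeff p j" .
    moreover have "(\<Sum>a\<in>A. coeff (h a) j) = of_nat n * coeff p j + (\<Sum>a\<in>A. a * coeff (g a) j)"
      using ha A by (simp add: sum.distrib)
    ultimately show ?thesis by (simp add: algebra_simps)
  qed
  have s2: "(\<Sum>a\<in>A. cnj a * cnj (coeff (g a) j)) = (of_nat j - of_nat n) * cnj (coeff p j)" for j
    using arg_cong[OF s1[of j], of cnj] by simp
  have rel: "G j k = (\<Sum>a\<in>A. coeff (h a) j * cnj (coeff (h a) k)) + (of_nat n - of_nat j - of_nat k) * coeff p j * cnj (coeff p k)" for j k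
  proof -
    have "(\<Sum>a\<in>A. coeff (h a) j * cnj (coeff (h a) k)) =
        (\<Sum>a\<in>A. coeff p j * cnj (coeff p k) + coeff p j * (cnj a * cnj (coeff (g a) k))
          + cnj (coeff p k) * (a * coeff (g a) j) + coeff (g a) j * cnj (coeff (g a) k))"
    proof (rule sum.cong[OF refl])
      fix a assume a: "a \<in> A"
      have "a * cnj a = 1" using u[OF a] by (simp add: complex_norm_square[symmetric])
      then have "a * coeff (g a) j * (cnj a * cnj (coeff (g a) k)) = coeff (g a) j * cnj (coeff (g a) k)"
        by (metis (no_types, lifting) mult.assoc mult.commute mult_1)
      then show "coeff (h a) j * cnj (coeff (h a) k) =
        coeff p j * cnj (coeff p k) + coeff p j * (cnj a * cnj (coeff (g a) k))
          + cnj (coeff p k) * (a * coeff (g a) j) + coeff (g a) j * cnj (coeff (g a) k)"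
        unfolding ha[OF a] by (simp add: algebra_simps)
    qed
    also have "\<dots> = of_nat n * (coeff p j * cnj (coeff p k)) + coeff p j * ((of_nat k - of_nat n) * cnj (coeff p k))
          + cnj (coeff p k) * ((of_nat j - of_nat n) * coeff p j) + G j k"
      using A by (simp add: sum.distrib sum_distrib_left[symmetric] s1 s2 G_def)
    finally show ?thesis by (simp add: algebra_simps)
  qed
  have "schur_cohn n (coeff p) j k = G j k"
  proof (induction j arbitrary: k)
    case 0
    show ?case unfolding rel[of 0 k] by (simp add: h_def)
  next
    case (Suc j)
    show ?case
    proof (cases k)
      case 0
      then show ?thesis unfolding rel[of "Suc j" k] by (simp add: h_def)
    next
      case (Suc k')
      then show ?thesis unfolding rel[of "Suc j" k] using Suc.IH[of k'] by (simp add: h_def G_def)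
    qed
  qed
  then show ?thesis by (simp add: G_def)
qed

locale unimodular_roots =
  fixes p :: "complex poly" and n :: nat
  assumes deg: "degree p = n" and p0: "p \<noteq> 0" and sq: "rsquarefree p"
    and uni: "\<And>a. poly p a = 0 \<Longrightarrow> norm a = 1"
begin

definition "A = {a. poly p a = 0}"
definition "cof a = p div [:- a, 1:]"

lemma finite_A: "finite A"
  unfolding A_def by (rule poly_roots_finite[OF p0])

lemma p_prod: "p = Polynomial.smult (lead_coeff p) (\<Prod>a\<in>A. [:- a, 1:])"
  using complex_poly_decompose_rsquarefree[OF sq] by (simp add: A_def)

lemma card_A: "card A = n"
proof -
  have "degree p = degree (\<Prod>a\<in>A. [:- a, 1:])" by (subst p_prod) (use p0 in simp)
  also have "\<dots> = (\<Sum>a\<in>A. degree [:- a, 1:])" by (rule degree_prod_eq_sum_degree) simp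
  finally show ?thesis using deg by simp
qed

lemma cof: "a \<in> A \<Longrightarrow> p = [:- a, 1:] * cof a"
  unfolding cof_def A_def by (simp add: poly_eq_0_iff_dvd del: mult_pCons_left)

lemma cof_prod: "a \<in> A \<Longrightarrow> cof a = Polynomial.smult (lead_coeff p) (\<Prod>b\<in>A - {a}. [:- b, 1:])"
proof -
  assume a: "a \<in> A"
  have "[:- a, 1:] * cof a = [:- a, 1:] * Polynomial.smult (lead_coeff p) (\<Prod>b\<in>A - {a}. [:- b, 1:])"
    unfolding cof[OF a, symmetric] mult_smult_right
    by (subst prod.remove[OF finite_A a, symmetric]) (rule p_prod)
  then show ?thesis by (subst (asm) mult_cancel_left) simp
qed

lemma cof_sum: "(\<Sum>a\<in>A. cof a) = pderiv p"
proof -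
  have "pderiv p = Polynomial.smult (lead_coeff p) (\<Sum>a\<in>A. \<Prod>b\<in>A - {a}. [:- b, 1:])"
    by (subst p_prod) (simp add: pderiv_smult pderiv_prod pderiv_pCons)
  then show ?thesis using cof_prod by (simp add: smult_sum2)
qed

lemma degree_cof: "a \<in> A \<Longrightarrow> Suc (degree (cof a)) = n"
proof -
  assume a: "a \<in> A"
  have "cof a \<noteq> 0" using cof[OF a] p0 by auto
  then have "degree ([:- a, 1:] * cof a) = Suc (degree (cof a))" by (subst degree_mult_eq) auto
  then show ?thesis using cof[OF a] deg by simp
qed

lemma cof_eval:
  assumes "a \<in> A" "b \<in> A"
  shows "poly (cof a) b = 0 \<longleftrightarrow> a \<noteq> b"
proof
  show "a \<noteq> b" if "poly (cof a) b = 0"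
  proof
    assume "a = b"
    then have "poly (\<Prod>b\<in>A - {a}. [:- b, 1:]) a = 0" using that cof_prod[OF assms(1)] p0 by simp
    then show False using finite_A by (auto simp: poly_prod)
  qed
  have "poly p b = (b - a) * poly (cof a) b" by (subst cof[OF assms(1)]) (simp add: algebra_simps)
  then show "poly (cof a) b = 0" if "a \<noteq> b" using that assms(2) by (simp add: A_def)
qed

lemma schur_cohn_sum: "schur_cohn n (coeff p) j k = (\<Sum>a\<in>A. coeff (cof a) j * cnj (coeff (cof a) k))"
  by (rule schur_cohn_eq[OF finite_A card_A cof _ cof_sum]) (use uni in \<open>auto simp: A_def\<close>)

text \<open>The cofactors p / (w - a) are, up to scaling, the Lagrange basis of the polynomials of
  degree below n. A functional that vanishes on them vanishes on every monomial.\<close>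

lemma cof_spans:
  assumes "\<And>a. a \<in> A \<Longrightarrow> (\<Sum>j<n. y j * coeff (cof a) j) = 0" "i < n"
  shows "y i = 0"
proof -
  define q where "q = monom (1::complex) i"
  define r where "r = (\<Sum>a\<in>A. Polynomial.smult (poly q a / poly (cof a) a) (cof a))"
  have "q = r"
  proof (rule ccontr)
    assume "q \<noteq> r"
    then have "q - r \<noteq> 0" by simp
    have "poly (q - r) b = 0" if b: "b \<in> A" for b
    proof -
      have "poly r b = (\<Sum>a\<in>A. poly q a / poly (cof a) a * poly (cof a) b)" by (simp add: r_def poly_sum)
      also have "\<dots> = (\<Sum>a\<in>{b}. poly q a / poly (cof a) a * poly (cof a) b)"
        using finite_A b cof_eval[OF _ b] by (intro sum.mono_neutral_right) auto
      also have "\<dots> = poly q b" using cof_eval[OF b b] by simp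
      finally show ?thesis by simp
    qed
    then have "n \<le> card {b. poly (q - r) b = 0}"
      unfolding card_A[symmetric] using poly_roots_finite[OF \<open>q - r \<noteq> 0\<close>] by (intro card_mono) auto
    also have "\<dots> \<le> degree (q - r)" by (rule card_poly_roots_bound[OF \<open>q - r \<noteq> 0\<close>])
    also have "\<dots> \<le> n - 1"
    proof (rule degree_diff_le)
      show "degree q \<le> n - 1" using assms(2) by (simp add: q_def degree_monom_eq)
      show "degree r \<le> n - 1" unfolding r_def
      proof (rule degree_sum_le[OF finite_A])
        fix a assume "a \<in> A"
        then show "degree (Polynomial.smult (poly q a / poly (cof a) a) (cof a)) \<le> n - 1"
          using degree_cof[of a] degree_smult_le[of "poly q a / poly (cof a) a" "cof a"] by linarith
      qed
    qed
    finally show False using assms(2) by simp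
  qed
  have "y i = (\<Sum>j<n. y j * coeff q j)"
    using assms(2) by (simp add: q_def if_distrib[where f = "\<lambda>x. y _ * x"] sum.delta' cong: if_cong)
  also have "\<dots> = (\<Sum>j<n. y j * coeff r j)" using \<open>q = r\<close> by simp
  also have "\<dots> = (\<Sum>j<n. \<Sum>a\<in>A. poly q a / poly (cof a) a * (y j * coeff (cof a) j))"
    unfolding r_def coeff_sum by (simp add: sum_distrib_left mult_ac)
  also have "\<dots> = (\<Sum>a\<in>A. poly q a / poly (cof a) a * (\<Sum>j<n. y j * coeff (cof a) j))"
    by (subst sum.swap) (simp only: sum_distrib_left)
  also have "\<dots> = 0" using assms(1) by simp
  finally show ?thesis .
qed

text \<open>The form is a sum of squared moduli of functionals, one for each root, and by
  \<open>cof_spans\<close> these have no common zero other than 0.\<close>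

lemma posdef_schur_cohn: "posdef n (schur_cohn n (coeff p))"
  unfolding posdef_def
proof (intro conjI allI impI)
  fix j k
  show "schur_cohn n (coeff p) j k = cnj (schur_cohn n (coeff p) k j)"
    unfolding schur_cohn_sum by (simp add: mult.commute)
next
  fix x :: "nat \<Rightarrow> complex" assume x: "\<exists>i<n. x i \<noteq> 0"
  define y where "y = (\<lambda>a. \<Sum>j<n. cnj (x j) * coeff (cof a) j)"
  have "sesq n (schur_cohn n (coeff p)) x =
      (\<Sum>j<n. \<Sum>k<n. \<Sum>a\<in>A. (cnj (x j) * coeff (cof a) j) * cnj (cnj (x k) * coeff (cof a) k))"
    unfolding sesq_def schur_cohn_sum by (simp add: sum_distrib_left sum_distrib_right mult_ac)
  also have "\<dots> = (\<Sum>j<n. \<Sum>a\<in>A. \<Sum>k<n. (cnj (x j) * coeff (cof a) j) * cnj (cnj (x k) * coeff (cof a) k))"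
    by (intro sum.cong refl sum.swap)
  also have "\<dots> = (\<Sum>a\<in>A. \<Sum>j<n. \<Sum>k<n. (cnj (x j) * coeff (cof a) j) * cnj (cnj (x k) * coeff (cof a) k))"
    by (rule sum.swap)
  also have "\<dots> = (\<Sum>a\<in>A. y a * cnj (y a))" by (simp add: y_def sum_product)
  also have "\<dots> = of_real (\<Sum>a\<in>A. (norm (y a))\<^sup>2)" by (simp only: complex_norm_square[symmetric] of_real_sum)
  finally have eq: "Re (sesq n (schur_cohn n (coeff p)) x) = (\<Sum>a\<in>A. (norm (y a))\<^sup>2)" by simp
  have "\<exists>a\<in>A. y a \<noteq> 0"
  proof (rule ccontr)
    assume "\<not> (\<exists>a\<in>A. y a \<noteq> 0)"
    then have "cnj (x i) = 0" if "i < n" for i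
      using that by (intro cof_spans[of "\<lambda>j. cnj (x j)"]) (auto simp: y_def)
    then show False using x by auto
  qed
  then obtain a where "a \<in> A" "y a \<noteq> 0" by blast
  then show "Re (sesq n (schur_cohn n (coeff p)) x) > 0"
    unfolding eq using finite_A by (intro sum_pos2[of _ a]) auto
qed

end

text \<open>The matrix of multiplication by c_n w modulo c_0 + ... + c_n w^n in the monomial basis.
  The factor c_n avoids division, so polynomial coefficients give polynomial entries.\<close>

definition companion :: "nat \<Rightarrow> (nat \<Rightarrow> 'a::ring_1) \<Rightarrow> 'a mat" where
  "companion n c = mat n n (\<lambda>(j, k). (if j = Suc k then c n else 0) - (if Suc k = n then c j else 0))"

lemma companion_carrier [simp]: "companion n c \<in> carrier_mat n n"
  by (simp add: companion_def)

lemma companion_mult: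
  fixes c :: "nat \<Rightarrow> complex"
  assumes "v \<in> carrier_vec n" "j < n"
  shows "(companion n c *\<^sub>v v) $ j = (case j of 0 \<Rightarrow> 0 | Suc i \<Rightarrow> c n * v $ i) - c j * v $ (n - 1)"
proof -
  have "(companion n c *\<^sub>v v) $ j = (\<Sum>k<n. (if j = Suc k then c n * v $ k else 0) - (if k = n - 1 then c j * v $ k else 0))"
    using assms by (simp add: companion_def scalar_prod_def lessThan_atLeast0) (intro sum.cong, auto simp: algebra_simps)
  also have "\<dots> = (\<Sum>k<n. if j = Suc k then c n * v $ k else 0) - c j * v $ (n - 1)"
    unfolding sum_subtractf using assms(2) by (simp add: sum.delta)
  also have "(\<Sum>k<n. if j = Suc k then c n * v $ k else 0) = (case j of 0 \<Rightarrow> 0 | Suc i \<Rightarrow> c n * v $ i)"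
    
  proof (cases j)
    case (Suc i)
    have "(\<Sum>k<n. if j = Suc k then c n * v $ k else 0) = (\<Sum>k<n. if k = i then c n * v $ k else 0)"
      by (intro sum.cong) (auto simp: Suc)
    then show ?thesis using Suc assms(2) by (simp add: sum.delta)
  qed simp
  finally show ?thesis .
qed

text \<open>Multiplication by w sends g to w g = p + a g, which is a g modulo p.\<close>

lemma companion_eigen:
  fixes p :: "complex poly"
  assumes deg: "degree p = n" and n: "n > 0" and g: "p = [:- a, 1:] * g"
  shows "companion n (coeff p) *\<^sub>v vec n (coeff g) = (lead_coeff p * a) \<cdot>\<^sub>v vec n (coeff g)"
proof (rule eq_vecI)
  fix j assume "j < dim_vec ((lead_coeff p * a) \<cdot>\<^sub>v vec n (coeff g))"
  then have j: "j < n" by simp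
  have p0: "p \<noteq> 0" using deg n by auto
  have "g \<noteq> 0" using p0 g by auto
  then have dg: "Suc (degree g) = n" using deg unfolding g by (subst (asm) degree_mult_eq) auto
  have cp: "coeff p i = coeff (pCons 0 g) i - a * coeff g i" for i
    using arg_cong[OF g, of "\<lambda>q. coeff q i"] by simp
  have gn: "coeff g (n - 1) = lead_coeff p"
  proof -
    have "coeff p n = coeff (pCons 0 g) n - a * coeff g n" by (rule cp)
    moreover have "coeff g n = 0" using dg by (intro coeff_eq_0) simp
    ultimately show ?thesis using n deg by (cases n) simp_all
  qed
  show "(companion n (coeff p) *\<^sub>v vec n (coeff g)) $ j = ((lead_coeff p * a) \<cdot>\<^sub>v vec n (coeff g)) $ j"
  proof (cases j)
    case 0
    then show ?thesis using n gn deg cp[of 0] by (subst companion_mult) (simp_all add: mult_ac)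
  next
    case (Suc i)
    have "coeff g i = coeff p (Suc i) + a * coeff g (Suc i)" using cp[of j] Suc by simp
    then show ?thesis using j n gn deg Suc by (subst companion_mult) (simp_all add: algebra_simps)
  qed
qed (simp add: companion_def)

lemma smult_one_mult_vec:
  fixes v :: "complex vec"
  assumes "v \<in> carrier_vec n"
  shows "(k \<cdot>\<^sub>m 1\<^sub>m n) *\<^sub>v v = k \<cdot>\<^sub>v v"
  using assms by (intro eq_vecI) simp_all

text \<open>Only kernels are compared. A root yields the eigenvector of
  \<open>companion_eigen\<close>; conversely, the equations of a kernel vector are Horner's scheme,
  run downwards from the last coordinate and ending in p(w) = 0.\<close>

lemma companion_det:
  fixes p :: "complex poly"
  assumes deg: "degree p = n" and n: "n > 0"
  shows "det (companion n (coeff p) - (w * lead_coeff p) \<cdot>\<^sub>m 1\<^sub>m n) = 0 \<longleftrightarrow> poly p w = 0"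
proof -
  let ?M = "companion n (coeff p) - (w * lead_coeff p) \<cdot>\<^sub>m 1\<^sub>m n"
  have p0: "lead_coeff p \<noteq> 0" using deg n by auto
  have M: "?M \<in> carrier_mat n n" by (intro minus_carrier_mat smult_carrier_mat one_carrier_mat)
  have Mv: "?M *\<^sub>v v = companion n (coeff p) *\<^sub>v v - (w * lead_coeff p) \<cdot>\<^sub>v v" if "v \<in> carrier_vec n" for v
    using that by (subst minus_mult_distrib_mat_vec[of _ n n]) (auto simp: smult_one_mult_vec)
  show ?thesis
  proof
    assume "poly p w = 0"
    then obtain g where g: "p = [:- w, 1:] * g" unfolding poly_eq_0_iff_dvd by (elim dvdE)
    have "g \<noteq> 0" using p0 g by auto
    then have dg: "degree g < n" using deg unfolding g by (subst (asm) degree_mult_eq) auto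
    have "vec n (coeff g) \<noteq> 0\<^sub>v n"
    proof
      assume "vec n (coeff g) = 0\<^sub>v n"
      then have "lead_coeff g = 0" using dg by (metis index_vec index_zero_vec(1))
      then show False using \<open>g \<noteq> 0\<close> by simp
    qed
    moreover have "?M *\<^sub>v vec n (coeff g) = 0\<^sub>v n"
      unfolding Mv[OF vec_carrier] companion_eigen[OF deg n g] by (intro eq_vecI) (auto simp: mult_ac)
    ultimately show "det ?M = 0" using det_0_iff_vec_prod_zero[OF M] vec_carrier by blast
  next
    assume "det ?M = 0"
    then obtain v where v: "v \<in> carrier_vec n" "v \<noteq> 0\<^sub>v n" "?M *\<^sub>v v = 0\<^sub>v n"
      using det_0_iff_vec_prod_zero[OF M] by blast
    \<comment> \<open>The last coordinate of v is \<open>lead_coeff p * s\<close>, and s determines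
      all the others, so it cannot be 0.\<close>
    define s where "s = v $ (n - 1) / lead_coeff p"
    have eq: "(case j of 0 \<Rightarrow> 0 | Suc i \<Rightarrow> lead_coeff p * v $ i) = coeff p j * v $ (n - 1) + w * lead_coeff p * v $ j" if j: "j < n" for j
    proof -
      have "(companion n (coeff p) *\<^sub>v v) $ j - (w * lead_coeff p) * v $ j = 0"
        using arg_cong[OF v(3)[unfolded Mv[OF v(1)]], of "\<lambda>x. x $ j"] j v(1) by simp
      then show ?thesis using companion_mult[OF v(1) j, of "coeff p"] deg by (cases j) (simp_all add: algebra_simps)
    qed
    have step: "v $ i = coeff p (Suc i) * s + w * v $ Suc i" if "Suc i < n" for i
      using eq[OF that] p0 by (simp add: s_def field_simps)
    have v0: "0 = coeff p 0 * s + w * v $ 0"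
      using eq[OF n] p0 by (simp add: s_def field_simps)
    have hor: "v $ (n - Suc i) = s * (\<Sum>k\<le>i. coeff p (n - i + k) * w ^ k)" if "i < n" for i
      using that
    proof (induction i)
      case 0
      then show ?case using p0 deg n by (simp add: s_def)
    next
      case (Suc i)
      then have "n - Suc i = Suc (n - Suc (Suc i))" by simp
      then have "v $ (n - Suc (Suc i)) = coeff p (n - Suc i) * s + w * v $ (n - Suc i)"
        using step[of "n - Suc (Suc i)"] Suc.prems by simp
      also have "\<dots> = s * (coeff p (n - Suc i) + (\<Sum>k\<le>i. coeff p (n - i + k) * w ^ Suc k))"
        using Suc by (simp add: sum_distrib_left algebra_simps)
      also have "\<dots> = s * (\<Sum>k\<le>Suc i. coeff p (n - Suc i + k) * w ^ k)"
        unfolding sum.atMost_Suc_shift using Suc.prems by (simp add: Suc_diff_le[symmetric])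
      finally show ?case .
    qed
    have "s \<noteq> 0"
    proof
      assume "s = 0"
      have "v $ j = 0" if "j < n" for j
        using hor[of "n - Suc j"] that \<open>s = 0\<close> by simp
      then have "v = 0\<^sub>v n" using v(1) by (intro eq_vecI) auto
      then show False using v(2) by simp
    qed
    have "v $ 0 = s * (\<Sum>k\<le>n - 1. coeff p (Suc k) * w ^ k)" using hor[of "n - 1"] n by simp
    then have "0 = s * (coeff p 0 + w * (\<Sum>k\<le>n - 1. coeff p (Suc k) * w ^ k))"
      using v0 by (simp add: algebra_simps)
    also have "coeff p 0 + w * (\<Sum>k\<le>n - 1. coeff p (Suc k) * w ^ k) = (\<Sum>k\<le>Suc (n - 1). coeff p k * w ^ k)"
      unfolding sum.atMost_Suc_shift by (simp add: sum_distrib_left mult_ac)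
    also have "\<dots> = poly p w" unfolding poly_altdef deg using n by simp
    finally show "poly p w = 0" using \<open>s \<noteq> 0\<close> by simp
  qed
qed

section \<open>Gram matrices and truncated products\<close>

definition sesq_on :: "'i set \<Rightarrow> ('i \<Rightarrow> 'i \<Rightarrow> complex) \<Rightarrow> ('i \<Rightarrow> complex) \<Rightarrow> complex" where
  "sesq_on I A x = (\<Sum>j\<in>I. \<Sum>k\<in>I. cnj (x j) * A j k * x k)"

lemma sesq_on_insert:
  assumes "finite I" "i \<notin> I"
  shows "sesq_on (insert i I) A x = cnj (x i) * A i i * x i + cnj (x i) * (\<Sum>k\<in>I. A i k * x k)
    + (\<Sum>j\<in>I. cnj (x j) * A j i) * x i + sesq_on I A x"
  unfolding sesq_on_def using assms
  by (simp add: sum.distrib sum_distrib_left sum_distrib_right mult.assoc)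

lemma sesq_on_cong: "(\<And>j. j \<in> I \<Longrightarrow> x j = y j) \<Longrightarrow> sesq_on I A x = sesq_on I A y"
  unfolding sesq_on_def by (intro sum.cong refl) auto

text \<open>Cholesky elimination for a semidefinite matrix. A vanishing pivot forces its whole row
  to vanish, so with x / 0 = 0 the same formulas cover that case.\<close>

lemma psd_Gram:
  assumes "finite I" "\<And>j k. j \<in> I \<Longrightarrow> k \<in> I \<Longrightarrow> A j k = cnj (A k j)" "\<And>x. Re (sesq_on I A x) \<ge> 0"
  shows "\<exists>Q. \<forall>j\<in>I. \<forall>k\<in>I. A j k = (\<Sum>l\<in>I. Q j l * cnj (Q k l))"
  using assms
proof (induction I arbitrary: A rule: finite_induct)
  case empty
  then show ?case by simp
next
  case (insert i I)
  have herm: "A j k = cnj (A k j)" if "j \<in> insert i I" "k \<in> insert i I" for j k using insert.prems(1) that by blast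
  have "A i i = cnj (A i i)" using herm by blast
  then obtain a where a: "A i i = of_real a" by (metis Reals_cnj_iff Reals_cases)
  have form: "sesq_on (insert i I) A x = of_real (a * (norm (x i))\<^sup>2) + cnj (x i) * (\<Sum>k\<in>I. A i k * x k)
    + cnj (cnj (x i) * (\<Sum>k\<in>I. A i k * x k)) + sesq_on I A x" for x
  proof -
    have "(\<Sum>j\<in>I. cnj (x j) * A j i) = cnj (\<Sum>k\<in>I. A i k * x k)"
      unfolding cnj_sum using herm[of _ i] by (intro sum.cong) (auto simp: mult.commute)
    moreover have "cnj (x i) * A i i * x i = of_real (a * (norm (x i))\<^sup>2)"
      unfolding a of_real_mult complex_norm_square by (simp add: mult_ac)
    ultimately show ?thesis unfolding sesq_on_insert[OF insert.hyps(1,2)] by (simp add: mult.commute)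
  qed
  have pos: "Re (sesq_on (insert i I) A x) \<ge> 0" for x by (rule insert.prems(2))
  have posI: "Re (sesq_on I A x) \<ge> 0" for x
  proof -
    have "sesq_on I A (x(i := 0)) = sesq_on I A x"
      using insert.hyps(2) by (intro sesq_on_cong) auto
    then show ?thesis using pos[of "x(i := 0)"] unfolding form by simp
  qed
  have "a \<ge> 0"
  proof -
    have "sesq_on I A ((\<lambda>_. 0)(i := 1)) = 0" using insert.hyps(2) unfolding sesq_on_def
      by (intro sum.neutral ballI) auto
    moreover have "(\<Sum>k\<in>I. A i k * ((\<lambda>_. 0)(i := 1)) k) = 0" using insert.hyps(2) by (intro sum.neutral ballI) auto
    ultimately show ?thesis using pos[of "(\<lambda>_. 0)(i := 1)"] unfolding form by simp
  qed
  have zero: "(\<Sum>k\<in>I. A i k * x k) = 0" if "a = 0" for x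
  proof (rule ccontr)
    define s where "s = (\<Sum>k\<in>I. A i k * x k)"
    assume "(\<Sum>k\<in>I. A i k * x k) \<noteq> 0"
    then have s: "(norm s)\<^sup>2 > 0" by (simp add: s_def)
    \<comment> \<open>Chosen so that the form takes the value -1 at y.\<close>
    define r where "r = (Re (sesq_on I A x) + 1) / (2 * (norm s)\<^sup>2)"
    define y where "y = x(i := - (of_real r * s))"
    have e: "(\<Sum>k\<in>I. A i k * y k) = s" "sesq_on I A y = sesq_on I A x"
      using insert.hyps(2) by (auto simp: y_def s_def intro!: sum.cong sesq_on_cong)
    have "Re (sesq_on (insert i I) A y) = 2 * Re (cnj (y i) * s) + Re (sesq_on I A x)"
      unfolding form e \<open>a = 0\<close> by simp
    also have "cnj (y i) * s = of_real (- (r * (norm s)\<^sup>2))"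
      unfolding of_real_minus of_real_mult complex_norm_square by (simp add: y_def mult_ac)
    also have "2 * Re (of_real (- (r * (norm s)\<^sup>2))) + Re (sesq_on I A x) = -1"
      using s by (simp add: r_def)
    finally show False using pos[of y] by simp
  qed
  have zero': "A i k = 0" if "a = 0" "k \<in> I" for k
    using zero[OF that(1), of "\<lambda>l. if l = k then 1 else 0"] that(2) insert.hyps(1)
    by (simp add: if_distrib[where f = "\<lambda>x. A i _ * x"] sum.delta' cong: if_cong)
  define A' where "A' = (\<lambda>j k. A j k - A j i * cnj (A k i) / of_real a)"
  have "\<exists>Q. \<forall>j\<in>I. \<forall>k\<in>I. A' j k = (\<Sum>l\<in>I. Q j l * cnj (Q k l))"
  proof (rule insert.IH)
    show "A' j k = cnj (A' k j)" if "j \<in> I" "k \<in> I" for j k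
      using herm[of j k] that by (simp add: A'_def mult.commute)
    fix x
    define s where "s = (\<Sum>k\<in>I. A i k * x k)"
    have cs: "(\<Sum>j\<in>I. cnj (x j) * A j i) = cnj s"
      unfolding s_def cnj_sum using herm[of _ i] by (intro sum.cong) (auto simp: mult.commute)
    have s2: "(\<Sum>k\<in>I. cnj (A k i) * x k) = s"
      unfolding s_def using herm[of i] by (intro sum.cong) auto
    have "sesq_on I A' x = sesq_on I A x - cnj s * s / of_real a"
    proof -
      have "cnj s * s / of_real a = (\<Sum>j\<in>I. \<Sum>k\<in>I. cnj (x j) * A j i * (cnj (A k i) * x k) / of_real a)"
        unfolding cs[symmetric] unfolding s2[symmetric] by (simp add: sum_product sum_divide_distrib)
      then show ?thesis unfolding sesq_on_def A'_def
        by (simp add: sum_subtractf[symmetric] algebra_simps)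
    qed
    also have "cnj s * s / of_real a = of_real ((norm s)\<^sup>2 / a)"
      unfolding of_real_divide complex_norm_square by (simp add: mult.commute)
    finally have eq: "Re (sesq_on I A' x) = Re (sesq_on I A x) - (norm s)\<^sup>2 / a" by simp
    show "Re (sesq_on I A' x) \<ge> 0"
    proof (cases "a = 0")
      case True
      then show ?thesis unfolding eq using posI[of x] by simp
    next
      case False
      then have a0: "a > 0" using \<open>a \<ge> 0\<close> by simp
      \<comment> \<open>The i-th coordinate that minimises the form for fixed remaining
        coordinates.\<close>
      define y where "y = x(i := - (s / of_real a))"
      have e: "(\<Sum>k\<in>I. A i k * y k) = s" "sesq_on I A y = sesq_on I A x"
        using insert.hyps(2) by (auto simp: y_def s_def intro!: sum.cong sesq_on_cong)
      have "cnj (y i) * s = of_real (- ((norm s)\<^sup>2 / a))"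
        unfolding of_real_minus of_real_divide complex_norm_square by (simp add: y_def mult_ac)
      moreover have "a * (norm (y i))\<^sup>2 = (norm s)\<^sup>2 / a"
        using a0 by (simp add: y_def norm_divide power2_eq_square)
      ultimately have "Re (sesq_on (insert i I) A y) = (norm s)\<^sup>2 / a - 2 * ((norm s)\<^sup>2 / a) + Re (sesq_on I A x)"
        unfolding form e by simp
      then show ?thesis unfolding eq using pos[of y] by simp
    qed
  qed
  then obtain Q where Q: "\<And>j k. j \<in> I \<Longrightarrow> k \<in> I \<Longrightarrow> A' j k = (\<Sum>l\<in>I. Q j l * cnj (Q k l))" by blast
  define Q' where "Q' = (\<lambda>j l. if l = i then A j i / of_real (sqrt a) else if j = i then 0 else Q j l)"
  have sq: "of_real (sqrt a) * of_real (sqrt a) = (of_real a :: complex)" using \<open>a \<ge> 0\<close> by (simp flip: of_real_mult)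
  have "A j k = (\<Sum>l\<in>insert i I. Q' j l * cnj (Q' k l))" if jk: "j \<in> insert i I" "k \<in> insert i I" for j k
  proof -
    have 1: "(\<Sum>l\<in>insert i I. Q' j l * cnj (Q' k l)) = A j i * cnj (A k i) / of_real a + (\<Sum>l\<in>I. Q' j l * cnj (Q' k l))"
      using insert.hyps sq by (simp add: Q'_def)
    have 2: "(\<Sum>l\<in>I. Q' j l * cnj (Q' k l)) = (if j = i \<or> k = i then 0 else A' j k)"
    proof (cases "j = i \<or> k = i")
      case True
      then show ?thesis using insert.hyps(2) by (auto simp: Q'_def intro!: sum.neutral)
    next
      case False
      then have "j \<in> I" "k \<in> I" using jk by auto
      from Q[OF this] show ?thesis using False insert.hyps(2) by (auto simp: Q'_def intro!: sum.cong)
    qed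
    show ?thesis
    proof (cases "j = i \<or> k = i")
      case True
      have "A j k = A j i * cnj (A k i) / of_real a"
      proof (cases "a = 0")
        case True
        then have "A i l = 0" if "l \<in> insert i I" for l using that zero' a by auto
        then have "A j k = 0" using herm[OF jk] jk \<open>j = i \<or> k = i\<close> by auto
        then show ?thesis using True by simp
      next
        case False
        then show ?thesis using \<open>j = i \<or> k = i\<close> a herm[OF jk] by auto
      qed
      then show ?thesis unfolding 1 2 using True by simp
    next
      case False
      then show ?thesis unfolding 1 2 by (simp add: A'_def)
    qed
  qed
  then show ?case by blast
qed

section \<open>Orthogonality on the circle and truncation of power series\<close>

lemma circle_mean_monomials:
  "((\<lambda>t. circ 1 t ^ l * cnj (circ 1 t) ^ k) has_integral (if l = k then 1 else 0)) {0..1}"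
proof -
  have one: "cnj (circ 1 t) * circ 1 t = 1" "circ 1 t * cnj (circ 1 t) = 1" for t
    using complex_norm_square[of "circ 1 t"] by (simp_all add: mult.commute)
  have pos: "((\<lambda>t. circ 1 t ^ d) has_integral 0) {0..1}" if "d > 0" for d
    using circle_mean_power_mult[of 1 "\<lambda>_. 1" d] that by simp
  consider "l = k" | d where "l = k + d" "d > 0" | d where "k = l + d" "d > 0"
    by (metis less_imp_add_positive linorder_neqE_nat)
  then show ?thesis
  proof cases
    case 1
    have "((\<lambda>t::real. 1::complex) has_integral 1) {0..1}" using has_integral_const_real[of "1::complex" 0 1] by simp
    moreover have "circ 1 t ^ k * cnj (circ 1 t) ^ k = 1" for t by (simp add: one flip: power_mult_distrib)
    ultimately show ?thesis using 1 by simp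
  next
    case 2
    have "circ 1 t ^ (k + d) * cnj (circ 1 t) ^ k = (circ 1 t * cnj (circ 1 t)) ^ k * circ 1 t ^ d" for t
      unfolding power_mult_distrib power_add by (simp only: mult_ac)
    then show ?thesis using pos[of d] 2 by (simp add: one)
  next
    case 3
    have "circ 1 t ^ l * cnj (circ 1 t) ^ (l + d) = (circ 1 t * cnj (circ 1 t)) ^ l * cnj (circ 1 t ^ d)" for t
      unfolding power_mult_distrib power_add complex_cnj_power by (simp only: mult_ac)
    moreover have "(cnj \<circ> (\<lambda>t. circ 1 t ^ d) has_integral cnj 0) {0..1}"
      using pos[OF 3(2)] by (subst has_integral_cnj)
    ultimately show ?thesis using 3 by (simp add: comp_def one)
  qed
qed

lemma Parseval_poly:
  assumes "degree p \<le> N"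
  shows "((\<lambda>t. poly p (circ 1 t) * cnj (poly p (circ 1 t))) has_integral of_real (\<Sum>l\<le>N. (norm (coeff p l))\<^sup>2)) {0..1}"
proof -
  have "((\<lambda>t. \<Sum>l\<le>N. \<Sum>k\<le>N. (coeff p l * cnj (coeff p k)) * (circ 1 t ^ l * cnj (circ 1 t) ^ k)) has_integral
      (\<Sum>l\<le>N. \<Sum>k\<le>N. (coeff p l * cnj (coeff p k)) * (if l = k then 1 else 0))) {0..1}"
    by (intro has_integral_sum has_integral_mult_right circle_mean_monomials) auto
  moreover have "(\<Sum>l\<le>N. \<Sum>k\<le>N. (coeff p l * cnj (coeff p k)) * (if l = k then 1 else 0)) = of_real (\<Sum>l\<le>N. (norm (coeff p l))\<^sup>2)"
    unfolding of_real_sum complex_norm_square by (intro sum.cong refl) (simp add: if_distrib[where f = "\<lambda>x. _ * x"] sum.delta' cong: if_cong)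
  moreover have "(\<Sum>l\<le>N. \<Sum>k\<le>N. (coeff p l * cnj (coeff p k)) * (circ 1 t ^ l * cnj (circ 1 t) ^ k)) =
      poly p (circ 1 t) * cnj (poly p (circ 1 t))" for t
    unfolding poly_altdef_bound[OF assms] by (simp add: sum_product mult_ac)
  ultimately show ?thesis by simp
qed

text \<open>The function is t plus a remainder whose power series starts at degree N + 1. The two
  are orthogonal on the circle, so the mean square is at least that of t, which Parseval's identity
  evaluates.\<close>

lemma truncation_mean_le:
  assumes q: "\<And>z. norm z \<le> 1 \<Longrightarrow> poly q z \<noteq> 0" and t: "degree t \<le> N"
    and I: "((\<lambda>x. (poly t (circ 1 x) + circ 1 x ^ Suc N * poly s (circ 1 x) / poly q (circ 1 x)) *
      cnj (poly t (circ 1 x) + circ 1 x ^ Suc N * poly s (circ 1 x) / poly q (circ 1 x))) has_integral I) {0..1}"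
  shows "(\<Sum>l\<le>N. (norm (coeff t l))\<^sup>2) \<le> Re I"
proof -
  define r where "r = (\<lambda>x. circ 1 x ^ Suc N * poly s (circ 1 x) / poly q (circ 1 x))"
  define T where "T = (\<lambda>x. poly t (circ 1 x))"
  have cross: "((\<lambda>x. cnj (T x) * r x) has_integral 0) {0..1}"
  proof -
    have "((\<lambda>x. \<Sum>l\<le>N. cnj (coeff t l) * (circ 1 x ^ (Suc N - l) * (poly s (circ 1 x) / poly q (circ 1 x)))) has_integral
        (\<Sum>l\<le>N. cnj (coeff t l) * 0)) {0..1}"
      by (intro has_integral_sum has_integral_mult_right circle_mean_power_mult) (auto intro!: continuous_intros holomorphic_intros simp: q)
    moreover have "(\<Sum>l\<le>N. cnj (coeff t l) * (circ 1 x ^ (Suc N - l) * (poly s (circ 1 x) / poly q (circ 1 x)))) = cnj (T x) * r x" for x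
    proof -
      have "cnj (circ 1 x) ^ l * circ 1 x ^ Suc N = circ 1 x ^ (Suc N - l)" if "l \<le> N" for l
      proof -
        have "circ 1 x ^ Suc N = circ 1 x ^ l * circ 1 x ^ (Suc N - l)" using that by (simp flip: power_add)
        moreover have "cnj (circ 1 x) ^ l * circ 1 x ^ l = 1"
          using complex_norm_square[of "circ 1 x"] by (simp add: mult.commute flip: power_mult_distrib)
        ultimately show ?thesis by (simp add: mult.assoc[symmetric] del: power_Suc)
      qed
      then have "(\<Sum>l\<le>N. cnj (coeff t l) * (circ 1 x ^ (Suc N - l) * (poly s (circ 1 x) / poly q (circ 1 x)))) =
          (\<Sum>l\<le>N. cnj (coeff t l) * ((cnj (circ 1 x) ^ l * circ 1 x ^ Suc N) * (poly s (circ 1 x) / poly q (circ 1 x))))"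
        by (intro sum.cong) simp_all
      also have "\<dots> = (\<Sum>l\<le>N. cnj (coeff t l) * cnj (circ 1 x) ^ l) * (circ 1 x ^ Suc N * (poly s (circ 1 x) / poly q (circ 1 x)))"
        by (simp only: sum_distrib_right mult.assoc)
      finally show ?thesis unfolding T_def r_def poly_altdef_bound[OF t] by simp
    qed
    ultimately show ?thesis by simp
  qed
  have "(cnj \<circ> (\<lambda>x. cnj (T x) * r x) has_integral cnj 0) {0..1}" using cross by (subst has_integral_cnj)
  then have cross': "((\<lambda>x. T x * cnj (r x)) has_integral 0) {0..1}" by (simp add: comp_def)
  have "((\<lambda>x. (T x + r x) * cnj (T x + r x) - T x * cnj (T x) - cnj (T x) * r x - T x * cnj (r x)) has_integral
      (I - of_real (\<Sum>l\<le>N. (norm (coeff t l))\<^sup>2) - 0 - 0)) {0..1}"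
    unfolding T_def using I cross cross'
    by (intro has_integral_diff Parseval_poly[OF t]) (simp_all add: r_def T_def)
  then have "((\<lambda>x. r x * cnj (r x)) has_integral (I - of_real (\<Sum>l\<le>N. (norm (coeff t l))\<^sup>2))) {0..1}"
    by (simp add: algebra_simps)
  then have "((\<lambda>x. Re (r x * cnj (r x))) has_integral Re (I - of_real (\<Sum>l\<le>N. (norm (coeff t l))\<^sup>2))) {0..1}"
    by (rule has_integral_Re)
  then have "0 \<le> Re (I - of_real (\<Sum>l\<le>N. (norm (coeff t l))\<^sup>2))"
    by (rule has_integral_nonneg) (simp add: complex_norm_square[symmetric])
  then show ?thesis by simp
qed

text \<open>Here t is the Taylor polynomial of g / q at 0 of order N, and s accounts for the
  remainder.\<close>

lemma divide_mod_power:
  fixes q :: "complex poly"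
  assumes "poly q 0 \<noteq> 0"
  shows "\<exists>t s. degree t \<le> N \<and> g = q * t + monom 1 (Suc N) * s"
proof (induction N)
  case 0
  define c where "c = poly g 0 / poly q 0"
  have "poly (g - q * [:c:]) 0 = 0" using assms by (simp add: c_def)
  then obtain s where s: "g - q * [:c:] = [:- 0, 1:] * s" unfolding poly_eq_0_iff_dvd by (elim dvdE)
  have "g = q * [:c:] + monom 1 (Suc 0) * s" using s by (simp add: monom_altdef algebra_simps)
  then show ?case by (intro exI[of _ "[:c:]"] exI[of _ s]) simp
next
  case (Suc N)
  then obtain t s where ts: "degree t \<le> N" "g = q * t + monom 1 (Suc N) * s" by blast
  define c where "c = poly s 0 / poly q 0"
  have "poly (s - q * [:c:]) 0 = 0" using assms by (simp add: c_def)
  then obtain s' where s': "s - q * [:c:] = [:- 0, 1:] * s'" unfolding poly_eq_0_iff_dvd by (elim dvdE)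
  have s: "s = q * [:c:] + monom 1 (Suc 0) * s'" using s' by (simp add: monom_altdef algebra_simps)
  have "g = q * (t + monom c (Suc N)) + monom 1 (Suc (Suc N)) * s'"
  proof -
    have m: "monom 1 (Suc N) * [:c:] = monom c (Suc N)" by (simp add: smult_monom mult.commute)
    have m2: "monom 1 (Suc N) * monom 1 (Suc 0) = monom (1::complex) (Suc (Suc N))" by (simp add: mult_monom)
    have "g = q * t + monom 1 (Suc N) * (q * [:c:] + monom 1 (Suc 0) * s')" using ts(2) s by simp
    also have "\<dots> = q * (t + monom 1 (Suc N) * [:c:]) + (monom 1 (Suc N) * monom 1 (Suc 0)) * s'"
      by (simp only: distrib_left mult_ac add_ac)
    finally show ?thesis unfolding m m2 .
  qed
  moreover have "degree (t + monom c (Suc N)) \<le> Suc N"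
    using ts(1) degree_monom_le[of c "Suc N"] by (intro degree_add_le) auto
  ultimately show ?case by blast
qed

section \<open>Unitary realizations\<close>

lemma unitary_transpose:
  assumes "unitary_mat U" "U \<in> carrier_mat n n"
  shows "unitary_mat (transpose_mat U)"
proof (rule unitary_matI)
  show "transpose_mat U * mat_adjoint (transpose_mat U) = 1\<^sub>m n"
  proof (rule eq_matI)
    fix i j assume "i < dim_row (1\<^sub>m n)" "j < dim_col (1\<^sub>m n)"
    then have ij: "i < n" "j < n" by auto
    have "(transpose_mat U * mat_adjoint (transpose_mat U)) $$ (i, j) = cnj ((mat_adjoint U * U) $$ (i, j))"
      using assms(2) ij by (simp add: scalar_prod_def mult.commute)
    then show "(transpose_mat U * mat_adjoint (transpose_mat U)) $$ (i, j) = 1\<^sub>m n $$ (i, j)"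
      using unitary_matD(2)[OF assms] ij by simp
  qed (use assms in auto)
qed (use assms in auto)

lemma sesq_on_Gram:
  "sesq_on J (\<lambda>r s. \<Sum>v\<in>V. X r v * cnj (X s v)) x = of_real (\<Sum>v\<in>V. (norm (\<Sum>s\<in>J. cnj (X s v) * x s))\<^sup>2)"
proof -
  have "sesq_on J (\<lambda>r s. \<Sum>v\<in>V. X r v * cnj (X s v)) x =
      (\<Sum>r\<in>J. \<Sum>s\<in>J. \<Sum>v\<in>V. (cnj (X s v) * x s) * cnj (cnj (X r v) * x r))"
    unfolding sesq_on_def by (simp add: sum_distrib_left sum_distrib_right mult_ac)
  also have "\<dots> = (\<Sum>r\<in>J. \<Sum>v\<in>V. \<Sum>s\<in>J. (cnj (X s v) * x s) * cnj (cnj (X r v) * x r))"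
    by (intro sum.cong refl sum.swap)
  also have "\<dots> = (\<Sum>v\<in>V. \<Sum>r\<in>J. \<Sum>s\<in>J. (cnj (X s v) * x s) * cnj (cnj (X r v) * x r))"
    by (rule sum.swap)
  also have "\<dots> = (\<Sum>v\<in>V. (\<Sum>s\<in>J. cnj (X s v) * x s) * cnj (\<Sum>r\<in>J. cnj (X r v) * x r))"
    by (simp add: sum_distrib_left sum_distrib_right)
  finally show ?thesis unfolding of_real_sum complex_norm_square .
qed

text \<open>Entries of the lower triangular Toeplitz matrix of multiplication by p on truncated
  power series.\<close>

definition shift_coeff :: "complex poly \<Rightarrow> nat \<Rightarrow> nat \<Rightarrow> complex" where
  "shift_coeff p i l = (if l \<le> i then coeff p (i - l) else 0)"

lemma shift_coeff_simps [simp]: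
  "shift_coeff p i 0 = coeff p i" "shift_coeff p 0 (Suc l) = 0" "shift_coeff p (Suc i) (Suc l) = shift_coeff p i l"
  by (simp_all add: shift_coeff_def)

lemma shift_coeff_mult:
  assumes "i \<le> N"
  shows "(\<Sum>l\<le>N. shift_coeff p i l * coeff t l) = coeff (p * t) i"
proof -
  have "coeff (p * t) i = (\<Sum>l\<le>i. shift_coeff p i l * coeff t l)"
    unfolding mult.commute[of p t] coeff_mult by (intro sum.cong) (auto simp: shift_coeff_def)
  also have "\<dots> = (\<Sum>l\<le>N. shift_coeff p i l * coeff t l)"
    using assms by (intro sum.mono_neutral_left) (auto simp: shift_coeff_def)
  finally show ?thesis by simp
qed

text \<open>The right side is an entry in the last row of a product of one Toeplitz matrix and the
  adjoint of another. Such entries are Laurent coefficients of p cnj r on the circle, shifted by the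
  z^N of the reflection.\<close>

lemma coeff_mult_cnj_reflect:
  assumes p: "degree p \<le> N" and j: "j \<le> N"
  shows "coeff (p * cnj_reflect N r) (2 * N - j) = (\<Sum>l\<le>N. shift_coeff p N l * cnj (shift_coeff r j l))"
proof -
  have "(\<Sum>i\<le>2 * N - j. coeff p i * coeff (cnj_reflect N r) (2 * N - j - i)) =
      (\<Sum>i\<in>{N - j..N}. coeff p i * coeff (cnj_reflect N r) (2 * N - j - i))"
    using j p by (intro sum.mono_neutral_right) (auto simp: coeff_eq_0 coeff_cnj_reflect)
  also have "\<dots> = (\<Sum>l\<le>j. shift_coeff p N l * cnj (shift_coeff r j l))"
  proof (rule sum.reindex_bij_witness[where i = "\<lambda>l. N - l" and j = "\<lambda>i. N - i"])
    fix i assume "i \<in> {N - j..N}"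
    then have i: "i \<le> N" "N - j \<le> i" by auto
    then have "N - (2 * N - j - i) = j - (N - i)" "2 * N - j - i \<le> N" using j by auto
    then show "shift_coeff p N (N - i) * cnj (shift_coeff r j (N - i)) = coeff p i * coeff (cnj_reflect N r) (2 * N - j - i)"
      using i by (auto simp: shift_coeff_def coeff_cnj_reflect)
  qed (use j in auto)
  also have "\<dots> = (\<Sum>l\<le>N. shift_coeff p N l * cnj (shift_coeff r j l))"
    using j by (intro sum.mono_neutral_left) (auto simp: shift_coeff_def)
  finally have "(\<Sum>i\<le>2 * N - j. coeff p i * coeff (cnj_reflect N r) (2 * N - j - i)) =
      (\<Sum>l\<le>N. shift_coeff p N l * cnj (shift_coeff r j l))" .
  then show ?thesis by (simp add: coeff_mult)
qed

locale inner_rational =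
  fixes n N :: nat and F :: "nat \<Rightarrow> nat \<Rightarrow> complex poly" and q :: "complex poly"
  assumes dq: "degree q \<le> N" and dF: "\<And>a c. a < n \<Longrightarrow> c < n \<Longrightarrow> degree (F a c) \<le> N"
    and q: "\<And>z. norm z \<le> 1 \<Longrightarrow> poly q z \<noteq> 0"
    and unit: "\<And>z a b. norm z = 1 \<Longrightarrow> a < n \<Longrightarrow> b < n \<Longrightarrow>
      (\<Sum>c<n. poly (F a c) z * cnj (poly (F b c) z)) = (if a = b then poly q z * cnj (poly q z) else 0)"
begin

definition "J = {..<n} \<times> {..N}"

definition "X r v = (if fst r = fst v then shift_coeff q (snd r) (snd v) else 0)"

definition "Y r v = shift_coeff (F (fst r) (fst v)) (snd r) (snd v)"

text \<open>The coefficient matrix X X^* - Y Y^* of the kernel: X and Y are the block Toeplitz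
  matrices of q I and of F, and dividing by 1 - z cnj u sums coefficients along diagonals.\<close>

definition "K r s = (\<Sum>v\<in>J. X r v * cnj (X s v)) - (\<Sum>v\<in>J. Y r v * cnj (Y s v))"

lemma finite_J: "finite J"
  by (simp add: J_def)

lemma sum_J: "(\<Sum>v\<in>J. f v) = (\<Sum>c<n. \<Sum>l\<le>N. f (c, l))"
  unfolding J_def by (simp add: sum.cartesian_product)

lemma K_eq:
  assumes "a < n" "b < n"
  shows "K (a, i) (b, j) = (if a = b then \<Sum>l\<le>N. shift_coeff q i l * cnj (shift_coeff q j l) else 0)
    - (\<Sum>c<n. \<Sum>l\<le>N. shift_coeff (F a c) i l * cnj (shift_coeff (F b c) j l))"
proof -
  have "(\<Sum>v\<in>J. X (a, i) v * cnj (X (b, j) v)) =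
      (\<Sum>c<n. if c = a then (if a = b then \<Sum>l\<le>N. shift_coeff q i l * cnj (shift_coeff q j l) else 0) else 0)"
    unfolding sum_J by (intro sum.cong refl) (auto simp: X_def)
  also have "\<dots> = (if a = b then \<Sum>l\<le>N. shift_coeff q i l * cnj (shift_coeff q j l) else 0)"
    using assms(1) by (simp add: sum.delta)
  finally show ?thesis unfolding K_def by (simp add: sum_J Y_def)
qed

lemma K_herm: "K r s = cnj (K s r)"
  unfolding K_def by (simp add: mult.commute)

lemma sum_shift_rec:
  assumes "i \<le> N" "j \<le> N"
  shows "(\<Sum>l\<le>N. shift_coeff p i l * cnj (shift_coeff r j l)) = coeff p i * cnj (coeff r j) +
    (if i = 0 \<or> j = 0 then 0 else \<Sum>l\<le>N. shift_coeff p (i - 1) l * cnj (shift_coeff r (j - 1) l))"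
proof -
  have 1: "(\<Sum>l\<le>N. shift_coeff p i l * cnj (shift_coeff r j l)) = coeff p i * cnj (coeff r j) +
      (\<Sum>l<N. shift_coeff p i (Suc l) * cnj (shift_coeff r j (Suc l)))"
    unfolding lessThan_Suc_atMost[symmetric] sum.lessThan_Suc_shift by simp
  show ?thesis
  proof (cases "i = 0 \<or> j = 0")
    case True
    then have "(\<Sum>l<N. shift_coeff p i (Suc l) * cnj (shift_coeff r j (Suc l))) = 0" by auto
    then show ?thesis unfolding 1 using True by simp
  next
    case False
    then obtain i' j' where ij: "i = Suc i'" "j = Suc j'" by (metis not0_implies_Suc)
    have "(\<Sum>l\<le>N. shift_coeff p i' l * cnj (shift_coeff r j' l)) = (\<Sum>l<N. shift_coeff p i' l * cnj (shift_coeff r j' l))"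
      using assms ij unfolding lessThan_Suc_atMost[symmetric] by (simp add: shift_coeff_def)
    then show ?thesis unfolding 1 using ij by simp
  qed
qed

text \<open>Multiplying the kernel by 1 - z cnj u returns its numerator. This is that identity for
  the coefficient of z^i cnj u^j, with the negative terms moved across.\<close>

lemma K_rec:
  assumes "a < n" "b < n" "i \<le> N" "j \<le> N"
  shows "(if a = b then coeff q i * cnj (coeff q j) else 0) + (if i = 0 \<or> j = 0 then 0 else K (a, i - 1) (b, j - 1)) =
    (\<Sum>c<n. coeff (F a c) i * cnj (coeff (F b c) j)) + K (a, i) (b, j)"
  unfolding K_eq[OF assms(1,2)] sum_shift_rec[OF assms(3,4)] by (simp add: sum.distrib)

text \<open>Unitarity of F / q says that the numerator of the kernel vanishes for u = z on the
  circle. The row of index N consists of coefficients of this vanishing expression; its being 0 lets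
  the recursion close up.\<close>

lemma K_last:
  assumes "a < n" "b < n" "j \<le> N"
  shows "K (a, N) (b, j) = 0"
proof -
  define R where "R = (if a = b then q * cnj_reflect N q else 0) - (\<Sum>c<n. F a c * cnj_reflect N (F b c))"
  have "R = 0"
  proof (rule ccontr)
    assume "R \<noteq> 0"
    have "poly R z = 0" if z: "norm z = 1" for z
    proof -
      have z0: "z \<noteq> 0" using z by auto
      have r: "poly (cnj_reflect N p) z = z ^ N * cnj (poly p z)" if "degree p \<le> N" for p
        using poly_cnj_reflect[OF that z0] inverse_cnj_circle[OF z] by simp
      have "poly R z = (if a = b then poly q z * (z ^ N * cnj (poly q z)) else 0)
          - (\<Sum>c<n. poly (F a c) z * (z ^ N * cnj (poly (F b c) z)))"
        unfolding R_def using r dq dF assms by (simp add: poly_sum)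
      also have "(\<Sum>c<n. poly (F a c) z * (z ^ N * cnj (poly (F b c) z))) = z ^ N * (\<Sum>c<n. poly (F a c) z * cnj (poly (F b c) z))"
        by (simp add: sum_distrib_left mult_ac)
      finally show ?thesis unfolding unit[OF z assms(1,2)] by simp
    qed
    then have "unit_circle \<subseteq> {z. poly R z = 0}" by auto
    then show False using poly_roots_finite[OF \<open>R \<noteq> 0\<close>] infinite_unit_circle finite_subset by blast
  qed
  then have "coeff R (2 * N - j) = 0" by simp
  then show ?thesis unfolding K_eq[OF assms(1,2)] R_def
    using coeff_mult_cnj_reflect[OF dq assms(3)] coeff_mult_cnj_reflect[OF dF assms(3)] assms
    by (simp add: coeff_sum split: if_splits)
qed

text \<open>Here x^* K x = |u|^2 - |y|^2 with u = X^* x and y = Y^* x. Let t be the truncation of F y / q at degree N. Then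
  X t = Y y gives (u, t) = |y|^2, and |t| is at most |y| because F / q is unitary on the circle.
  Hence x^* K x is at least |u - t|^2.\<close>

lemma K_psd: "Re (sesq_on J K x) \<ge> 0"
proof -
  define u where "u = (\<lambda>v. \<Sum>s\<in>J. cnj (X s v) * x s)"
  define y where "y = (\<lambda>v. \<Sum>s\<in>J. cnj (Y s v) * x s)"
  define P where "P = (\<lambda>c. \<Sum>l\<le>N. monom (y (c, l)) l)"
  have cP: "coeff (P c) l = (if l \<le> N then y (c, l) else 0)" for c l
    unfolding P_def coeff_sum coeff_monom by (simp add: sum.delta)
  have dP: "degree (P c) \<le> N" for c by (rule degree_le) (simp add: cP)
  define g where "g = (\<lambda>a. \<Sum>c<n. F a c * P c)"
  have "\<forall>a. \<exists>t s. degree t \<le> N \<and> g a = q * t + monom 1 (Suc N) * s"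
    using divide_mod_power[of q] q[of 0] by simp
  then obtain t s where t: "\<And>a. degree (t a) \<le> N" and ts: "\<And>a. g a = q * t a + monom 1 (Suc N) * s a" by metis
  define T where "T = (\<lambda>v. coeff (t (fst v)) (snd v))"
  have XT: "(\<Sum>v\<in>J. X r v * T v) = (\<Sum>v\<in>J. Y r v * y v)" if r: "r \<in> J" for r
  proof -
    obtain a i where ai: "r = (a, i)" "a < n" "i \<le> N" using r by (auto simp: J_def)
    have "(\<Sum>v\<in>J. X r v * T v) = (\<Sum>c<n. if c = a then (\<Sum>l\<le>N. shift_coeff q i l * coeff (t a) l) else 0)"
      unfolding sum_J ai by (intro sum.cong refl) (auto simp: X_def T_def)
    also have "\<dots> = coeff (q * t a) i" using ai by (simp add: sum.delta shift_coeff_mult)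
    also have "\<dots> = coeff (g a) i" unfolding ts using ai(3) by (simp add: coeff_monom_mult)
    also have "\<dots> = (\<Sum>c<n. \<Sum>l\<le>N. shift_coeff (F a c) i l * coeff (P c) l)"
      unfolding g_def coeff_sum using shift_coeff_mult[OF ai(3)] by simp
    also have "\<dots> = (\<Sum>v\<in>J. Y r v * y v)" unfolding sum_J ai by (simp add: Y_def cP)
    finally show ?thesis .
  qed
  have "(\<Sum>v\<in>J. u v * cnj (T v)) = (\<Sum>s\<in>J. x s * cnj (\<Sum>v\<in>J. X s v * T v))"
  proof -
    have "(\<Sum>v\<in>J. u v * cnj (T v)) = (\<Sum>v\<in>J. \<Sum>s\<in>J. x s * cnj (X s v * T v))"
      unfolding u_def sum_distrib_right by (intro sum.cong refl) simp
    also have "\<dots> = (\<Sum>s\<in>J. \<Sum>v\<in>J. x s * cnj (X s v * T v))" by (rule sum.swap)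
    finally show ?thesis unfolding cnj_sum sum_distrib_left .
  qed
  also have "\<dots> = (\<Sum>s\<in>J. x s * cnj (\<Sum>v\<in>J. Y s v * y v))" using XT by simp
  also have "\<dots> = (\<Sum>s\<in>J. \<Sum>v\<in>J. (cnj (Y s v) * x s) * cnj (y v))"
    by (simp add: sum_distrib_left mult_ac)
  also have "\<dots> = (\<Sum>v\<in>J. \<Sum>s\<in>J. (cnj (Y s v) * x s) * cnj (y v))" by (rule sum.swap)
  also have "\<dots> = (\<Sum>v\<in>J. y v * cnj (y v))" by (simp only: sum_distrib_right y_def)
  also have "\<dots> = of_real (\<Sum>v\<in>J. (norm (y v))\<^sup>2)" unfolding of_real_sum complex_norm_square ..
  finally have uT: "(\<Sum>v\<in>J. u v * cnj (T v)) = of_real (\<Sum>v\<in>J. (norm (y v))\<^sup>2)" .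
  have Ty: "(\<Sum>v\<in>J. (norm (T v))\<^sup>2) \<le> (\<Sum>v\<in>J. (norm (y v))\<^sup>2)"
  proof -
    define G where "G = (\<lambda>a \<theta>. poly (t a) (circ 1 \<theta>) + circ 1 \<theta> ^ Suc N * poly (s a) (circ 1 \<theta>) / poly q (circ 1 \<theta>))"
    define I where "I = (\<lambda>a. integral {0..1} (\<lambda>\<theta>. G a \<theta> * cnj (G a \<theta>)))"
    have GI: "((\<lambda>\<theta>. G a \<theta> * cnj (G a \<theta>)) has_integral I a) {0..1}" for a
      unfolding I_def by (intro integrable_integral integrable_continuous_interval)
        (auto simp: G_def q intro!: continuous_intros)
    have Gg: "G a \<theta> = poly (g a) (circ 1 \<theta>) / poly q (circ 1 \<theta>)" for a \<theta>
    proof -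
      have "poly q (circ 1 \<theta>) \<noteq> 0" by (rule q) simp
      then show ?thesis unfolding G_def ts by (simp add: poly_monom add_divide_distrib)
    qed
    \<comment> \<open>Pointwise on the circle F / q is unitary, so it preserves the total squared
      modulus.\<close>
    have pt: "(\<Sum>a<n. G a \<theta> * cnj (G a \<theta>)) = (\<Sum>c<n. poly (P c) (circ 1 \<theta>) * cnj (poly (P c) (circ 1 \<theta>)))" for \<theta>
    proof -
      define z where "z = circ 1 \<theta>"
      have z: "norm z = 1" by (simp add: z_def)
      have q0: "poly q z \<noteq> 0" using q z by simp
      define U where "U = mat n n (\<lambda>(a, c). poly (F a c) z / poly q z)"
      have U: "U \<in> carrier_mat n n" by (simp add: U_def)
      have "unitary_mat U"
      proof (rule unitary_matI[OF U], rule eq_matI)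
        fix a b assume "a < dim_row (1\<^sub>m n)" "b < dim_col (1\<^sub>m n)"
        then have ab: "a < n" "b < n" by auto
        have "(U * mat_adjoint U) $$ (a, b) = (\<Sum>c<n. poly (F a c) z / poly q z * cnj (poly (F b c) z / poly q z))"
          using ab by (simp add: U_def scalar_prod_def lessThan_atLeast0)
        also have "\<dots> = (\<Sum>c<n. poly (F a c) z * cnj (poly (F b c) z)) / (poly q z * cnj (poly q z))"
          by (simp add: sum_divide_distrib)
        also have "\<dots> = (if a = b then 1 else 0)" unfolding unit[OF z ab] using q0 by simp
        finally show "(U * mat_adjoint U) $$ (a, b) = 1\<^sub>m n $$ (a, b)" using ab by simp
      qed (use U in auto)
      define v where "v = vec n (\<lambda>c. poly (P c) z)"
      have v: "v \<in> carrier_vec n" by (simp add: v_def)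
      have Uv: "(U *\<^sub>v v) $ a = G a \<theta>" if "a < n" for a
        using that unfolding Gg g_def by (simp add: U_def v_def z_def scalar_prod_def lessThan_atLeast0 poly_sum sum_divide_distrib)
      have "(U *\<^sub>v v) \<bullet>c (U *\<^sub>v v) = v \<bullet>c v" by (rule unitary_preserves[OF \<open>unitary_mat U\<close> U v v])
      moreover have "(U *\<^sub>v v) \<bullet>c (U *\<^sub>v v) = (\<Sum>a<n. G a \<theta> * cnj (G a \<theta>))"
        using U v Uv by (subst cscalar_prod_sum[of _ n]) auto
      moreover have "v \<bullet>c v = (\<Sum>c<n. poly (P c) z * cnj (poly (P c) z))"
        by (subst cscalar_prod_sum[of _ n]) (auto simp: v_def)
      ultimately show ?thesis by (simp add: z_def)
    qed
    have "((\<lambda>\<theta>. \<Sum>a<n. G a \<theta> * cnj (G a \<theta>)) has_integral (\<Sum>a<n. I a)) {0..1}"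
      by (intro has_integral_sum GI) simp
    moreover have "((\<lambda>\<theta>. \<Sum>c<n. poly (P c) (circ 1 \<theta>) * cnj (poly (P c) (circ 1 \<theta>))) has_integral
        (\<Sum>c<n. of_real (\<Sum>l\<le>N. (norm (coeff (P c) l))\<^sup>2))) {0..1}"
      by (intro has_integral_sum Parseval_poly dP) simp
    ultimately have eq: "(\<Sum>a<n. I a) = (\<Sum>c<n. of_real (\<Sum>l\<le>N. (norm (coeff (P c) l))\<^sup>2))"
      unfolding pt by (rule has_integral_unique)
    have "(\<Sum>v\<in>J. (norm (T v))\<^sup>2) = (\<Sum>a<n. \<Sum>l\<le>N. (norm (coeff (t a) l))\<^sup>2)" by (simp add: sum_J T_def)
    also have "\<dots> \<le> (\<Sum>a<n. Re (I a))"
      using GI unfolding G_def by (intro sum_mono truncation_mean_le[OF q t]) auto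
    also have "\<dots> = Re (\<Sum>a<n. I a)" by simp
    also have "\<dots> = (\<Sum>v\<in>J. (norm (y v))\<^sup>2)" unfolding eq by (simp add: sum_J cP)
    finally show ?thesis .
  qed
  have "0 \<le> (\<Sum>v\<in>J. (norm (u v - T v))\<^sup>2)" by (intro sum_nonneg) simp
  also have "(\<Sum>v\<in>J. (norm (u v - T v))\<^sup>2) = (\<Sum>v\<in>J. (norm (u v))\<^sup>2) - 2 * Re (\<Sum>v\<in>J. u v * cnj (T v)) + (\<Sum>v\<in>J. (norm (T v))\<^sup>2)"
    by (simp add: cmod_power2 power2_diff sum.distrib sum_subtractf sum_distrib_left algebra_simps)
  also have "\<dots> \<le> (\<Sum>v\<in>J. (norm (u v))\<^sup>2) - (\<Sum>v\<in>J. (norm (y v))\<^sup>2)" unfolding uT using Ty by simp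
  also have "\<dots> = Re (sesq_on J K x)"
  proof -
    have "sesq_on J K x = sesq_on J (\<lambda>r s. \<Sum>v\<in>J. X r v * cnj (X s v)) x - sesq_on J (\<lambda>r s. \<Sum>v\<in>J. Y r v * cnj (Y s v)) x"
      unfolding sesq_on_def K_def by (simp add: algebra_simps sum_subtractf)
    then show ?thesis unfolding sesq_on_Gram u_def y_def by simp
  qed
  finally show ?thesis .
qed

text \<open>The recursion of K under the shift says that two families of vectors have equal Gram matrices; the
  unitary matching them is the realization.\<close>

lemma realization:
  "\<exists>m A B C D Q. A \<in> carrier_mat n n \<and> B \<in> carrier_mat n m \<and> C \<in> carrier_mat m n \<and> D \<in> carrier_mat m m \<and>
    unitary_mat (four_block_mat A B C D) \<and> (\<forall>z. Q z \<in> carrier_mat n m \<and>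
      poly q z \<cdot>\<^sub>m A + z \<cdot>\<^sub>m (Q z * C) = mat n n (\<lambda>(a, c). poly (F a c) z) \<and>
      poly q z \<cdot>\<^sub>m B + z \<cdot>\<^sub>m (Q z * D) = Q z)"
proof -
  obtain Q where Q: "\<And>r s. r \<in> J \<Longrightarrow> s \<in> J \<Longrightarrow> K r s = (\<Sum>l\<in>J. Q r l * cnj (Q s l))"
    using psd_Gram[OF finite_J, of K] K_herm K_psd by blast
  \<comment> \<open>The diagonal entry of K at index N is the squared norm of this Gram vector, and
    it is 0.\<close>
  have QN: "Q (a, N) l = 0" if "a < n" "l \<in> J" for a l
  proof -
    have "(a, N) \<in> J" using that by (simp add: J_def)
    then have "(\<Sum>l\<in>J. Q (a, N) l * cnj (Q (a, N) l)) = 0" using Q K_last[OF that(1) that(1), of N] by simp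
    then have "of_real (\<Sum>l\<in>J. (norm (Q (a, N) l))\<^sup>2) = (0::complex)" unfolding of_real_sum complex_norm_square .
    then have "(\<Sum>l\<in>J. (norm (Q (a, N) l))\<^sup>2) = 0" by (rule of_real_eq_0_iff[THEN iffD1])
    then show ?thesis using that(2) finite_J by (subst (asm) sum_nonneg_eq_0_iff) auto
  qed
  define m where "m = card J"
  obtain e where e: "bij_betw e {..<m} J"
    using ex_bij_betw_nat_finite[OF finite_J] by (auto simp: m_def lessThan_atLeast0)
  have sum_e: "(\<Sum>l<m. f (e l)) = (\<Sum>r\<in>J. f r)" for f :: "nat \<times> nat \<Rightarrow> complex"
    by (rule sum.reindex_bij_betw[OF e])
  have eJ: "e k \<in> J" if "k < m" for k using e that by (auto simp: bij_betw_def)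
  \<comment> \<open>\<open>K_rec\<close> in Gram form: coefficients of q joined with the Gram vector
    of index i - 1 have the same products as coefficients of F joined with that of index i.\<close>
  define x where "x = (\<lambda>r. vec (n + m) (\<lambda>s. if s < n then (if fst r = s then coeff q (snd r) else 0)
      else (if snd r = 0 then 0 else Q (fst r, snd r - 1) (e (s - n)))))"
  define y where "y = (\<lambda>r. vec (n + m) (\<lambda>s. if s < n then coeff (F (fst r) s) (snd r) else Q r (e (s - n))))"
  have split: "(\<Sum>s<n + m. f s) = (\<Sum>s<n. f s) + (\<Sum>s<m. f (n + s))" for f :: "nat \<Rightarrow> complex"
    by (induction m) (simp_all add: add.assoc)
  have gram: "x r \<bullet>c x s = y r \<bullet>c y s" if r: "r \<in> J" and s: "s \<in> J" for r s
  proof -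
    obtain a i b j where ab: "r = (a, i)" "s = (b, j)" "a < n" "b < n" "i \<le> N" "j \<le> N"
      using r s by (auto simp: J_def)
    have "x r \<bullet>c x s = (\<Sum>c<n. if c = a then (if a = b then coeff q i * cnj (coeff q j) else 0) else 0) +
        (if i = 0 \<or> j = 0 then 0 else \<Sum>l<m. Q (a, i - 1) (e l) * cnj (Q (b, j - 1) (e l)))"
    proof -
      have "x r \<bullet>c x s = (\<Sum>k<n + m. x r $ k * cnj (x s $ k))"
        by (rule cscalar_prod_sum) (simp add: x_def)
      moreover have "(\<Sum>k<n. x r $ k * cnj (x s $ k)) =
          (\<Sum>c<n. if c = a then (if a = b then coeff q i * cnj (coeff q j) else 0) else 0)"
        by (intro sum.cong) (auto simp: x_def ab)
      moreover have "(\<Sum>k<m. x r $ (n + k) * cnj (x s $ (n + k))) =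
          (if i = 0 \<or> j = 0 then 0 else \<Sum>l<m. Q (a, i - 1) (e l) * cnj (Q (b, j - 1) (e l)))"
        by (auto simp: x_def ab)
      ultimately show ?thesis unfolding split by simp
    qed
    also have "\<dots> = (if a = b then coeff q i * cnj (coeff q j) else 0) + (if i = 0 \<or> j = 0 then 0 else K (a, i - 1) (b, j - 1))"
    proof -
      have "(a, i - 1) \<in> J" "(b, j - 1) \<in> J" using ab by (auto simp: J_def)
      then show ?thesis using ab(3) sum_e[of "\<lambda>l. Q (a, i - 1) l * cnj (Q (b, j - 1) l)"] Q by (simp add: sum.delta)
    qed
    also have "\<dots> = (\<Sum>c<n. coeff (F a c) i * cnj (coeff (F b c) j)) + (\<Sum>l<m. Q r (e l) * cnj (Q s (e l)))"
      unfolding K_rec[OF ab(3-6)] using Q[OF r s] sum_e[of "\<lambda>l. Q r l * cnj (Q s l)"] ab by simp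
    also have "\<dots> = y r \<bullet>c y s"
      unfolding y_def ab by (subst cscalar_prod_sum[of _ "n + m"], simp, subst split) simp
    finally show ?thesis .
  qed
  have "\<exists>U. U \<in> carrier_mat (n + m) (n + m) \<and> unitary_mat U \<and> (\<forall>k<m. U *\<^sub>v x (e k) = y (e k))"
    using gram eJ by (intro unitary_extension) (auto simp: x_def y_def)
  then obtain U where U: "U \<in> carrier_mat (n + m) (n + m)" "unitary_mat U" "\<And>k. k < m \<Longrightarrow> U *\<^sub>v x (e k) = y (e k)" by blast
  have Ux: "U *\<^sub>v x r = y r" if "r \<in> J" for r
  proof -
    have "r \<in> e ` {..<m}" using e that by (simp add: bij_betw_def)
    then obtain k where "k < m" "r = e k" by auto
    then show ?thesis using U(3) by simp
  qed
  have ent: "(\<Sum>s<n. U $$ (c, s) * x (a, i) $ s) + (\<Sum>l<m. U $$ (c, n + l) * x (a, i) $ (n + l)) = y (a, i) $ c"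
    if "a < n" "i \<le> N" "c < n + m" for a i c
  proof -
    have "(a, i) \<in> J" using that by (simp add: J_def)
    then have "y (a, i) $ c = (U *\<^sub>v x (a, i)) $ c" using Ux by simp
    also have "\<dots> = (\<Sum>s<n + m. U $$ (c, s) * x (a, i) $ s)"
      using U(1) that by (simp add: scalar_prod_def lessThan_atLeast0 x_def)
    finally show ?thesis by (simp add: split)
  qed
  have ent': "coeff q i * U $$ (c, a) + (if i = 0 then 0 else \<Sum>l<m. U $$ (c, n + l) * Q (a, i - 1) (e l)) = y (a, i) $ c"
    if "a < n" "i \<le> N" "c < n + m" for a i c
  proof -
    have "(\<Sum>s<n. U $$ (c, s) * x (a, i) $ s) = (\<Sum>s<n. if s = a then coeff q i * U $$ (c, a) else 0)"
      by (intro sum.cong) (auto simp: x_def)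
    also have "\<dots> = coeff q i * U $$ (c, a)" using that(1) by (simp add: sum.delta)
    finally have "(\<Sum>s<n. U $$ (c, s) * x (a, i) $ s) = coeff q i * U $$ (c, a)" .
    moreover have "(\<Sum>l<m. U $$ (c, n + l) * x (a, i) $ (n + l)) = (if i = 0 then 0 else \<Sum>l<m. U $$ (c, n + l) * Q (a, i - 1) (e l))"
      by (auto simp: x_def intro!: sum.cong)
    ultimately show ?thesis using ent[OF that] by simp
  qed
  \<comment> \<open>The generating polynomial of the Gram vectors; it stops below N because the
    vector of index N is 0.\<close>
  define Qz where "Qz = (\<lambda>z. mat n m (\<lambda>(a, l). \<Sum>i<N. Q (a, i) (e l) * z ^ i))"
  have key: "poly q z * U $$ (c, a) + z * (\<Sum>l<m. Qz z $$ (a, l) * U $$ (c, n + l)) = (\<Sum>i\<le>N. y (a, i) $ c * z ^ i)"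
    if "a < n" "c < n + m" for a c z
  proof -
    have "(\<Sum>i\<le>N. y (a, i) $ c * z ^ i) = (\<Sum>i\<le>N. coeff q i * U $$ (c, a) * z ^ i) +
        (\<Sum>i\<le>N. (if i = 0 then 0 else \<Sum>l<m. U $$ (c, n + l) * Q (a, i - 1) (e l)) * z ^ i)"
      unfolding sum.distrib[symmetric] distrib_right[symmetric] using ent'[OF that(1) _ that(2)] by simp
    also have "(\<Sum>i\<le>N. coeff q i * U $$ (c, a) * z ^ i) = poly q z * U $$ (c, a)"
      unfolding poly_altdef_bound[OF dq] by (simp add: sum_distrib_left mult_ac)
    also have "(\<Sum>i\<le>N. (if i = 0 then 0 else \<Sum>l<m. U $$ (c, n + l) * Q (a, i - 1) (e l)) * z ^ i) =
        (\<Sum>i<N. (\<Sum>l<m. U $$ (c, n + l) * Q (a, i) (e l)) * z ^ Suc i)"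
      unfolding lessThan_Suc_atMost[symmetric] sum.lessThan_Suc_shift by simp
    also have "\<dots> = (\<Sum>i<N. \<Sum>l<m. z * (Q (a, i) (e l) * z ^ i * U $$ (c, n + l)))"
      by (simp add: sum_distrib_left sum_distrib_right mult_ac)
    also have "\<dots> = (\<Sum>l<m. \<Sum>i<N. z * (Q (a, i) (e l) * z ^ i * U $$ (c, n + l)))" by (rule sum.swap)
    also have "\<dots> = z * (\<Sum>l<m. Qz z $$ (a, l) * U $$ (c, n + l))"
      using that(1) by (simp add: Qz_def sum_distrib_left sum_distrib_right mult_ac)
    finally show ?thesis by simp
  qed
  define A where "A = mat n n (\<lambda>(s, c). U $$ (c, s))"
  define B where "B = mat n m (\<lambda>(s, l). U $$ (n + l, s))"
  define C where "C = mat m n (\<lambda>(l, c). U $$ (c, n + l))"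
  define D where "D = mat m m (\<lambda>(k, l). U $$ (n + l, n + k))"
  \<comment> \<open>U acts on column vectors, while in the realization \<open>Q z\<close> stands to
    the left of C and D; hence the transpose.\<close>
  have "four_block_mat A B C D = transpose_mat U"
    by (rule eq_matI) (use U(1) in \<open>auto simp: A_def B_def C_def D_def\<close>)
  then have un: "unitary_mat (four_block_mat A B C D)" using unitary_transpose[OF U(2,1)] by simp
  have e1: "poly q z \<cdot>\<^sub>m A + z \<cdot>\<^sub>m (Qz z * C) = mat n n (\<lambda>(a, c). poly (F a c) z)" for z
  proof (rule eq_matI)
    fix a c assume "a < dim_row (mat n n (\<lambda>(a, c). poly (F a c) z))" "c < dim_col (mat n n (\<lambda>(a, c). poly (F a c) z))"
    then have ac: "a < n" "c < n" by auto
    have "(Qz z * C) $$ (a, c) = (\<Sum>l<m. Qz z $$ (a, l) * U $$ (c, n + l))"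
      using ac by (simp add: C_def Qz_def scalar_prod_def lessThan_atLeast0)
    then have "(poly q z \<cdot>\<^sub>m A + z \<cdot>\<^sub>m (Qz z * C)) $$ (a, c) = (\<Sum>i\<le>N. y (a, i) $ c * z ^ i)"
      using ac key[of a c z] by (simp add: A_def C_def Qz_def)
    also have "\<dots> = poly (F a c) z" unfolding poly_altdef_bound[OF dF[OF ac]] using ac by (simp add: y_def)
    finally show "(poly q z \<cdot>\<^sub>m A + z \<cdot>\<^sub>m (Qz z * C)) $$ (a, c) = mat n n (\<lambda>(a, c). poly (F a c) z) $$ (a, c)" using ac by simp
  qed (auto simp: A_def C_def Qz_def)
  have e2: "poly q z \<cdot>\<^sub>m B + z \<cdot>\<^sub>m (Qz z * D) = Qz z" for z
  proof (rule eq_matI)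
    fix a k assume "a < dim_row (Qz z)" "k < dim_col (Qz z)"
    then have ak: "a < n" "k < m" by (auto simp: Qz_def)
    have "(Qz z * D) $$ (a, k) = (\<Sum>l<m. Qz z $$ (a, l) * U $$ (n + k, n + l))"
      using ak by (simp add: D_def Qz_def scalar_prod_def lessThan_atLeast0)
    then have "(poly q z \<cdot>\<^sub>m B + z \<cdot>\<^sub>m (Qz z * D)) $$ (a, k) = (\<Sum>i\<le>N. y (a, i) $ (n + k) * z ^ i)"
      using ak key[of a "n + k" z] by (simp add: B_def D_def Qz_def)
    also have "\<dots> = (\<Sum>i\<le>N. Q (a, i) (e k) * z ^ i)" using ak by (simp add: y_def)
    also have "\<dots> = (\<Sum>i<N. Q (a, i) (e k) * z ^ i)"
      unfolding lessThan_Suc_atMost[symmetric] using QN[OF ak(1) eJ[OF ak(2)]] by simp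
    finally show "(poly q z \<cdot>\<^sub>m B + z \<cdot>\<^sub>m (Qz z * D)) $$ (a, k) = Qz z $$ (a, k)" using ak by (simp add: Qz_def)
  qed (auto simp: B_def D_def Qz_def)
  show ?thesis
    by (intro exI[of _ m] exI[of _ A] exI[of _ B] exI[of _ C] exI[of _ D] exI[of _ Qz] conjI allI un e1 e2)
       (auto simp: A_def B_def C_def D_def Qz_def)
qed

end

section \<open>Rational inner functions in lowest terms\<close>

lemma unitary_block_isometry:
  assumes c: "A \<in> carrier_mat n n" "B \<in> carrier_mat n m" "C \<in> carrier_mat m n" "D \<in> carrier_mat m m"
    and u: "unitary_mat (four_block_mat A B C D)"
    and h: "h \<in> carrier_vec n" "k \<in> carrier_vec n" and x: "x \<in> carrier_vec m" "y \<in> carrier_vec m"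
  shows "(A *\<^sub>v h + B *\<^sub>v x) \<bullet>c (A *\<^sub>v k + B *\<^sub>v y) + (C *\<^sub>v h + D *\<^sub>v x) \<bullet>c (C *\<^sub>v k + D *\<^sub>v y) = h \<bullet>c k + x \<bullet>c y"
proof -
  have app: "(v @\<^sub>v w) \<bullet>c (v' @\<^sub>v w') = v \<bullet>c v' + w \<bullet>c w'"
    if "v \<in> carrier_vec n" "v' \<in> carrier_vec n" "w \<in> carrier_vec m" "w' \<in> carrier_vec m" for v v' w w' :: "complex vec"
  proof -
    have "conjugate (v' @\<^sub>v w') = conjugate v' @\<^sub>v conjugate w'"
      by (intro eq_vecI) (use that in \<open>auto simp: append_vec_def Let_def\<close>)
    then show ?thesis using that by (simp add: scalar_prod_append[of _ n _ m])
  qed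
  let ?U = "four_block_mat A B C D"
  have U: "?U \<in> carrier_mat (n + m) (n + m)" using c by simp
  have mv: "?U *\<^sub>v (v @\<^sub>v w) = (A *\<^sub>v v + B *\<^sub>v w) @\<^sub>v (C *\<^sub>v v + D *\<^sub>v w)"
    if "v \<in> carrier_vec n" "w \<in> carrier_vec m" for v w
    using four_block_mat_mult_vec[OF c that] .
  have "(?U *\<^sub>v (h @\<^sub>v x)) \<bullet>c (?U *\<^sub>v (k @\<^sub>v y)) = (h @\<^sub>v x) \<bullet>c (k @\<^sub>v y)"
    using h x by (intro unitary_preserves[OF u U]) auto
  then show ?thesis unfolding mv[OF h(1) x(1)] mv[OF h(2) x(2)] using c h x by (simp add: app)
qed

lemma cscalar_prod_smult:
  fixes v w :: "complex vec"
  assumes "v \<in> carrier_vec n" "w \<in> carrier_vec n"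
  shows "(a \<cdot>\<^sub>v v) \<bullet>c (b \<cdot>\<^sub>v w) = a * cnj b * (v \<bullet>c w)"
  using assms by (simp add: cscalar_prod_sum[of _ n] sum_distrib_left mult_ac)

lemma cscalar_prod_self_nonneg:
  fixes v :: "complex vec"
  assumes "v \<in> carrier_vec n"
  shows "v \<bullet>c v = of_real (Re (v \<bullet>c v))" "Re (v \<bullet>c v) \<ge> 0" "v \<noteq> 0\<^sub>v n \<Longrightarrow> Re (v \<bullet>c v) > 0"
proof -
  show 1: "v \<bullet>c v = of_real (Re (v \<bullet>c v))" unfolding cscalar_prod_self[OF assms] by simp
  show 2: "Re (v \<bullet>c v) \<ge> 0" unfolding cscalar_prod_self[OF assms] by (simp add: sum_nonneg)
  show "Re (v \<bullet>c v) > 0" if "v \<noteq> 0\<^sub>v n"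
  proof -
    have "v \<bullet>c v \<noteq> 0" using cscalar_prod_self_eq_0[OF assms] that by blast
    then have "Re (v \<bullet>c v) \<noteq> 0" using 1 by auto
    then show ?thesis using 2 by simp
  qed
qed

text \<open>The energy balance of a unitary colligation, with x the state for input h. For w = z it
  gives contractivity in the disc, and unitarity on the circle, where 1 - z cnj z = 0.\<close>

lemma realization_transfer:
  assumes c: "A \<in> carrier_mat n n" "B \<in> carrier_mat n m" "C \<in> carrier_mat m n" "D \<in> carrier_mat m m"
    and u: "unitary_mat (four_block_mat A B C D)"
    and h: "h \<in> carrier_vec n" "k \<in> carrier_vec n" and x: "x \<in> carrier_vec m" "y \<in> carrier_vec m"
    and xe: "x = C *\<^sub>v h + z \<cdot>\<^sub>v (D *\<^sub>v x)" and ye: "y = C *\<^sub>v k + w \<cdot>\<^sub>v (D *\<^sub>v y)"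
  shows "(A *\<^sub>v h + z \<cdot>\<^sub>v (B *\<^sub>v x)) \<bullet>c (A *\<^sub>v k + w \<cdot>\<^sub>v (B *\<^sub>v y)) = h \<bullet>c k - (1 - z * cnj w) * (x \<bullet>c y)"
proof -
  have sm: "M *\<^sub>v (a \<cdot>\<^sub>v v) = a \<cdot>\<^sub>v (M *\<^sub>v v)" if "M \<in> carrier_mat r m" "v \<in> carrier_vec m" for M :: "complex mat" and a v r
    using that by (rule mult_mat_vec)
  have "(A *\<^sub>v h + B *\<^sub>v (z \<cdot>\<^sub>v x)) \<bullet>c (A *\<^sub>v k + B *\<^sub>v (w \<cdot>\<^sub>v y)) + (C *\<^sub>v h + D *\<^sub>v (z \<cdot>\<^sub>v x)) \<bullet>c (C *\<^sub>v k + D *\<^sub>v (w \<cdot>\<^sub>v y))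
      = h \<bullet>c k + (z \<cdot>\<^sub>v x) \<bullet>c (w \<cdot>\<^sub>v y)"
    using h x by (intro unitary_block_isometry[OF c u]) auto
  then show ?thesis
    unfolding sm[OF c(2) x(1)] sm[OF c(2) x(2)] sm[OF c(4) x(1)] sm[OF c(4) x(2)] xe[symmetric] ye[symmetric] cscalar_prod_smult[OF x]
    by (simp add: algebra_simps)
qed

lemma mat_inverse_exists:
  fixes M :: "complex mat"
  assumes M: "M \<in> carrier_mat m m" and d: "det M \<noteq> 0"
  obtains R where "mat_inverse M = Some R" "R \<in> carrier_mat m m" "M * R = 1\<^sub>m m" "R * M = 1\<^sub>m m"
proof (cases "mat_inverse M")
  case None
  from mat_inverse(1)[OF M None, of "()"] det_non_zero_imp_unit[OF M d, of "()"] show ?thesis by blast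
next
  case (Some R)
  from mat_inverse(2)[OF M this] Some show ?thesis using that by blast
qed

lemma Re_defect: "Re ((1 - z * cnj z) * c) = (1 - (norm z)\<^sup>2) * Re c"
proof -
  have "1 - z * cnj z = of_real (1 - (norm z)\<^sup>2)" unfolding of_real_diff complex_norm_square by simp
  then show ?thesis by simp
qed

text \<open>A kernel vector of I - z D is a state for input 0. By the energy balance its output
  would have negative squared norm.\<close>

lemma realization_resolvent_det:
  assumes c: "A \<in> carrier_mat n n" "B \<in> carrier_mat n m" "C \<in> carrier_mat m n" "D \<in> carrier_mat m m"
    and u: "unitary_mat (four_block_mat A B C D)" and z: "norm z < 1"
  shows "det (1\<^sub>m m - z \<cdot>\<^sub>m D) \<noteq> 0"
proof
  assume d: "det (1\<^sub>m m - z \<cdot>\<^sub>m D) = 0"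
  have M: "1\<^sub>m m - z \<cdot>\<^sub>m D \<in> carrier_mat m m" using c by (intro minus_carrier_mat) simp
  obtain x where x: "x \<in> carrier_vec m" "x \<noteq> 0\<^sub>v m" "(1\<^sub>m m - z \<cdot>\<^sub>m D) *\<^sub>v x = 0\<^sub>v m"
    using d det_0_iff_vec_prod_zero[OF M] by blast
  have "(1\<^sub>m m - z \<cdot>\<^sub>m D) *\<^sub>v x = x - z \<cdot>\<^sub>v (D *\<^sub>v x)"
    using c x by (subst minus_mult_distrib_mat_vec[of _ m m]) (auto intro!: eq_vecI)
  then have e: "x - z \<cdot>\<^sub>v (D *\<^sub>v x) = 0\<^sub>v m" using x(3) by simp
  have xe: "x = C *\<^sub>v 0\<^sub>v n + z \<cdot>\<^sub>v (D *\<^sub>v x)"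
  proof (rule eq_vecI)
    fix i assume "i < dim_vec (C *\<^sub>v 0\<^sub>v n + z \<cdot>\<^sub>v (D *\<^sub>v x))"
    then have i: "i < m" using c by simp
    then show "x $ i = (C *\<^sub>v 0\<^sub>v n + z \<cdot>\<^sub>v (D *\<^sub>v x)) $ i"
      using arg_cong[OF e, of "\<lambda>v. v $ i"] c x(1) by simp
  qed (use c x in simp)
  define p where "p = A *\<^sub>v 0\<^sub>v n + z \<cdot>\<^sub>v (B *\<^sub>v x)"
  have p: "p \<in> carrier_vec n" using c x by (simp add: p_def)
  have "p \<bullet>c p = 0\<^sub>v n \<bullet>c 0\<^sub>v n - (1 - z * cnj z) * (x \<bullet>c x)"
    unfolding p_def by (rule realization_transfer[OF c u _ _ x(1) x(1) xe xe]) simp_all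
  also have "(0\<^sub>v n :: complex vec) \<bullet>c 0\<^sub>v n = 0" by (simp add: cscalar_prod_sum[of _ n])
  finally have "Re (p \<bullet>c p) = - ((1 - (norm z)\<^sup>2) * Re (x \<bullet>c x))"
    unfolding Re_defect[symmetric] by simp
  moreover have "(1 - (norm z)\<^sup>2) * Re (x \<bullet>c x) > 0"
    using z cscalar_prod_self_nonneg(3)[OF x(1,2)] by (intro mult_pos_pos) (auto simp: power_less_one_iff)
  ultimately show False using cscalar_prod_self_nonneg(2)[OF p] by simp
qed

lemma rational_inner_contraction:
  assumes "rational_inner n \<Psi>" "norm z < 1" "h \<in> carrier_vec n"
  shows "\<Psi> z \<in> carrier_mat n n" "Re ((\<Psi> z *\<^sub>v h) \<bullet>c (\<Psi> z *\<^sub>v h)) \<le> Re (h \<bullet>c h)"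
proof -
  obtain m A B C D where c: "A \<in> carrier_mat n n" "B \<in> carrier_mat n m" "C \<in> carrier_mat m n" "D \<in> carrier_mat m m"
    and u: "unitary_mat (four_block_mat A B C D)"
    and real: "\<And>z. z \<in> unit_disc \<Longrightarrow> \<exists>R. mat_inverse (1\<^sub>m m - z \<cdot>\<^sub>m D) = Some R \<and> \<Psi> z = A + z \<cdot>\<^sub>m (B * R * C)"
    using assms(1) unfolding rational_inner_def by blast
  obtain R where R: "mat_inverse (1\<^sub>m m - z \<cdot>\<^sub>m D) = Some R" "\<Psi> z = A + z \<cdot>\<^sub>m (B * R * C)"
    using real[of z] assms(2) by auto
  have M: "1\<^sub>m m - z \<cdot>\<^sub>m D \<in> carrier_mat m m" using c by (intro minus_carrier_mat) simp
  have Ri: "(1\<^sub>m m - z \<cdot>\<^sub>m D) * R = 1\<^sub>m m" "R \<in> carrier_mat m m" using mat_inverse(2)[OF M R(1)] by auto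
  show \<Psi>: "\<Psi> z \<in> carrier_mat n n" unfolding R(2) using c Ri by simp
  define x where "x = R *\<^sub>v (C *\<^sub>v h)"
  have Ch: "C *\<^sub>v h \<in> carrier_vec m" using c assms(3) by simp
  have x: "x \<in> carrier_vec m" using Ri Ch by (simp add: x_def)
  have "C *\<^sub>v h = ((1\<^sub>m m - z \<cdot>\<^sub>m D) * R) *\<^sub>v (C *\<^sub>v h)" using Ri(1) Ch by simp
  also have "\<dots> = (1\<^sub>m m - z \<cdot>\<^sub>m D) *\<^sub>v x" unfolding x_def by (rule assoc_mult_mat_vec[OF M Ri(2) Ch])
  also have "\<dots> = x - z \<cdot>\<^sub>v (D *\<^sub>v x)"
    using c x by (subst minus_mult_distrib_mat_vec[of _ m m]) (auto intro!: eq_vecI)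
  finally have xe: "x = C *\<^sub>v h + z \<cdot>\<^sub>v (D *\<^sub>v x)" using c x by (auto intro!: eq_vecI)
  have \<Psi>h: "\<Psi> z *\<^sub>v h = A *\<^sub>v h + z \<cdot>\<^sub>v (B *\<^sub>v x)"
  proof -
    have "\<Psi> z *\<^sub>v h = A *\<^sub>v h + (z \<cdot>\<^sub>m (B * R * C)) *\<^sub>v h"
      unfolding R(2) using c Ri assms(3) by (intro add_mult_distrib_mat_vec) auto
    also have "(z \<cdot>\<^sub>m (B * R * C)) *\<^sub>v h = z \<cdot>\<^sub>v ((B * R * C) *\<^sub>v h)"
      using c Ri assms(3) by (intro eq_vecI) auto
    also have "(B * R * C) *\<^sub>v h = (B * R) *\<^sub>v (C *\<^sub>v h)"
      by (rule assoc_mult_mat_vec[OF mult_carrier_mat[OF c(2) Ri(2)] c(3) assms(3)])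
    also have "\<dots> = B *\<^sub>v x" unfolding x_def by (rule assoc_mult_mat_vec[OF c(2) Ri(2) Ch])
    finally show ?thesis .
  qed
  have "(\<Psi> z *\<^sub>v h) \<bullet>c (\<Psi> z *\<^sub>v h) = h \<bullet>c h - (1 - z * cnj z) * (x \<bullet>c x)"
    unfolding \<Psi>h by (rule realization_transfer[OF c u assms(3,3) x x xe xe])
  then have "Re ((\<Psi> z *\<^sub>v h) \<bullet>c (\<Psi> z *\<^sub>v h)) = Re (h \<bullet>c h) - (1 - (norm z)\<^sup>2) * Re (x \<bullet>c x)"
    unfolding Re_defect[symmetric] by simp
  moreover have "(1 - (norm z)\<^sup>2) * Re (x \<bullet>c x) \<ge> 0"
    using assms(2) cscalar_prod_self_nonneg(2)[OF x] by (intro mult_nonneg_nonneg) (auto simp: power_le_one_iff)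
  ultimately show "Re ((\<Psi> z *\<^sub>v h) \<bullet>c (\<Psi> z *\<^sub>v h)) \<le> Re (h \<bullet>c h)" by simp
qed

lemma poly_eq_on_infinite:
  fixes p r :: "complex poly"
  assumes "infinite S" "\<And>z. z \<in> S \<Longrightarrow> poly p z = poly r z"
  shows "p = r"
proof (rule ccontr)
  assume "p \<noteq> r"
  then have "finite {z. poly (p - r) z = 0}" by (intro poly_roots_finite) simp
  moreover have "S \<subseteq> {z. poly (p - r) z = 0}" using assms(2) by auto
  ultimately show False using assms(1) finite_subset by blast
qed

lemma infinite_disc: "infinite unit_disc"
  using uncountable_ball[of 1 "0::complex"] by (simp add: uncountable_infinite)

lemma mult_mat_unit_vec:
  fixes A :: "complex mat"
  assumes "A \<in> carrier_mat n m" "j < m"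
  shows "A *\<^sub>v unit_vec m j = col A j"
  using assms by (intro eq_vecI) (auto simp: scalar_prod_right_unit)

text \<open>Stated for any right inverse R of I - z D, because on the circle it is applied to one
  built from the adjugate.\<close>

lemma transfer_resolvent:
  fixes A B C D :: "complex mat"
  assumes c: "A \<in> carrier_mat n n" "B \<in> carrier_mat n m" "C \<in> carrier_mat m n" "D \<in> carrier_mat m m"
    and R: "R \<in> carrier_mat m m" "(1\<^sub>m m - z \<cdot>\<^sub>m D) * R = 1\<^sub>m m" and h: "h \<in> carrier_vec n"
  shows "R *\<^sub>v (C *\<^sub>v h) = C *\<^sub>v h + z \<cdot>\<^sub>v (D *\<^sub>v (R *\<^sub>v (C *\<^sub>v h)))"
    "(A + z \<cdot>\<^sub>m (B * R * C)) *\<^sub>v h = A *\<^sub>v h + z \<cdot>\<^sub>v (B *\<^sub>v (R *\<^sub>v (C *\<^sub>v h)))"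
proof -
  have M: "1\<^sub>m m - z \<cdot>\<^sub>m D \<in> carrier_mat m m" using c by (intro minus_carrier_mat) simp
  define x where "x = R *\<^sub>v (C *\<^sub>v h)"
  have Ch: "C *\<^sub>v h \<in> carrier_vec m" using c h by simp
  have x: "x \<in> carrier_vec m" using R Ch by (simp add: x_def)
  have "C *\<^sub>v h = ((1\<^sub>m m - z \<cdot>\<^sub>m D) * R) *\<^sub>v (C *\<^sub>v h)" using R Ch by simp
  also have "\<dots> = (1\<^sub>m m - z \<cdot>\<^sub>m D) *\<^sub>v x" unfolding x_def by (rule assoc_mult_mat_vec[OF M R(1) Ch])
  also have "\<dots> = x - z \<cdot>\<^sub>v (D *\<^sub>v x)"
    using c x by (subst minus_mult_distrib_mat_vec[of _ m m]) (auto intro!: eq_vecI)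
  finally have "x = C *\<^sub>v h + z \<cdot>\<^sub>v (D *\<^sub>v x)" using c x by (auto intro!: eq_vecI)
  then show "R *\<^sub>v (C *\<^sub>v h) = C *\<^sub>v h + z \<cdot>\<^sub>v (D *\<^sub>v (R *\<^sub>v (C *\<^sub>v h)))" unfolding x_def .
  have "(A + z \<cdot>\<^sub>m (B * R * C)) *\<^sub>v h = A *\<^sub>v h + (z \<cdot>\<^sub>m (B * R * C)) *\<^sub>v h"
    using c R h by (intro add_mult_distrib_mat_vec) auto
  also have "(z \<cdot>\<^sub>m (B * R * C)) *\<^sub>v h = z \<cdot>\<^sub>v ((B * R * C) *\<^sub>v h)"
    using c R h by (intro eq_vecI) auto
  also have "(B * R * C) *\<^sub>v h = (B * R) *\<^sub>v (C *\<^sub>v h)"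
    by (rule assoc_mult_mat_vec[OF mult_carrier_mat[OF c(2) R(1)] c(3) h])
  also have "\<dots> = B *\<^sub>v (R *\<^sub>v (C *\<^sub>v h))" by (rule assoc_mult_mat_vec[OF c(2) R(1) Ch])
  finally show "(A + z \<cdot>\<^sub>m (B * R * C)) *\<^sub>v h = A *\<^sub>v h + z \<cdot>\<^sub>v (B *\<^sub>v (R *\<^sub>v (C *\<^sub>v h)))" .
qed

locale lowest_inner =
  fixes n :: nat and \<Psi> :: "complex \<Rightarrow> complex mat" and F :: "complex poly mat" and q :: "complex poly"
  assumes inner: "rational_inner n \<Psi>" and low: "lowest_terms n \<Psi> F q"
begin

lemma n_pos: "n > 0"
  using inner by (simp add: rational_inner_def)

lemma F_carrier: "F \<in> carrier_mat n n"
  using low by (simp add: lowest_terms_def)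

lemma evm_F_carrier: "evm z F \<in> carrier_mat n n"
  using F_carrier by simp

lemma q_neq_0: "q \<noteq> 0"
  using low by (simp add: lowest_terms_def)

lemma \<Psi>_carrier: "norm z < 1 \<Longrightarrow> \<Psi> z \<in> carrier_mat n n" and \<Psi>_eq: "norm z < 1 \<Longrightarrow> poly q z \<cdot>\<^sub>m \<Psi> z = evm z F"
  using low by (auto simp: lowest_terms_def)

text \<open>Contractivity bounds the entries of \<Psi> on the disc; with the denominator multiplied
  out, the bound extends to the closed disc by continuity. A zero of q there is then a zero of every
  entry of F.\<close>

lemma entry_bound:
  assumes ij: "i < n" "j < n" and z: "norm z \<le> 1"
  shows "norm (poly (F $$ (i, j)) z) \<le> norm (poly q z)"
proof -
  have disc: "norm (poly (F $$ (i, j)) z) \<le> norm (poly q z)" if z: "norm z < 1" for z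
  proof -
    let ?h = "unit_vec n j :: complex vec"
    have h: "?h \<in> carrier_vec n" by simp
    have "Re ((\<Psi> z *\<^sub>v ?h) \<bullet>c (\<Psi> z *\<^sub>v ?h)) \<le> Re (?h \<bullet>c ?h)"
      by (rule rational_inner_contraction(2)[OF inner z h])
    moreover have "Re (?h \<bullet>c ?h) = 1" unfolding cscalar_prod_self[OF h] using ij
      by (simp add: unit_vec_def if_distrib[where f = norm] if_distrib[where f = "\<lambda>x. x ^ 2"] sum.delta' cong: if_cong)
    moreover have "Re ((\<Psi> z *\<^sub>v ?h) \<bullet>c (\<Psi> z *\<^sub>v ?h)) = (\<Sum>i<n. (norm (\<Psi> z $$ (i, j)))\<^sup>2)"
      unfolding mult_mat_unit_vec[OF \<Psi>_carrier[OF z] ij(2)] using \<Psi>_carrier[OF z] ij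
      by (subst cscalar_prod_self[of _ n]) (auto intro!: carrier_vecI)
    ultimately have "(\<Sum>i<n. (norm (\<Psi> z $$ (i, j)))\<^sup>2) \<le> 1" by simp
    moreover have "(norm (\<Psi> z $$ (i, j)))\<^sup>2 \<le> (\<Sum>i<n. (norm (\<Psi> z $$ (i, j)))\<^sup>2)"
      using ij by (intro member_le_sum) auto
    ultimately have "(norm (\<Psi> z $$ (i, j)))\<^sup>2 \<le> 1" by simp
    then have "norm (\<Psi> z $$ (i, j)) \<le> 1" by (simp add: power_le_one_iff)
    moreover have "poly (F $$ (i, j)) z = poly q z * \<Psi> z $$ (i, j)"
      using arg_cong[OF \<Psi>_eq[OF z], of "\<lambda>M. M $$ (i, j)"] \<Psi>_carrier[OF z] F_carrier ij by simp
    ultimately show ?thesis by (simp add: norm_mult mult_left_le)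
  qed
  have "closed {z. norm (poly (F $$ (i, j)) z) \<le> norm (poly q z)}"
    by (intro closed_Collect_le continuous_intros)
  moreover have "ball 0 1 \<subseteq> {z. norm (poly (F $$ (i, j)) z) \<le> norm (poly q z)}" using disc by auto
  ultimately have "closure (ball 0 1) \<subseteq> {z. norm (poly (F $$ (i, j)) z) \<le> norm (poly q z)}"
    by (rule closure_minimal[rotated])
  then show ?thesis using z by auto
qed

lemma q_nonzero:
  assumes "norm z \<le> 1"
  shows "poly q z \<noteq> 0"
proof
  assume z0: "poly q z = 0"
  have "[:- z, 1:] dvd q" using z0 poly_eq_0_iff_dvd by blast
  moreover have "[:- z, 1:] dvd F $$ (i, j)" if "i < n" "j < n" for i j
    using entry_bound[OF that assms] z0 poly_eq_0_iff_dvd by auto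
  ultimately have "degree [:- z, 1:] = 0" using low unfolding lowest_terms_def by blast
  then show False by simp
qed

text \<open>The realization is given on the open disc only, and D may have unimodular eigenvalues.
  The adjugate writes it as a rational function with denominator p = det (I - z D), so the energy
  balance applies at the points of the circle where p is nonzero.\<close>

lemma isometry_circle_generic:
  "\<exists>p. p \<noteq> 0 \<and> (\<forall>z h k. norm z = 1 \<longrightarrow> poly p z \<noteq> 0 \<longrightarrow> h \<in> carrier_vec n \<longrightarrow> k \<in> carrier_vec n \<longrightarrow>
    (evm z F *\<^sub>v h) \<bullet>c (evm z F *\<^sub>v k) = poly q z * cnj (poly q z) * (h \<bullet>c k))"
proof -
  obtain m A B C D where c: "A \<in> carrier_mat n n" "B \<in> carrier_mat n m" "C \<in> carrier_mat m n" "D \<in> carrier_mat m m"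
    and u: "unitary_mat (four_block_mat A B C D)"
    and real: "\<And>z. z \<in> unit_disc \<Longrightarrow> \<exists>R. mat_inverse (1\<^sub>m m - z \<cdot>\<^sub>m D) = Some R \<and> \<Psi> z = A + z \<cdot>\<^sub>m (B * R * C)"
    using inner unfolding rational_inner_def by blast
  define cm where "cm = map_mat (\<lambda>c::complex. [:c:])"
  have cm: "cm V \<in> carrier_mat r s" if "V \<in> carrier_mat r s" for V r s using that by (simp add: cm_def)
  have ecm: "evm z (cm V) = V" for z V by (simp add: cm_def evm_const)
  define M where "M = 1\<^sub>m m - [:0, 1:] \<cdot>\<^sub>m cm D"
  have M: "M \<in> carrier_mat m m" unfolding M_def using cm[OF c(4)] by (intro minus_carrier_mat) simp
  have eM: "evm z M = 1\<^sub>m m - z \<cdot>\<^sub>m D" for z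
    by (rule eq_matI) (use c(4) in \<open>auto simp: M_def cm_def\<close>)
  have eMc: "1\<^sub>m m - z \<cdot>\<^sub>m D \<in> carrier_mat m m" for z using c by (intro minus_carrier_mat) simp
  define aM where "aM = adj_mat M"
  have aM: "aM \<in> carrier_mat m m" "M * aM = det M \<cdot>\<^sub>m 1\<^sub>m m" using adj_mat[OF M] by (auto simp: aM_def)
  have eaM: "evm z aM \<in> carrier_mat m m" for z using aM by simp
  define p where "p = det M"
  have MaM: "(1\<^sub>m m - z \<cdot>\<^sub>m D) * evm z aM = poly p z \<cdot>\<^sub>m 1\<^sub>m m" for z
  proof -
    have "evm z (M * aM) = poly p z \<cdot>\<^sub>m evm z (1\<^sub>m m)" unfolding aM(2) p_def evm_smult ..
    moreover have "evm z (1\<^sub>m m) = 1\<^sub>m m" by (rule eq_matI) auto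
    ultimately show ?thesis unfolding evm_mult[OF M aM(1)] eM by simp
  qed
  define R where "R = (\<lambda>z. (1 / poly p z) \<cdot>\<^sub>m evm z aM)"
  have R: "R z \<in> carrier_mat m m" for z using eaM by (simp add: R_def)
  have MR: "(1\<^sub>m m - z \<cdot>\<^sub>m D) * R z = 1\<^sub>m m" if "poly p z \<noteq> 0" for z
    unfolding R_def mult_smult_distrib[OF eMc eaM] MaM using that by (intro eq_matI) auto
  have pz: "poly p z \<noteq> 0" if "norm z < 1" for z
    using realization_resolvent_det[OF c u that] unfolding p_def by (simp add: det_evm[symmetric] eM)
  have p0: "p \<noteq> 0" using pz[of 0] by auto
  define G where "G = p \<cdot>\<^sub>m cm A + [:0, 1:] \<cdot>\<^sub>m (cm B * aM * cm C)"
  have cBaC: "cm B * aM * cm C \<in> carrier_mat n n" using cm[OF c(2)] cm[OF c(3)] aM(1) by simp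
  have G: "G \<in> carrier_mat n n" unfolding G_def using cm[OF c(1)] cBaC by simp
  have eG: "evm z G = poly p z \<cdot>\<^sub>m A + z \<cdot>\<^sub>m (B * evm z aM * C)" for z
  proof -
    have "evm z (cm B * aM * cm C) = B * evm z aM * C"
      using evm_mult[OF mult_carrier_mat[OF cm[OF c(2)] aM(1)] cm[OF c(3)]] evm_mult[OF cm[OF c(2)] aM(1)] by (simp add: ecm)
    moreover have "evm z (X + Y) = evm z X + evm z Y" if "X \<in> carrier_mat n n" "Y \<in> carrier_mat n n" for X Y
      using that by (intro eq_matI) auto
    then have "evm z G = evm z (p \<cdot>\<^sub>m cm A) + evm z ([:0, 1:] \<cdot>\<^sub>m (cm B * aM * cm C))"
      unfolding G_def using cm[OF c(1)] cBaC by simp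
    ultimately show ?thesis unfolding evm_smult ecm by simp
  qed
  have eGR: "evm z G = poly p z \<cdot>\<^sub>m (A + z \<cdot>\<^sub>m (B * R z * C))" if "poly p z \<noteq> 0" for z
  proof -
    have "B * R z * C = (1 / poly p z) \<cdot>\<^sub>m (B * evm z aM * C)"
      unfolding R_def mult_smult_distrib[OF c(2) eaM]
      by (rule mult_smult_assoc_mat[OF mult_carrier_mat[OF c(2) eaM] c(3)])
    moreover have "B * evm z aM * C \<in> carrier_mat n n" using c eaM by simp
    moreover have "k \<cdot>\<^sub>m A + z \<cdot>\<^sub>m P = k \<cdot>\<^sub>m (A + z \<cdot>\<^sub>m ((1 / k) \<cdot>\<^sub>m P))"
      if "P \<in> carrier_mat n n" "k \<noteq> 0" for P and k :: complex
      by (rule eq_matI) (use that c(1) in \<open>simp_all add: distrib_left\<close>)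
    ultimately show ?thesis unfolding eG using that by simp
  qed
  \<comment> \<open>Both F / q and G / p represent \<Psi> on the disc, so the cross products agree
    as polynomials and hence on the circle.\<close>
  have FG: "p * F $$ (i, j) = q * G $$ (i, j)" if ij: "i < n" "j < n" for i j
  proof (rule poly_eq_on_infinite[OF infinite_disc])
    fix z :: complex assume "z \<in> unit_disc"
    then have z: "norm z < 1" by simp
    obtain R' where R': "mat_inverse (1\<^sub>m m - z \<cdot>\<^sub>m D) = Some R'" "\<Psi> z = A + z \<cdot>\<^sub>m (B * R' * C)"
      using real[of z] z by auto
    have i': "R' * (1\<^sub>m m - z \<cdot>\<^sub>m D) = 1\<^sub>m m" "R' \<in> carrier_mat m m" using mat_inverse(2)[OF eMc R'(1)] by auto
    have "R' = R' * ((1\<^sub>m m - z \<cdot>\<^sub>m D) * R z)" unfolding MR[OF pz[OF z]] using i' by simp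
    also have "\<dots> = R' * (1\<^sub>m m - z \<cdot>\<^sub>m D) * R z" by (rule assoc_mult_mat[symmetric, OF i'(2) eMc R])
    also have "\<dots> = R z" unfolding i'(1) using left_mult_one_mat[OF R] by simp
    finally have e: "evm z G = poly p z \<cdot>\<^sub>m \<Psi> z" using eGR[OF pz[OF z]] R'(2) by simp
    have "poly (G $$ (i, j)) z = poly p z * \<Psi> z $$ (i, j)"
      using arg_cong[OF e, of "\<lambda>M. M $$ (i, j)"] G \<Psi>_carrier[OF z] ij by simp
    moreover have "poly (F $$ (i, j)) z = poly q z * \<Psi> z $$ (i, j)"
      using arg_cong[OF \<Psi>_eq[OF z], of "\<lambda>M. M $$ (i, j)"] \<Psi>_carrier[OF z] F_carrier ij by simp
    ultimately show "poly (p * F $$ (i, j)) z = poly (q * G $$ (i, j)) z" by simp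
  qed
  have "(evm z F *\<^sub>v h) \<bullet>c (evm z F *\<^sub>v k) = poly q z * cnj (poly q z) * (h \<bullet>c k)"
    if z: "norm z = 1" "poly p z \<noteq> 0" and hk: "h \<in> carrier_vec n" "k \<in> carrier_vec n" for z h k
  proof -
    define P where "P = A + z \<cdot>\<^sub>m (B * R z * C)"
    have carr: "P \<in> carrier_mat n n" using mult_carrier_mat[OF mult_carrier_mat[OF c(2) R] c(3)] c(1) by (simp add: P_def)
    have "evm z F = poly q z \<cdot>\<^sub>m P"
    proof (rule eq_matI)
      fix i j assume "i < dim_row (poly q z \<cdot>\<^sub>m P)" "j < dim_col (poly q z \<cdot>\<^sub>m P)"
      then have ij: "i < n" "j < n" using carr by auto
      have "poly p z * poly (F $$ (i, j)) z = poly q z * evm z G $$ (i, j)"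
        using arg_cong[OF FG[OF ij], of "\<lambda>p. poly p z"] G ij by simp
      also have "evm z G $$ (i, j) = poly p z * P $$ (i, j)"
        unfolding eGR[OF z(2)] P_def[symmetric] using carr ij by simp
      finally show "evm z F $$ (i, j) = (poly q z \<cdot>\<^sub>m P) $$ (i, j)"
        using z(2) F_carrier carr ij by simp
    qed (use F_carrier carr in auto)
    then have "evm z F = poly q z \<cdot>\<^sub>m (A + z \<cdot>\<^sub>m (B * R z * C))" unfolding P_def .
    moreover note carr[unfolded P_def]
    ultimately have Fv: "evm z F *\<^sub>v v = poly q z \<cdot>\<^sub>v ((A + z \<cdot>\<^sub>m (B * R z * C)) *\<^sub>v v)" if "v \<in> carrier_vec n" for v
      using that by (intro eq_vecI) auto
    define T where "T = (\<lambda>v. (A + z \<cdot>\<^sub>m (B * R z * C)) *\<^sub>v v)"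
    have Tc: "T v \<in> carrier_vec n" if "v \<in> carrier_vec n" for v using carr[unfolded P_def] that by (auto simp: T_def)
    have "T h \<bullet>c T k = h \<bullet>c k - (1 - z * cnj z) * ((R z *\<^sub>v (C *\<^sub>v h)) \<bullet>c (R z *\<^sub>v (C *\<^sub>v k)))"
      unfolding T_def transfer_resolvent(2)[OF c R MR[OF z(2)] hk(1)] transfer_resolvent(2)[OF c R MR[OF z(2)] hk(2)]
      using c R[of z] hk
      by (intro realization_transfer[OF c u] transfer_resolvent(1)[OF c R MR[OF z(2)]]) auto
    also have "1 - z * cnj z = 0" using z(1) by (simp add: complex_norm_square[symmetric])
    finally have "T h \<bullet>c T k = h \<bullet>c k" by simp
    then show ?thesis unfolding Fv[OF hk(1)] Fv[OF hk(2)] T_def[symmetric]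
      using cscalar_prod_smult[OF Tc[OF hk(1)] Tc[OF hk(2)]] by simp
  qed
  then show ?thesis using p0 by blast
qed

text \<open>Unitarity off finitely many points of the circle becomes, through
  \<open>cnj_reflect\<close>, a polynomial identity, and this holds at every nonzero z.\<close>

lemma reflection:
  assumes "z \<noteq> 0" and hk: "h \<in> carrier_vec n" "k \<in> carrier_vec n"
  shows "(evm z F *\<^sub>v h) \<bullet>c (evm (1 / cnj z) F *\<^sub>v k) = poly q z * cnj (poly q (1 / cnj z)) * (h \<bullet>c k)"
proof -
  obtain p where p: "p \<noteq> 0" "\<And>z h k. norm z = 1 \<Longrightarrow> poly p z \<noteq> 0 \<Longrightarrow> h \<in> carrier_vec n \<Longrightarrow> k \<in> carrier_vec n \<Longrightarrow>
    (evm z F *\<^sub>v h) \<bullet>c (evm z F *\<^sub>v k) = poly q z * cnj (poly q z) * (h \<bullet>c k)"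
    using isometry_circle_generic by blast
  define N where "N = degree q + (\<Sum>i<n. \<Sum>j<n. degree (F $$ (i, j)))"
  have dq: "degree q \<le> N" by (simp add: N_def)
  have dF: "degree (F $$ (i, j)) \<le> N" if "i < n" "j < n" for i j
  proof -
    have "degree (F $$ (i, j)) \<le> (\<Sum>j<n. degree (F $$ (i, j)))" using that by (intro member_le_sum) auto
    also have "\<dots> \<le> (\<Sum>i<n. \<Sum>j<n. degree (F $$ (i, j)))"
      using that by (intro member_le_sum[of i "{..<n}" "\<lambda>i. \<Sum>j<n. degree (F $$ (i, j))"]) auto
    finally show ?thesis by (simp add: N_def)
  qed
  have eq: "(\<Sum>i<n. F $$ (i, j) * cnj_reflect N (F $$ (i, l))) = (if j = l then q * cnj_reflect N q else 0)"
    if jl: "j < n" "l < n" for j l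
  proof (rule poly_eq_on_infinite)
    show "infinite (unit_circle - {z. poly p z = 0})" using infinite_unit_circle poly_roots_finite[OF p(1)] by simp
    fix z :: complex assume "z \<in> unit_circle - {z. poly p z = 0}"
    then have z: "norm z = 1" "poly p z \<noteq> 0" by auto
    have z0: "z \<noteq> 0" using z by auto
    have r: "poly (cnj_reflect N g) z = z ^ N * cnj (poly g z)" if "degree g \<le> N" for g
      using poly_cnj_reflect[OF that z0] inverse_cnj_circle[OF z(1)] by simp
    have "(evm z F *\<^sub>v unit_vec n j) \<bullet>c (evm z F *\<^sub>v unit_vec n l) =
        poly q z * cnj (poly q z) * (unit_vec n j \<bullet>c unit_vec n l)"
      by (rule p(2)[OF z]) simp_all
    moreover have "(unit_vec n j :: complex vec) \<bullet>c unit_vec n l = (if j = l then 1 else 0)"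
      using jl by (simp add: cscalar_prod_sum[of _ n] unit_vec_def if_distrib[where f = cnj] if_distrib[where f = "\<lambda>x. _ * x"] sum.delta' cong: if_cong)
    moreover have "(evm z F *\<^sub>v unit_vec n j) \<bullet>c (evm z F *\<^sub>v unit_vec n l) =
        (\<Sum>i<n. poly (F $$ (i, j)) z * cnj (poly (F $$ (i, l)) z))"
      unfolding mult_mat_unit_vec[OF evm_F_carrier jl(1)] mult_mat_unit_vec[OF evm_F_carrier jl(2)]
      using F_carrier jl by (subst cscalar_prod_sum[of _ n]) auto
    ultimately have "(\<Sum>i<n. poly (F $$ (i, j)) z * cnj (poly (F $$ (i, l)) z)) = (if j = l then poly q z * cnj (poly q z) else 0)"
      by simp
    then have "z ^ N * (\<Sum>i<n. poly (F $$ (i, j)) z * cnj (poly (F $$ (i, l)) z)) = (if j = l then poly q z * (z ^ N * cnj (poly q z)) else 0)"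
      by simp
    then show "poly (\<Sum>i<n. F $$ (i, j) * cnj_reflect N (F $$ (i, l))) z = poly (if j = l then q * cnj_reflect N q else 0) z"
      using r[OF dF] r[OF dq] jl by (simp add: poly_sum sum_distrib_left mult_ac)
  qed
  define w where "w = 1 / cnj z"
  have ent: "(\<Sum>i<n. poly (F $$ (i, j)) z * cnj (poly (F $$ (i, l)) w)) = (if j = l then poly q z * cnj (poly q w) else 0)"
    if jl: "j < n" "l < n" for j l
  proof -
    have r: "poly (cnj_reflect N g) z = z ^ N * cnj (poly g w)" if "degree g \<le> N" for g
      using poly_cnj_reflect[OF that assms(1)] by (simp add: w_def)
    have "z ^ N * (\<Sum>i<n. poly (F $$ (i, j)) z * cnj (poly (F $$ (i, l)) w)) = z ^ N * (if j = l then poly q z * cnj (poly q w) else 0)"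
      using arg_cong[OF eq[OF jl], of "\<lambda>p. poly p z"] r[OF dF] r[OF dq] jl
      by (simp add: poly_sum sum_distrib_left mult_ac split: if_splits)
    then show ?thesis using assms(1) by simp
  qed
  have "(evm z F *\<^sub>v h) \<bullet>c (evm w F *\<^sub>v k) =
      (\<Sum>i<n. (\<Sum>j<n. poly (F $$ (i, j)) z * h $ j) * cnj (\<Sum>l<n. poly (F $$ (i, l)) w * k $ l))"
    using F_carrier hk by (subst cscalar_prod_sum[of _ n]) (auto simp: scalar_prod_def lessThan_atLeast0)
  also have "\<dots> = (\<Sum>i<n. \<Sum>j<n. \<Sum>l<n. (h $ j * cnj (k $ l)) * (poly (F $$ (i, j)) z * cnj (poly (F $$ (i, l)) w)))"
    by (simp add: sum_product mult_ac)
  also have "\<dots> = (\<Sum>j<n. \<Sum>i<n. \<Sum>l<n. (h $ j * cnj (k $ l)) * (poly (F $$ (i, j)) z * cnj (poly (F $$ (i, l)) w)))"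
    by (rule sum.swap)
  also have "\<dots> = (\<Sum>j<n. \<Sum>l<n. \<Sum>i<n. (h $ j * cnj (k $ l)) * (poly (F $$ (i, j)) z * cnj (poly (F $$ (i, l)) w)))"
    by (intro sum.cong refl sum.swap)
  also have "\<dots> = (\<Sum>j<n. \<Sum>l<n. (h $ j * cnj (k $ l)) * (if j = l then poly q z * cnj (poly q w) else 0))"
    unfolding sum_distrib_left[symmetric] using ent by (intro sum.cong refl) simp
  also have "\<dots> = (\<Sum>j<n. (h $ j * cnj (k $ j)) * (poly q z * cnj (poly q w)))"
    by (intro sum.cong refl) (simp add: if_distrib[where f = "\<lambda>x. _ * x"] sum.delta' cong: if_cong)
  also have "\<dots> = poly q z * cnj (poly q w) * (h \<bullet>c k)"
    using hk by (simp add: cscalar_prod_sum[of _ n] sum_distrib_left mult_ac)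
  finally show ?thesis by (simp add: w_def)
qed

section \<open>The variety of F / q as an eigenvalue problem\<close>

lemma W_iff_eigen:
  "(z, w) \<in> W_variety n F q \<longleftrightarrow> (\<exists>v\<in>carrier_vec n. v \<noteq> 0\<^sub>v n \<and> evm z F *\<^sub>v v = (w * poly q z) \<cdot>\<^sub>v v)"
proof -
  let ?M = "evm z F - (w * poly q z) \<cdot>\<^sub>m 1\<^sub>m n"
  have M: "?M \<in> carrier_mat n n" by (intro minus_carrier_mat) simp
  have "(?M *\<^sub>v v = 0\<^sub>v n) = (evm z F *\<^sub>v v = (w * poly q z) \<cdot>\<^sub>v v)" if v: "v \<in> carrier_vec n" for v
  proof -
    have "?M *\<^sub>v v = evm z F *\<^sub>v v - (w * poly q z) \<cdot>\<^sub>v v"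
      using evm_F_carrier[of z] v by (subst minus_mult_distrib_mat_vec[of _ n n]) (auto simp: smult_one_mult_vec)
    moreover have Fv: "evm z F *\<^sub>v v \<in> carrier_vec n" using evm_F_carrier v by simp
    moreover have "(a - b = 0\<^sub>v n) = (a = b)" if "a \<in> carrier_vec n" "b \<in> carrier_vec n" for a b :: "complex Matrix.vec"
    proof
      assume e: "a - b = 0\<^sub>v n"
      have "a $ i = b $ i" if "i < n" for i
        using arg_cong[OF e, of "\<lambda>v. v $ i"] that \<open>a \<in> carrier_vec n\<close> \<open>b \<in> carrier_vec n\<close> by simp
      then show "a = b" using that by (intro eq_vecI) auto
    qed (use that in auto)
    ultimately show ?thesis using v by simp
  qed
  then show ?thesis unfolding W_variety_def using det_0_iff_vec_prod_zero[OF M] by auto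
qed

lemma W_disc:
  assumes "(z, w) \<in> W_variety n F q" "norm z < 1"
  shows "norm w \<le> 1"
proof -
  obtain v where v: "v \<in> carrier_vec n" "v \<noteq> 0\<^sub>v n" "evm z F *\<^sub>v v = (w * poly q z) \<cdot>\<^sub>v v"
    using assms(1) W_iff_eigen by blast
  have qz: "poly q z \<noteq> 0" using q_nonzero assms(2) by simp
  have "poly q z \<cdot>\<^sub>v (\<Psi> z *\<^sub>v v) = evm z F *\<^sub>v v"
    unfolding \<Psi>_eq[OF assms(2), symmetric] using \<Psi>_carrier[OF assms(2)] v(1) by (intro eq_vecI) auto
  then have e: "poly q z \<cdot>\<^sub>v (\<Psi> z *\<^sub>v v) = (w * poly q z) \<cdot>\<^sub>v v" using v(3) by simp
  have "\<Psi> z *\<^sub>v v = w \<cdot>\<^sub>v v"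
  proof (rule eq_vecI)
    fix i assume "i < dim_vec (w \<cdot>\<^sub>v v)"
    then have i: "i < n" using v(1) by simp
    then show "(\<Psi> z *\<^sub>v v) $ i = (w \<cdot>\<^sub>v v) $ i"
      using arg_cong[OF e, of "\<lambda>x. x $ i"] qz v(1) \<Psi>_carrier[OF assms(2)] by simp
  qed (use \<Psi>_carrier[OF assms(2)] v in auto)
  then have "Re ((w \<cdot>\<^sub>v v) \<bullet>c (w \<cdot>\<^sub>v v)) \<le> Re (v \<bullet>c v)"
    using rational_inner_contraction(2)[OF inner assms(2) v(1)] by simp
  then have "(norm w)\<^sup>2 * Re (v \<bullet>c v) \<le> 1 * Re (v \<bullet>c v)"
    unfolding cscalar_prod_smult[OF v(1) v(1)] complex_norm_square[symmetric] by (simp flip: of_real_power)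
  then have "(norm w)\<^sup>2 \<le> 1" using cscalar_prod_self_nonneg(3)[OF v(1,2)] by (simp only: mult_le_cancel_right_pos)
  then show ?thesis by (simp add: power_le_one_iff)
qed

lemma W_circle:
  assumes "(z, w) \<in> W_variety n F q" "norm z = 1"
  shows "norm w = 1"
proof -
  obtain v where v: "v \<in> carrier_vec n" "v \<noteq> 0\<^sub>v n" "evm z F *\<^sub>v v = (w * poly q z) \<cdot>\<^sub>v v"
    using assms(1) W_iff_eigen by blast
  have z0: "z \<noteq> 0" using assms(2) by auto
  have qz: "poly q z * cnj (poly q z) \<noteq> 0" using q_nonzero[of z] assms(2) by simp
  have "(evm z F *\<^sub>v v) \<bullet>c (evm z F *\<^sub>v v) = poly q z * cnj (poly q z) * (v \<bullet>c v)"
    using reflection[OF z0 v(1) v(1)] inverse_cnj_circle[OF assms(2)] by simp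
  then have "(poly q z * cnj (poly q z)) * ((w * cnj w) * (v \<bullet>c v)) = (poly q z * cnj (poly q z)) * (v \<bullet>c v)"
    unfolding v(3) cscalar_prod_smult[OF v(1) v(1)] by (simp add: mult_ac)
  then have "(w * cnj w) * (v \<bullet>c v) = 1 * (v \<bullet>c v)" using qz by simp
  moreover have "v \<bullet>c v \<noteq> 0" using cscalar_prod_self_eq_0[OF v(1)] v(2) by blast
  ultimately have "w * cnj w = 1" by simp
  then have "(norm w)\<^sup>2 = 1" unfolding complex_norm_square[symmetric] by (metis of_real_1 of_real_eq_iff)
  then show ?thesis using norm_ge_zero[of w] by (auto simp: power2_eq_1_iff)
qed

text \<open>With y = 1 / cnj z, the identity \<open>reflection\<close> makes the eigenvector v of
  F(z) orthogonal to the range of F(y) - (q(y) / cnj w) I, which is therefore not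
  invertible.\<close>

lemma W_reflect:
  assumes W: "(z, w) \<in> W_variety n F q" and z: "z \<noteq> 0" and q: "poly q z \<noteq> 0" "poly q (1 / cnj z) \<noteq> 0"
  shows "w \<noteq> 0" "(1 / cnj z, 1 / cnj w) \<in> W_variety n F q"
proof -
  obtain v where v: "v \<in> carrier_vec n" "v \<noteq> 0\<^sub>v n" "evm z F *\<^sub>v v = (w * poly q z) \<cdot>\<^sub>v v"
    using W W_iff_eigen by blast
  define y where "y = 1 / cnj z"
  have vv: "v \<bullet>c v \<noteq> 0" using cscalar_prod_self_eq_0[OF v(1)] v(2) by blast
  have eq: "w * (v \<bullet>c (evm y F *\<^sub>v k)) = cnj (poly q y) * (v \<bullet>c k)" if k: "k \<in> carrier_vec n" for k
  proof -
    have Fk: "evm y F *\<^sub>v k \<in> carrier_vec n" using evm_F_carrier k by simp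
    have "(evm z F *\<^sub>v v) \<bullet>c (evm y F *\<^sub>v k) = poly q z * cnj (poly q y) * (v \<bullet>c k)"
      using reflection[OF z v(1) k] by (simp add: y_def)
    moreover have "(evm z F *\<^sub>v v) \<bullet>c (evm y F *\<^sub>v k) = w * poly q z * (v \<bullet>c (evm y F *\<^sub>v k))"
      unfolding v(3) using cscalar_prod_smult[OF v(1) Fk, of "w * poly q z" 1] by simp
    ultimately have "poly q z * (w * (v \<bullet>c (evm y F *\<^sub>v k))) = poly q z * (cnj (poly q y) * (v \<bullet>c k))"
      by (simp add: mult_ac)
    then show ?thesis using q(1) by simp
  qed
  show w: "w \<noteq> 0"
  proof
    assume "w = 0"
    then show False using eq[OF v(1)] q(2) vv by (simp add: y_def)
  qed
  let ?M = "evm y F - (1 / cnj w * poly q y) \<cdot>\<^sub>m 1\<^sub>m n"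
  have M: "?M \<in> carrier_mat n n" by (intro minus_carrier_mat) simp
  have orth: "v \<bullet>c (?M *\<^sub>v k) = 0" if k: "k \<in> carrier_vec n" for k
  proof -
    have Fk: "evm y F *\<^sub>v k \<in> carrier_vec n" using evm_F_carrier k by simp
    have "?M *\<^sub>v k = evm y F *\<^sub>v k - (1 / cnj w * poly q y) \<cdot>\<^sub>v k"
      using evm_F_carrier[of y] k by (subst minus_mult_distrib_mat_vec[of _ n n]) (auto simp: smult_one_mult_vec)
    moreover have "v \<bullet>c (a - b) = v \<bullet>c a - v \<bullet>c b" if "a \<in> carrier_vec n" "b \<in> carrier_vec n" for a b
      using that v(1) by (simp add: cscalar_prod_sum[of _ n] right_diff_distrib sum_subtractf)
    ultimately have "v \<bullet>c (?M *\<^sub>v k) = v \<bullet>c (evm y F *\<^sub>v k) - cnj (1 / cnj w * poly q y) * (v \<bullet>c k)"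
      using Fk k cscalar_prod_smult[OF v(1) k, of 1 "1 / cnj w * poly q y"] by simp
    also have "w * \<dots> = 0" using eq[OF k] w by (simp add: field_simps)
    finally show ?thesis using w by simp
  qed
  have "det ?M = 0"
  proof (rule ccontr)
    assume "det ?M \<noteq> 0"
    then obtain R where R: "R \<in> carrier_mat n n" "?M * R = 1\<^sub>m n" using mat_inverse_exists[OF M] by metis
    have "?M *\<^sub>v (R *\<^sub>v v) = (?M * R) *\<^sub>v v" using assoc_mult_mat_vec[OF M R(1) v(1)] by simp
    also have "\<dots> = v" unfolding R(2) using v(1) by simp
    finally have "v \<bullet>c v = 0" using orth[of "R *\<^sub>v v"] R(1) v(1) by simp
    then show False using vv by simp
  qed
  then show "(1 / cnj z, 1 / cnj w) \<in> W_variety n F q" unfolding W_variety_def y_def by simp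
qed

lemma W_eigen_matrix:
  assumes "poly q z \<noteq> 0"
  shows "(z, w) \<in> W_variety n F q \<longleftrightarrow> w \<in> spectrum ((1 / poly q z) \<cdot>\<^sub>m evm z F)"
proof -
  let ?A = "(1 / poly q z) \<cdot>\<^sub>m evm z F"
  have "(evm z F *\<^sub>v v = (w * poly q z) \<cdot>\<^sub>v v) = (?A *\<^sub>v v = w \<cdot>\<^sub>v v)" if v: "v \<in> carrier_vec n" for v
  proof -
    have A: "?A *\<^sub>v v = (1 / poly q z) \<cdot>\<^sub>v (evm z F *\<^sub>v v)" using v F_carrier by (intro eq_vecI) auto
    show ?thesis
    proof
      assume "evm z F *\<^sub>v v = (w * poly q z) \<cdot>\<^sub>v v"
      then show "?A *\<^sub>v v = w \<cdot>\<^sub>v v" unfolding A using assms by (simp add: smult_smult_assoc)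
    next
      assume "?A *\<^sub>v v = w \<cdot>\<^sub>v v"
      then have "poly q z \<cdot>\<^sub>v ((1 / poly q z) \<cdot>\<^sub>v (evm z F *\<^sub>v v)) = poly q z \<cdot>\<^sub>v (w \<cdot>\<^sub>v v)" unfolding A by simp
      then show "evm z F *\<^sub>v v = (w * poly q z) \<cdot>\<^sub>v v" using assms by (simp add: smult_smult_assoc mult.commute)
    qed
  qed
  then show ?thesis
    unfolding W_iff_eigen spectrum_def eigenvalue_def eigenvector_def using F_carrier by auto
qed

lemma W_nonempty:
  assumes "poly q z \<noteq> 0"
  shows "\<exists>w. (z, w) \<in> W_variety n F q"
  using spectrum_non_empty[of "(1 / poly q z) \<cdot>\<^sub>m evm z F" n] n_pos F_carrier W_eigen_matrix[OF assms] by auto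

lemma W_finite:
  assumes "poly q z \<noteq> 0"
  shows "finite {w. (z, w) \<in> W_variety n F q}"
  unfolding W_eigen_matrix[OF assms] using card_finite_spectrum(1)[of "(1 / poly q z) \<cdot>\<^sub>m evm z F" n] F_carrier by simp

lemma ev_det_poly: "ev (det_poly n F q) z w = det (evm z F - (w * poly q z) \<cdot>\<^sub>m 1\<^sub>m n)"
proof -
  interpret h: comm_ring_hom "\<lambda>p::complex poly poly. ev p z w" by unfold_locales auto
  have "ev (det_poly n F q) z w = det (map_mat (\<lambda>p. ev p z w) (map_mat (\<lambda>f. [:f:]) F - [:0, q:] \<cdot>\<^sub>m 1\<^sub>m n))"
    unfolding det_poly_def by (rule h.hom_det[symmetric])
  also have "map_mat (\<lambda>p. ev p z w) (map_mat (\<lambda>f. [:f:]) F - [:0, q:] \<cdot>\<^sub>m 1\<^sub>m n) = evm z F - (w * poly q z) \<cdot>\<^sub>m 1\<^sub>m n"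
    by (rule eq_matI) (use F_carrier in auto)
  finally show ?thesis .
qed

lemma W_eq: "W_variety n F q = zero_set (det_poly n F q)"
  by (auto simp: W_variety_def ev_det_poly)

section \<open>The polynomial left after dividing out the zeros of q\<close>

abbreviation "\<xi> \<equiv> xi_poly n F q"

lemma det_poly_nonzero: "det_poly n F q \<noteq> 0"
proof
  assume "det_poly n F q = 0"
  then have "{w. (0, w) \<in> W_variety n F q} = UNIV" unfolding W_eq by auto
  then show False using W_finite[of 0] q_nonzero[of 0] infinite_UNIV_char_0[where 'a = complex] by simp
qed

lemma ev_pole_part: "ev (pole_part n F q) z w = 0 \<longleftrightarrow>
    (poly q z = 0 \<and> multiplicity [:[:- z, 1:]:] (det_poly n F q) > 0)"
proof -
  have "finite {\<alpha>. poly q \<alpha> = 0}" using q_neq_0 by (rule poly_roots_finite)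
  then have "ev (pole_part n F q) z w = 0 \<longleftrightarrow> (\<exists>\<alpha>\<in>{\<alpha>. poly q \<alpha> = 0}. ev ([:[:- \<alpha>, 1:]:] ^ multiplicity [:[:- \<alpha>, 1:]:] (det_poly n F q)) z w = 0)"
    unfolding pole_part_def ev_prod by (rule prod_zero_iff)
  also have "\<dots> \<longleftrightarrow> (\<exists>\<alpha>. poly q \<alpha> = 0 \<and> z = \<alpha> \<and> multiplicity [:[:- \<alpha>, 1:]:] (det_poly n F q) > 0)"
    by auto
  finally show ?thesis by auto
qed

lemma ev_det_poly_factor: "ev (det_poly n F q) z w = ev (pole_part n F q) z w * ev \<xi> z w"
  using arg_cong[OF det_poly_eq[OF q_neq_0, of n F], of "\<lambda>p. ev p z w"] by simp

lemma W_xi_regular: "poly q z \<noteq> 0 \<Longrightarrow> (z, w) \<in> zero_set \<xi> \<longleftrightarrow> (z, w) \<in> W_variety n F q"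
  unfolding W_eq mem_zero_set ev_det_poly_factor using ev_pole_part by auto

lemma xi_nonzero: "\<xi> \<noteq> 0"
  using det_poly_nonzero det_poly_eq[OF q_neq_0, of n F] by auto

text \<open>At a zero of q this is the maximality of the exponent divided out. It makes continuity
  of the roots in w available over the zeros of q.\<close>

lemma slice_xi_nonzero: "slice z \<xi> \<noteq> 0"
proof
  assume s: "slice z \<xi> = 0"
  then have zero: "ev \<xi> z w = 0" for w using poly_slice[of z \<xi> w] by simp
  show False
  proof (cases "poly q z = 0")
    case False
    then have "{w. (z, w) \<in> W_variety n F q} = UNIV" using W_xi_regular[OF False] zero by auto
    then show False using W_finite[OF False] infinite_UNIV_char_0[where 'a = complex] by simp
  next
    case True
    let ?a = "[:[:- z, 1:]:]" and ?P = "det_poly n F q"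
    have "[:- z, 1:] dvd coeff \<xi> k" for k
      using arg_cong[OF s, of "\<lambda>p. coeff p k"] unfolding poly_eq_0_iff_dvd[symmetric] by simp
    then have "?a dvd \<xi>" by (simp add: const_poly_dvd_iff)
    moreover have "?a ^ multiplicity ?a ?P dvd pole_part n F q"
      unfolding pole_part_def using True poly_roots_finite[OF q_neq_0] by (intro dvd_prodI) auto
    ultimately have "?a ^ multiplicity ?a ?P * ?a dvd ?P"
      unfolding det_poly_eq[OF q_neq_0, of n F] by (rule mult_dvd_mono[rotated])
    then have "?a ^ Suc (multiplicity ?a ?P) dvd ?P" by (simp only: power_Suc2)
    moreover have "\<not> is_unit ?a" by (simp add: is_unit_const_poly_iff is_unit_pCons_iff)
    ultimately have "Suc (multiplicity ?a ?P) \<le> multiplicity ?a ?P"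
      using det_poly_nonzero by (intro multiplicity_geI) 
    then show False by simp
  qed
qed

end

section \<open>The numerical radius of a contraction\<close>

text \<open>Vectors are encoded as functions supported below n, so that compactness comes from the
  product topology.\<close>

lemma compact_unit_vectors:
  "compact {x :: nat \<Rightarrow> complex. (\<forall>i\<ge>n. x i = 0) \<and> (\<Sum>i<n. (norm (x i))\<^sup>2) = 1}" (is "compact ?S")
proof -
  define P where "P = (\<lambda>i. if i < n then cball 0 1 else {0 :: complex})"
  have "compactin (product_topology (\<lambda>i. euclidean) UNIV) (PiE UNIV P)"
    by (subst compactin_PiE) (auto simp: P_def)
  then have c: "compact (PiE UNIV P)" by (simp add: euclidean_product_topology)
  have "?S = PiE UNIV P \<inter> {x. (\<Sum>i<n. (norm (x i))\<^sup>2) = 1}"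
  proof (intro Set.set_eqI iffI)
    fix x assume x: "x \<in> ?S"
    have "norm (x i) \<le> 1" if "i < n" for i
    proof -
      have "(norm (x i))\<^sup>2 \<le> (\<Sum>i<n. (norm (x i))\<^sup>2)" using that by (intro member_le_sum) auto
      then show ?thesis using x by (simp add: power_le_one_iff)
    qed
    then show "x \<in> PiE UNIV P \<inter> {x. (\<Sum>i<n. (norm (x i))\<^sup>2) = 1}" using x by (auto simp: P_def)
  next
    fix x assume x: "x \<in> PiE UNIV P \<inter> {x. (\<Sum>i<n. (norm (x i))\<^sup>2) = 1}"
    then have "x i = 0" if "i \<ge> n" for i using that by (auto simp: P_def PiE_iff dest!: spec[of _ i])
    then show "x \<in> ?S" using x by auto
  qed
  moreover have "closed {x :: nat \<Rightarrow> complex. (\<Sum>i<n. (norm (x i))\<^sup>2) = 1}"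
    by (intro closed_Collect_eq continuous_intros continuous_on_product_coordinates)
  ultimately show ?thesis using c by (simp add: compact_Int_closed)
qed

text \<open>The defect in the squared inequality is the squared norm of the component of u
  orthogonal to v.\<close>

lemma Cauchy_Schwarz_equality:
  fixes u v :: "complex Matrix.vec"
  assumes u: "u \<in> carrier_vec n" and v: "v \<in> carrier_vec n" and vv: "v \<bullet>c v = 1"
  shows "norm (u \<bullet>c v) \<le> sqrt (Re (u \<bullet>c u))"
    "norm (u \<bullet>c v) = sqrt (Re (u \<bullet>c u)) \<Longrightarrow> u = (u \<bullet>c v) \<cdot>\<^sub>v v"
proof -
  define c where "c = u \<bullet>c v"
  define d where "d = u - c \<cdot>\<^sub>v v"
  have d: "d \<in> carrier_vec n" using u v by (simp add: d_def)
  have idx: "d $ i = u $ i - c * v $ i" if "i < n" for i using that u v by (simp add: d_def)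
  have "d \<bullet>c d = u \<bullet>c u - cnj c * (u \<bullet>c v) - c * (v \<bullet>c u) + c * cnj c * (v \<bullet>c v)"
    using u v d by (simp add: idx cscalar_prod_sum[of _ n] sum_distrib_left algebra_simps sum_subtractf sum.distrib)
  also have "v \<bullet>c u = cnj c" using cscalar_prod_cnj[OF u v] by (simp add: c_def)
  finally have "d \<bullet>c d = u \<bullet>c u - c * cnj c" using vv by (simp add: c_def[symmetric])
  then have dd: "Re (d \<bullet>c d) = Re (u \<bullet>c u) - (norm c)\<^sup>2" unfolding complex_norm_square[symmetric] by simp
  have "(norm c)\<^sup>2 \<le> Re (u \<bullet>c u)" using dd cscalar_prod_self_nonneg(2)[OF d] by simp
  then show "norm (u \<bullet>c v) \<le> sqrt (Re (u \<bullet>c u))" unfolding c_def by (rule real_le_rsqrt)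
  assume "norm (u \<bullet>c v) = sqrt (Re (u \<bullet>c u))"
  then have "(norm c)\<^sup>2 = Re (u \<bullet>c u)" using cscalar_prod_self_nonneg(2)[OF u] by (simp add: c_def)
  then have "Re (d \<bullet>c d) = 0" using dd by simp
  then have "d = 0\<^sub>v n" using cscalar_prod_self_nonneg(3)[OF d] by (metis less_irrefl)
  then have "u $ i = (c \<cdot>\<^sub>v v) $ i" if "i < n" for i using idx[OF that] that v by simp
  then show "u = (u \<bullet>c v) \<cdot>\<^sub>v v" unfolding c_def[symmetric] using u v by (intro eq_vecI) auto
qed

text \<open>By compactness the supremum is attained at some unit vector h. If it is 1, both
  inequalities in |<Ah, h>| <= |Ah| <= 1 are equalities, and equality in Cauchy-Schwarz makes h an
  eigenvector with a unimodular eigenvalue.\<close>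

lemma numerical_radius_less_1_iff:
  assumes A: "A \<in> carrier_mat n n" and n: "n > 0"
    and contr: "\<And>h. h \<in> carrier_vec n \<Longrightarrow> Re ((A *\<^sub>v h) \<bullet>c (A *\<^sub>v h)) \<le> Re (h \<bullet>c h)"
  shows "numerical_radius A < 1 \<longleftrightarrow>
    \<not> (\<exists>w v. norm w = 1 \<and> v \<in> carrier_vec n \<and> v \<noteq> 0\<^sub>v n \<and> A *\<^sub>v v = w \<cdot>\<^sub>v v)"
proof -
  define V where "V = {cmod ((A *\<^sub>v h) \<bullet>c h) | h. h \<in> carrier_vec n \<and> h \<bullet>c h = 1}"
  have nr: "numerical_radius A = Sup V" using A by (simp add: numerical_radius_def V_def)
  have le1: "sqrt (Re ((A *\<^sub>v h) \<bullet>c (A *\<^sub>v h))) \<le> 1" if "h \<in> carrier_vec n" "h \<bullet>c h = 1" for h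
    using contr[OF that(1)] that(2) by simp
  have Vle: "x \<le> 1" if "x \<in> V" for x
  proof -
    obtain h where h: "x = cmod ((A *\<^sub>v h) \<bullet>c h)" "h \<in> carrier_vec n" "h \<bullet>c h = 1" using \<open>x \<in> V\<close> by (auto simp: V_def)
    have "A *\<^sub>v h \<in> carrier_vec n" using A h by simp
    from order_trans[OF Cauchy_Schwarz_equality(1)[OF this h(2,3)] le1[OF h(2,3)]] h(1) show ?thesis by simp
  qed
  define S where "S = {x :: nat \<Rightarrow> complex. (\<forall>i\<ge>n. x i = 0) \<and> (\<Sum>i<n. (norm (x i))\<^sup>2) = 1}"
  define f where "f = (\<lambda>x :: nat \<Rightarrow> complex. cmod (\<Sum>i<n. (\<Sum>j<n. A $$ (i, j) * x j) * cnj (x i)))"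
  have fV: "cmod ((A *\<^sub>v vec n x) \<bullet>c vec n x) = f x" for x
    using A by (simp add: f_def cscalar_prod_sum[of _ n] scalar_prod_def lessThan_atLeast0)
  have unitx: "vec n x \<bullet>c vec n x = 1 \<longleftrightarrow> (\<Sum>i<n. (norm (x i))\<^sup>2) = 1" for x :: "nat \<Rightarrow> complex"
    unfolding cscalar_prod_self[OF vec_carrier] by (metis (no_types, lifting) index_vec lessThan_iff of_real_1 of_real_eq_iff sum.cong)
  have "(\<lambda>i. if i = 0 then 1 else 0) \<in> S"
    using n by (auto simp: S_def if_distrib[where f = norm] if_distrib[where f = "\<lambda>x. x ^ 2"] sum.delta' cong: if_cong)
  then have "S \<noteq> {}" by blast
  moreover have "compact S" unfolding S_def by (rule compact_unit_vectors)
  moreover have "continuous_on S f" unfolding f_def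
    by (intro continuous_intros continuous_on_subset[OF continuous_on_product_coordinates]) auto
  ultimately obtain x0 where x0: "x0 \<in> S" "\<And>x. x \<in> S \<Longrightarrow> f x \<le> f x0"
    using continuous_attains_sup[of S f] by blast
  define h0 where "h0 = vec n x0"
  have h0: "h0 \<in> carrier_vec n" "h0 \<bullet>c h0 = 1" using x0(1) unitx[of x0] by (simp_all add: h0_def S_def)
  have f0V: "f x0 \<in> V" unfolding V_def using h0 fV[of x0] by (auto simp: h0_def intro!: exI[of _ h0])
  have max: "y \<le> f x0" if y: "y \<in> V" for y
  proof -
    obtain h where h: "y = cmod ((A *\<^sub>v h) \<bullet>c h)" "h \<in> carrier_vec n" "h \<bullet>c h = 1" using y by (auto simp: V_def)
    define x where "x = (\<lambda>i. if i < n then h $ i else 0)"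
    have hx: "h = vec n x" using h(2) by (intro eq_vecI) (auto simp: x_def)
    have "x \<in> S" using h(3) unitx[of x] unfolding hx by (simp add: S_def x_def)
    from x0(2)[OF this] show ?thesis using h(1) fV[of x] unfolding hx by simp
  qed
  have sup: "Sup V = f x0" by (rule cSup_eq_maximum[OF f0V max])
  show ?thesis
  proof
    assume "numerical_radius A < 1"
    show "\<not> (\<exists>w v. norm w = 1 \<and> v \<in> carrier_vec n \<and> v \<noteq> 0\<^sub>v n \<and> A *\<^sub>v v = w \<cdot>\<^sub>v v)"
    proof
      assume "\<exists>w v. norm w = 1 \<and> v \<in> carrier_vec n \<and> v \<noteq> 0\<^sub>v n \<and> A *\<^sub>v v = w \<cdot>\<^sub>v v"
      then obtain w v where wv: "norm w = 1" "v \<in> carrier_vec n" "v \<noteq> 0\<^sub>v n" "A *\<^sub>v v = w \<cdot>\<^sub>v v" by blast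
      define s where "s = Re (v \<bullet>c v)"
      have s: "s > 0" "v \<bullet>c v = of_real s"
        using cscalar_prod_self_nonneg[OF wv(2)] wv(3) by (auto simp: s_def)
      define h where "h = (1 / of_real (sqrt s)) \<cdot>\<^sub>v v"
      have h: "h \<in> carrier_vec n" using wv(2) by (simp add: h_def)
      have sq: "of_real (sqrt s) * of_real (sqrt s) = (of_real s :: complex)" using s(1) by (simp flip: of_real_mult)
      have hh: "h \<bullet>c h = 1" unfolding h_def cscalar_prod_smult[OF wv(2) wv(2)] s(2) using s(1) sq by (simp add: field_simps)
      have "A *\<^sub>v h = w \<cdot>\<^sub>v h"
        unfolding h_def mult_mat_vec[OF A wv(2)] wv(4) by (simp add: smult_smult_assoc mult.commute)
      then have "(A *\<^sub>v h) \<bullet>c h = w"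
        using cscalar_prod_smult[OF h h, of w 1] hh by simp
      then have "1 \<in> V" unfolding V_def using h hh wv(1) by (auto intro!: exI[of _ h])
      then show False using max[of 1] sup nr \<open>numerical_radius A < 1\<close> by simp
    qed
  next
    assume no: "\<not> (\<exists>w v. norm w = 1 \<and> v \<in> carrier_vec n \<and> v \<noteq> 0\<^sub>v n \<and> A *\<^sub>v v = w \<cdot>\<^sub>v v)"
    have "f x0 \<noteq> 1"
    proof
      assume "f x0 = 1"
      then have e: "cmod ((A *\<^sub>v h0) \<bullet>c h0) = 1" using fV[of x0] by (simp add: h0_def)
      have Ah: "A *\<^sub>v h0 \<in> carrier_vec n" using A h0 by simp
      have "sqrt (Re ((A *\<^sub>v h0) \<bullet>c (A *\<^sub>v h0))) = 1"
        using Cauchy_Schwarz_equality(1)[OF Ah h0] le1[OF h0] unfolding e by (rule order.antisym[rotated])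
      then have "A *\<^sub>v h0 = ((A *\<^sub>v h0) \<bullet>c h0) \<cdot>\<^sub>v h0"
        using e by (intro Cauchy_Schwarz_equality(2)[OF Ah h0]) simp
      moreover have "h0 \<noteq> 0\<^sub>v n"
      proof
        assume "h0 = 0\<^sub>v n"
        then show False using h0(2) by (simp add: cscalar_prod_sum[of _ n])
      qed
      ultimately show False using no e h0(1) by blast
    qed
    then have "f x0 < 1" using Vle[OF f0V] by simp
    then show "numerical_radius A < 1" unfolding nr sup .
  qed
qed

section \<open>Distinguished varieties of rational inner functions\<close>

context lowest_inner
begin

lemma W_disc_eigen:
  assumes z: "norm z < 1"
  shows "(z, w) \<in> W_variety n F q \<longleftrightarrow> (\<exists>v. v \<in> carrier_vec n \<and> v \<noteq> 0\<^sub>v n \<and> \<Psi> z *\<^sub>v v = w \<cdot>\<^sub>v v)"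
proof -
  have qz: "poly q z \<noteq> 0" using q_nonzero z by simp
  have "(1 / poly q z) \<cdot>\<^sub>m evm z F = \<Psi> z"
    unfolding \<Psi>_eq[OF z, symmetric] using \<Psi>_carrier[OF z] qz by (intro eq_matI) auto
  then show ?thesis
    using W_eigen_matrix[OF qz] \<Psi>_carrier[OF z] by (auto simp: spectrum_def eigenvalue_def eigenvector_def)
qed

text \<open>The condition to which each of the four equivalent statements is reduced.\<close>

definition strict :: bool where
  "strict \<longleftrightarrow> (\<forall>z w. norm z < 1 \<longrightarrow> (z, w) \<in> W_variety n F q \<longrightarrow> norm w < 1)"

lemma strict_iff_numerical_radius:
  "strict \<longleftrightarrow> (\<forall>z\<in>unit_disc. numerical_radius (\<Psi> z) < 1)"
proof -
  have "numerical_radius (\<Psi> z) < 1 \<longleftrightarrow> (\<forall>w. (z, w) \<in> W_variety n F q \<longrightarrow> norm w < 1)" if z: "norm z < 1" for z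
  proof -
    have "numerical_radius (\<Psi> z) < 1 \<longleftrightarrow> \<not> (\<exists>w. norm w = 1 \<and> (z, w) \<in> W_variety n F q)"
      unfolding W_disc_eigen[OF z]
      using numerical_radius_less_1_iff[OF \<Psi>_carrier[OF z] n_pos rational_inner_contraction(2)[OF inner z]] by blast
    then show ?thesis using W_disc[OF _ z] by (metis order_less_le)
  qed
  then show ?thesis unfolding strict_def by (auto simp: dist_norm)
qed

text \<open>Stated for any V that agrees with the variety of F / q over the closed disc, so as to
  cover both that variety and the zero set of \<xi>.\<close>

lemma strict_iff_distinguished:
  assumes V: "\<And>z w. norm z \<le> 1 \<Longrightarrow> (z, w) \<in> V \<longleftrightarrow> (z, w) \<in> W_variety n F q" and "V = zero_set p"
  shows "distinguished_variety V \<longleftrightarrow> strict"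
proof
  assume dv: "distinguished_variety V"
  show strict unfolding strict_def
  proof (intro allI impI)
    fix z w assume z: "norm z < 1" "(z, w) \<in> W_variety n F q"
    have "norm w \<noteq> 1"
    proof
      assume "norm w = 1"
      then have "(z, w) \<in> V \<inter> frontier bidisc" using z V by (auto simp: frontier_bidisc)
      then have "(z, w) \<in> torus" using dv unfolding distinguished_variety_def by blast
      then show False using z by simp
    qed
    then show "norm w < 1" using W_disc[OF z(2,1)] by simp
  qed
next
  assume strict
  then have s: "norm z < 1 \<Longrightarrow> (z, w) \<in> V \<Longrightarrow> norm w < 1" for z w using V by (auto simp: strict_def)
  \<comment> \<open>A matrix has an eigenvalue, so the fibre over 0 provides a point of the
    bidisc.\<close>
  obtain w where "(0, w) \<in> W_variety n F q" using W_nonempty[of 0] q_nonzero[of 0] by auto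
  then have "(0, w) \<in> V \<inter> bidisc" using V s[of 0 w] by auto
  moreover have "V \<inter> frontier bidisc = V \<inter> torus"
  proof (intro Set.set_eqI iffI)
    fix x assume x: "x \<in> V \<inter> frontier bidisc"
    obtain z w where zw: "x = (z, w)" by (cases x)
    have "norm z = 1"
    proof (rule ccontr)
      assume "norm z \<noteq> 1"
      then show False using x s[of z w] unfolding zw by (auto simp: frontier_bidisc)
    qed
    then show "x \<in> V \<inter> torus" using x W_circle[of z w] V[of z w] unfolding zw by (auto simp: frontier_bidisc)
  qed (auto simp: frontier_bidisc)
  ultimately show "distinguished_variety V" unfolding distinguished_variety_def using assms(2) by blast
qed

lemma strict_iff_distinguished_W: "distinguished_variety (W_variety n F q) \<longleftrightarrow> strict"
  by (rule strict_iff_distinguished[OF _ W_eq]) simp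

lemma strict_iff_distinguished_xi: "distinguished_variety (zero_set \<xi>) \<longleftrightarrow> strict"
  by (rule strict_iff_distinguished[OF W_xi_regular refl]) (rule q_nonzero)

lemma strict_outer_regular:
  assumes strict "norm z > 1" "poly q z \<noteq> 0" "(z, w) \<in> W_variety n F q"
  shows "norm w > 1"
proof -
  have z: "z \<noteq> 0" and y: "norm (1 / cnj z) < 1" using assms(2) by (auto simp: norm_divide divide_less_eq)
  have w: "w \<noteq> 0" "(1 / cnj z, 1 / cnj w) \<in> W_variety n F q"
    using W_reflect[OF assms(4) z assms(3)] q_nonzero y by auto
  then have "norm (1 / cnj w) < 1" using assms(1) y by (auto simp: strict_def)
  then show ?thesis using w(1) by (simp add: norm_divide)
qed

lemma strict_outer:
  assumes s: strict and z: "norm z > 1" and \<xi>0: "ev \<xi> z w = 0"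
  shows "norm w > 1"
proof -
  have inner: "ev \<xi> z w \<noteq> 0" if z: "norm z > 1" and w: "norm w < 1" for z w
  proof
    assume "ev \<xi> z w = 0"
    then have "\<forall>\<^sub>F z' in at z. \<exists>w'. norm (w' - w) < 1 - norm w \<and> ev \<xi> z' w' = 0"
      using w by (intro ev_root_continuity_w slice_xi_nonzero) auto
    moreover have "\<forall>\<^sub>F z' in at z. z' \<notin> {z. poly q z = 0}"
      using q_neq_0 by (intro eventually_at_avoid_finite poly_roots_finite)
    moreover have "\<forall>\<^sub>F z' in at z. norm z' > 1"
      using z by (intro order_tendstoD[OF tendsto_norm[OF tendsto_ident_at]])
    ultimately have "\<forall>\<^sub>F z' in at z. False"
    proof eventually_elim
      case (elim z')
      then obtain w' where w': "norm (w' - w) < 1 - norm w" "ev \<xi> z' w' = 0" by blast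
      have "(z', w') \<in> W_variety n F q" using W_xi_regular[of z' w'] w'(2) elim by simp
      then have "norm w' > 1" using strict_outer_regular[OF s, of z' w'] elim by simp
      then show False using w'(1) norm_triangle_ineq2[of w' w] by simp
    qed
    then show False by simp
  qed
  have "norm w \<noteq> 1"
  proof
    assume w: "norm w = 1"
    \<comment> \<open>A horizontal line at height w would contain (0, w), and |w| = 1 contradicts
      \<open>strict\<close>.\<close>
    have "poly \<xi> [:w:] \<noteq> 0"
    proof
      assume "poly \<xi> [:w:] = 0"
      then have "(0, w) \<in> W_variety n F q" using W_xi_regular[of 0 w] q_nonzero[of 0] by (simp add: ev_def)
      then show False using s w by (force simp: strict_def)
    qed
    then have "\<forall>\<^sub>F w' in at w. \<exists>z'. norm (z' - z) < norm z - 1 \<and> ev \<xi> z' w' = 0"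
      using \<xi>0 z by (intro ev_root_continuity_z) auto
    then obtain d where d: "d > 0" "\<And>w'. w' \<noteq> w \<Longrightarrow> dist w' w < d \<Longrightarrow> \<exists>z'. norm (z' - z) < norm z - 1 \<and> ev \<xi> z' w' = 0"
      unfolding eventually_at by auto
    \<comment> \<open>The distance by which w is moved radially inwards: below d for root
      continuity, and below 1 so that the new modulus is 1 - t.\<close>
    define t where "t = min (1/2) (d / 2)"
    have t: "0 < t" "t < 1" "t < d" using d(1) by (auto simp: t_def)
    define w' where "w' = of_real (1 - t) * w"
    have "w' - w = - (of_real t * w)" by (simp add: w'_def algebra_simps)
    then have "norm (w' - w) = t" using w t by (simp add: norm_mult)
    then obtain z' where z': "norm (z' - z) < norm z - 1" "ev \<xi> z' w' = 0"
      using d(2)[of w'] t by (auto simp: dist_norm)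
    have "norm z' > 1" using z'(1) norm_triangle_ineq2[of z z'] by (simp add: norm_minus_commute)
    moreover have "norm w' < 1" using w t unfolding w'_def norm_mult norm_of_real by simp
    ultimately show False using inner z'(2) by blast
  qed
  then show ?thesis using inner[OF z, of w] \<xi>0 by (cases "norm w < 1") auto
qed

lemma strict_iff_xi_subset:
  "zero_set \<xi> \<subseteq> bidisc \<union> torus \<union> biexterior \<longleftrightarrow> strict"
proof
  assume sub: "zero_set \<xi> \<subseteq> bidisc \<union> torus \<union> biexterior"
  show strict unfolding strict_def
  proof (intro allI impI)
    fix z w assume z: "norm z < 1" "(z, w) \<in> W_variety n F q"
    then have "(z, w) \<in> zero_set \<xi>" using W_xi_regular[of z w] q_nonzero[of z] by simp
    then have "(z, w) \<in> bidisc \<union> torus \<union> biexterior" using sub by blast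
    then show "norm w < 1" using z(1) by auto
  qed
next
  assume s: strict
  show "zero_set \<xi> \<subseteq> bidisc \<union> torus \<union> biexterior"
  proof
    fix x assume x: "x \<in> zero_set \<xi>"
    obtain z w where zw: "x = (z, w)" by (cases x)
    have W: "(z, w) \<in> W_variety n F q" if "norm z \<le> 1" using W_xi_regular[of z w] q_nonzero[OF that] x zw by simp
    consider "norm z < 1" | "norm z = 1" | "norm z > 1" by linarith
    then show "x \<in> bidisc \<union> torus \<union> biexterior"
    proof cases
      case 1
      then show ?thesis using s W zw by (auto simp: strict_def)
    next
      case 2
      then show ?thesis using W_circle[OF W] zw by auto
    next
      case 3
      then show ?thesis using strict_outer[OF s 3, of w] x zw by auto
    qed
  qed
qed

end

text \<open>An irreducible factor f of p has zeros over all but finitely many z in the disc. By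
  containment they lie in the bidisc, hence on the zero set of r. So f and r share zeros over
  infinitely many z, and f divides r.\<close>

lemma zero_set_subset_from_bidisc:
  assumes "p \<noteq> 0" and U: "zero_set p \<subseteq> bidisc \<union> torus \<union> biexterior"
    and r: "zero_set p \<inter> bidisc \<subseteq> zero_set r"
  shows "zero_set p \<subseteq> zero_set r"
proof
  fix x assume x: "x \<in> zero_set p"
  obtain z w where zw: "x = (z, w)" by (cases x)
  obtain f where f: "f \<in> prime_factors p" "ev f z w = 0" using zero_set_prime_factors[OF \<open>p \<noteq> 0\<close>] x zw by auto
  have fp: "ev f z' w' = 0 \<Longrightarrow> (z', w') \<in> zero_set p" for z' w'
    using zero_set_prime_factors[OF \<open>p \<noteq> 0\<close>] f(1) by auto
  have irr: "irreducible f" using f(1) by (intro prime_elem_imp_irreducible prime_imp_prime_elem in_prime_factors_imp_prime)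
  have "degree f > 0"
  proof (rule ccontr)
    assume "\<not> degree f > 0"
    then obtain c where c: "f = [:c:]" using degree_eq_zeroE[of f] by auto
    \<comment> \<open>A factor in z alone contains a vertical line, but w = 0 and w = 1 cannot both
      occur over the same z in the allowed set.\<close>
    then have "ev f z w' = 0" for w' using f(2) by simp
    then have "(z, w') \<in> bidisc \<union> torus \<union> biexterior" for w' using fp U by blast
    from this[of 0] this[of 1] show False by auto
  qed
  have "f dvd r"
  proof (rule ccontr)
    assume "\<not> f dvd r"
    then have "finite {z. \<exists>w. ev f z w = 0 \<and> ev r z w = 0}"
      using irr \<open>degree f > 0\<close> by (intro irreducible_common_zeros)
    moreover have "finite {z. poly (lead_coeff f) z = 0}"
      using \<open>degree f > 0\<close> by (intro poly_roots_finite) auto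
    ultimately have "infinite (unit_disc - ({z. \<exists>w. ev f z w = 0 \<and> ev r z w = 0} \<union> {z. poly (lead_coeff f) z = 0}))"
      using infinite_disc by (intro Diff_infinite_finite) auto
    from infinite_imp_nonempty[OF this] obtain y where y: "norm y < 1"
      "y \<notin> {z. \<exists>w. ev f z w = 0 \<and> ev r z w = 0}" "y \<notin> {z. poly (lead_coeff f) z = 0}"
      unfolding ex_in_conv[symmetric] by (elim exE) (simp, blast)
    have "degree (slice y f) > 0"
      using le_degree[of "slice y f" "degree f"] y(3) \<open>degree f > 0\<close> by simp
    then obtain v where v: "poly (slice y f) v = 0"
      using Fundamental_Theorem_Algebra.fundamental_theorem_of_algebra[of "slice y f"] constant_degree[of "slice y f"] by auto
    then have "(y, v) \<in> zero_set p" using fp by simp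
    moreover from this have "(y, v) \<in> bidisc \<union> torus \<union> biexterior" using U by blast
    then have "(y, v) \<in> bidisc" using y(1) by auto
    ultimately have "(y, v) \<in> zero_set r" using r by blast
    then show False using y(2) v by simp
  qed
  then show "x \<in> zero_set r" using f(2) zw by (auto simp: dvd_def)
qed

section \<open>Rational inner functions of distinguished varieties\<close>

lemma smult_smult_mat: "a \<cdot>\<^sub>m (b \<cdot>\<^sub>m A) = (a * b) \<cdot>\<^sub>m A" for a b :: "'a::semigroup_mult"
  by (rule eq_matI) (auto simp: mult.assoc)

lemma mat_adjoint_smult:
  fixes A :: "complex mat"
  shows "mat_adjoint (c \<cdot>\<^sub>m A) = cnj c \<cdot>\<^sub>m mat_adjoint A"
  by (rule eq_matI) auto

text \<open>Conjugation with L carries the form L L^* to the identity, and with it the invariance of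
  that form under C, up to the factor k, to X X^* being scalar.\<close>

lemma similar_scaled_unitary:
  fixes L X C :: "complex mat"
  assumes c: "L \<in> carrier_mat n n" "X \<in> carrier_mat n n" "C \<in> carrier_mat n n"
    and "det L \<noteq> 0" and LX: "L * X = c \<cdot>\<^sub>m (C * L)"
    and C: "C * (L * mat_adjoint L) * mat_adjoint C = k \<cdot>\<^sub>m (L * mat_adjoint L)"
  shows "X * mat_adjoint X = (c * cnj c * k) \<cdot>\<^sub>m 1\<^sub>m n"
proof -
  obtain R where R: "R \<in> carrier_mat n n" "L * R = 1\<^sub>m n" "R * L = 1\<^sub>m n"
    using mat_inverse_exists[OF c(1) \<open>det L \<noteq> 0\<close>] by metis
  note cs = c R(1) mat_adjoint_carrier[OF c(1)] mat_adjoint_carrier[OF c(2)] mat_adjoint_carrier[OF c(3)] mat_adjoint_carrier[OF R(1)]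
  note assoc = assoc_mult_mat[of _ n n _ n _ n]
  define Y where "Y = L * X"
  have Y: "Y \<in> carrier_mat n n" "mat_adjoint Y \<in> carrier_mat n n" using c unfolding Y_def by auto
  have XY: "X = R * Y" unfolding Y_def using cs R(3) by (simp add: assoc[symmetric])
  have CL: "C * L \<in> carrier_mat n n" "mat_adjoint (C * L) \<in> carrier_mat n n" using c by auto
  have "Y * mat_adjoint Y = (c * cnj c) \<cdot>\<^sub>m (C * L * mat_adjoint (C * L))"
    unfolding Y_def LX mat_adjoint_smult
    using mult_smult_distrib[OF _ CL(2), of "c \<cdot>\<^sub>m (C * L)" n] mult_smult_assoc_mat[OF CL] CL
    by (simp add: smult_smult_mat mult.commute)
  also have "C * L * mat_adjoint (C * L) = C * (L * mat_adjoint L) * mat_adjoint C"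
    unfolding mat_adjoint_mult[OF c(3,1)] using cs mult_carrier_mat[OF cs(5) cs(7)] by (simp add: assoc)
  finally have YY: "Y * mat_adjoint Y = (c * cnj c * k) \<cdot>\<^sub>m (L * mat_adjoint L)"
    unfolding C by (simp add: smult_smult_mat)
  have LL: "L * mat_adjoint L \<in> carrier_mat n n" using cs by simp
  have "X * mat_adjoint X = R * (Y * mat_adjoint Y) * mat_adjoint R"
    unfolding XY mat_adjoint_mult[OF R(1) Y(1)] using Y cs mult_carrier_mat[OF Y(2) cs(8)] by (simp add: assoc)
  also have "\<dots> = (c * cnj c * k) \<cdot>\<^sub>m (R * (L * mat_adjoint L) * mat_adjoint R)"
    unfolding YY mult_smult_distrib[OF R(1) LL]
    by (rule mult_smult_assoc_mat[OF mult_carrier_mat[OF R(1) LL] mat_adjoint_carrier[OF R(1)]])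
  also have "R * (L * mat_adjoint L) * mat_adjoint R = (R * L) * mat_adjoint (R * L)"
    unfolding mat_adjoint_mult[OF R(1) c(1)] using cs mult_carrier_mat[OF cs(5) cs(8)] by (simp add: assoc)
  also have "\<dots> = 1\<^sub>m n" unfolding R(3) by (rule eq_matI) (auto simp: scalar_prod_def if_distrib sum.delta' cong: if_cong)
  finally show ?thesis .
qed

text \<open>S is a sum of rank one matrices built from eigenvectors of the companion matrix. Their
  eigenvalues \<open>lead_coeff p * a\<close> have the modulus of the leading coefficient because
  |a| = 1.\<close>

lemma (in unimodular_roots) companion_schur_cohn:
  fixes S
  defines "S \<equiv> mat n n (\<lambda>(j, k). schur_cohn n (coeff p) j k)"
  assumes n: "n > 0"
  shows "companion n (coeff p) * S * mat_adjoint (companion n (coeff p)) = (lead_coeff p * cnj (lead_coeff p)) \<cdot>\<^sub>m S"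
proof (rule eq_matI)
  let ?C = "companion n (coeff p)"
  have C: "dim_row ?C = n" "dim_col ?C = n" using companion_carrier[of n "coeff p"] by (simp_all only: carrier_matD)
  fix j k assume "j < dim_row ((lead_coeff p * cnj (lead_coeff p)) \<cdot>\<^sub>m S)" "k < dim_col ((lead_coeff p * cnj (lead_coeff p)) \<cdot>\<^sub>m S)"
  then have jk: "j < n" "k < n" by (auto simp: S_def)
  define v where "v = (\<lambda>a i. coeff (cof a) i)"
  have S: "S $$ (i, l) = (\<Sum>a\<in>A. v a i * cnj (v a l))" if "i < n" "l < n" for i l
    using that schur_cohn_sum by (simp add: S_def v_def)
  have row: "(\<Sum>i<n. ?C $$ (j, i) * v a i) = lead_coeff p * a * v a j" if a: "a \<in> A" and j: "j < n" for a j
  proof -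
    have "(?C *\<^sub>v vec n (coeff (cof a))) $ j = (\<Sum>i<n. ?C $$ (j, i) * v a i)"
      using j C by (simp add: scalar_prod_def lessThan_atLeast0 v_def)
    then show ?thesis unfolding companion_eigen[OF deg n cof[OF a]] using j by (simp add: v_def)
  qed
  have na: "a * cnj a = 1" if "a \<in> A" for a
    using uni[of a] that by (simp add: A_def complex_norm_square[symmetric])
  define h where "h = (\<lambda>a i l. (?C $$ (j, i) * v a i) * cnj (?C $$ (k, l) * v a l))"
  have "(?C * S * mat_adjoint ?C) $$ (j, k) = (\<Sum>l<n. (\<Sum>i<n. ?C $$ (j, i) * S $$ (i, l)) * cnj (?C $$ (k, l)))"
    using jk C by (simp add: scalar_prod_def lessThan_atLeast0 S_def)
  also have "\<dots> = (\<Sum>l<n. \<Sum>i<n. \<Sum>a\<in>A. h a i l)"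
    by (intro sum.cong refl) (simp add: S h_def sum_distrib_left sum_distrib_right mult_ac)
  also have "\<dots> = (\<Sum>i<n. \<Sum>l<n. \<Sum>a\<in>A. h a i l)" by (rule sum.swap)
  also have "\<dots> = (\<Sum>i<n. \<Sum>a\<in>A. \<Sum>l<n. h a i l)" by (intro sum.cong refl sum.swap)
  also have "\<dots> = (\<Sum>a\<in>A. \<Sum>i<n. \<Sum>l<n. h a i l)" by (rule sum.swap)
  also have "\<dots> = (\<Sum>a\<in>A. (\<Sum>i<n. ?C $$ (j, i) * v a i) * cnj (\<Sum>l<n. ?C $$ (k, l) * v a l))"
    by (simp add: h_def sum_product)
  also have "\<dots> = (\<Sum>a\<in>A. lead_coeff p * cnj (lead_coeff p) * (v a j * cnj (v a k)))"
  proof (intro sum.cong refl)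
    fix a assume a: "a \<in> A"
    have "lead_coeff p * a * v a j * cnj (lead_coeff p * a * v a k) =
      (a * cnj a) * (lead_coeff p * cnj (lead_coeff p) * (v a j * cnj (v a k)))" by simp
    then show "(\<Sum>i<n. ?C $$ (j, i) * v a i) * cnj (\<Sum>l<n. ?C $$ (k, l) * v a l) = lead_coeff p * cnj (lead_coeff p) * (v a j * cnj (v a k))"
      unfolding row[OF a jk(1)] row[OF a jk(2)] na[OF a] by simp
  qed
  also have "\<dots> = ((lead_coeff p * cnj (lead_coeff p)) \<cdot>\<^sub>m S) $$ (j, k)"
    using S[OF jk] jk by (simp add: S_def sum_distrib_left)
  finally show "(?C * S * mat_adjoint ?C) $$ (j, k) = ((lead_coeff p * cnj (lead_coeff p)) \<cdot>\<^sub>m S) $$ (j, k)" .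
qed (use carrier_matD[OF companion_carrier[of n "coeff p"]] in \<open>simp_all add: S_def\<close>)

lemma inner_poly_unimodular_roots:
  assumes p: "inner_poly p" and z: "norm z = 1" "\<nexists>w. ev p z w = 0 \<and> ev (pderiv p) z w = 0"
  shows "unimodular_roots (slice z p) (degree p)"
proof
  have "coeff (slice z p) (degree p) \<noteq> 0" using p z(1) by (auto simp: inner_poly_def)
  from le_degree[OF this] this show "degree (slice z p) = degree p" and "slice z p \<noteq> 0"
    using degree_slice_le[of z p] by (simp, metis coeff_0)
  show "rsquarefree (slice z p)"
    unfolding rsquarefree_roots slice_pderiv[symmetric] using z(2) by simp
  show "norm a = 1" if "poly (slice z p) a = 0" for a using that p z(1) by (auto simp: inner_poly_def)
qed

lemma evm_companion: "evm z (companion n (coeff p)) = companion n (coeff (slice z p))"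
  by (rule eq_matI) (auto simp: companion_def)

text \<open>Denominators are cleared in the similarity: F takes the adjugate of L for its inverse,
  and q collects det L and the leading coefficient. As det L may vanish on the circle, q is only
  claimed to be nonzero inside; passing to lowest terms repairs this later.\<close>

lemma inner_poly_matrix:
  assumes p: "inner_poly p"
  obtains F q where "F \<in> carrier_mat (degree p) (degree p)" "\<And>z. norm z < 1 \<Longrightarrow> poly q z \<noteq> 0"
    "\<And>z a b. norm z = 1 \<Longrightarrow> a < degree p \<Longrightarrow> b < degree p \<Longrightarrow>
      (\<Sum>c<degree p. poly (F $$ (a, c)) z * cnj (poly (F $$ (b, c)) z)) = (if a = b then poly q z * cnj (poly q z) else 0)"
    "\<And>z w. norm z < 1 \<Longrightarrow> (z, w) \<in> W_variety (degree p) F q \<longleftrightarrow> ev p z w = 0"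
proof -
  define n where "n = degree p"
  have n: "n > 0" and lead: "\<And>z. norm z \<le> 1 \<Longrightarrow> poly (lead_coeff p) z \<noteq> 0" using p by (auto simp: inner_poly_def n_def)
  define B where "B = {z. \<exists>w. ev p z w = 0 \<and> ev (pderiv p) z w = 0}"
  have finB: "finite B" using p by (simp add: inner_poly_def B_def)
  have cs: "coeff (slice z p) = (\<lambda>i. poly (coeff p i) z)" for z by (rule ext) simp
  define S where "S = (\<lambda>j k z. schur_cohn n (coeff (slice z p)) j k)"
  have trigS: "trig (S j k)" for j k unfolding S_def cs by (rule trig_schur_cohn) (rule trig_poly)
  have ur: "unimodular_roots (slice z p) n" if "norm z = 1" "z \<notin> B" for z
    unfolding n_def using inner_poly_unimodular_roots[OF p that(1)] that(2) by (auto simp: B_def)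
  have pd: "posdef n (\<lambda>j k. S j k z)" if "norm z = 1" "z \<notin> B" for z
    using unimodular_roots.posdef_schur_cohn[OF ur[OF that]] by (simp add: S_def)
  obtain d K where dK: "d \<noteq> 0" "K \<in> carrier_mat n n" "\<And>z. norm z < 1 \<Longrightarrow> poly (det K) z \<noteq> 0"
    "\<And>z j k. norm z = 1 \<Longrightarrow> z \<notin> B \<Longrightarrow> j < n \<Longrightarrow> k < n \<Longrightarrow>
      poly d z * cnj (poly d z) * S j k z = (\<Sum>l<n. poly (K $$ (l, j)) z * cnj (poly (K $$ (l, k)) z))"
    by (rule spectral_factorization[of n S B, OF trigS finB pd]) blast+
  \<comment> \<open>With the transpose, the factorization reads |d|^2 S = L L^*.\<close>
  define L where "L = transpose_mat K"
  have L: "L \<in> carrier_mat n n" using dK(2) by (simp add: L_def)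
  have detL: "poly (det L) z \<noteq> 0" if "norm z < 1" for z
    using dK(3)[OF that] Determinant.det_transpose[OF dK(2)] by (simp add: L_def)
  define C where "C = companion n (coeff p)"
  have C: "C \<in> carrier_mat n n" by (simp add: C_def)
  define F where "F = adj_mat L * C * L"
  define q where "q = det L * lead_coeff p"
  have aL: "adj_mat L \<in> carrier_mat n n" "L * adj_mat L = det L \<cdot>\<^sub>m 1\<^sub>m n" using adj_mat[OF L] by auto
  have F: "F \<in> carrier_mat n n" unfolding F_def using aL C L by simp
  have "L * F = (L * adj_mat L) * (C * L)" unfolding F_def using aL(1) C L by (simp add: assoc_mult_mat[of _ n n _ n _ n])
  also have "\<dots> = det L \<cdot>\<^sub>m (C * L)"
    unfolding aL(2) mult_smult_assoc_mat[OF one_carrier_mat mult_carrier_mat[OF C L]] using C L by simp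
  finally have LF: "L * F = det L \<cdot>\<^sub>m (C * L)" .
  have eLF: "evm z L * evm z F = poly (det L) z \<cdot>\<^sub>m (evm z C * evm z L)" for z
    using arg_cong[OF LF, of "evm z"] unfolding evm_mult[OF L F] evm_smult evm_mult[OF C L] .
  have ec: "evm z L \<in> carrier_mat n n" "evm z F \<in> carrier_mat n n" "evm z C \<in> carrier_mat n n" for z
    using L F C by auto
  have deg: "degree (slice z p) = n" "lead_coeff (slice z p) = poly (lead_coeff p) z" if "norm z \<le> 1" for z
  proof -
    have "coeff (slice z p) (degree p) \<noteq> 0" using lead[OF that] by simp
    from le_degree[OF this] show "degree (slice z p) = n" unfolding n_def
      using degree_slice_le[of z p] by simp
    then show "lead_coeff (slice z p) = poly (lead_coeff p) z" by (simp add: n_def)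
  qed
  have eC: "evm z C = companion n (coeff (slice z p))" for z unfolding C_def evm_companion ..
  have "q \<noteq> 0" using detL[of 0] lead[of 0] by (auto simp: q_def)
  have "det L \<noteq> 0" using detL[of 0] by auto
  \<comment> \<open>At zeros of det L the similarity breaks down. Both sides of the unitarity
    relation are trigonometric polynomials, so it extends to these points.\<close>
  define B' where "B' = B \<union> {z. poly (det L) z = 0}"
  have finB': "finite B'" using finB poly_roots_finite[OF \<open>det L \<noteq> 0\<close>] by (simp add: B'_def)
  have unit: "evm z F * mat_adjoint (evm z F) = (poly q z * cnj (poly q z)) \<cdot>\<^sub>m 1\<^sub>m n" if z: "norm z = 1" "z \<notin> B'" for z
  proof -
    interpret u: unimodular_roots "slice z p" n using ur z by (simp add: B'_def)
    define S' where "S' = mat n n (\<lambda>(j, k). schur_cohn n (coeff (slice z p)) j k)"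
    have S': "S' \<in> carrier_mat n n" by (simp add: S'_def)
    define k where "k = poly d z * cnj (poly d z)"
    have LL: "evm z L * mat_adjoint (evm z L) = k \<cdot>\<^sub>m S'"
    proof (rule eq_matI)
      fix i j assume "i < dim_row (k \<cdot>\<^sub>m S')" "j < dim_col (k \<cdot>\<^sub>m S')"
      then have ij: "i < n" "j < n" by (auto simp: S'_def)
      have "(evm z L * mat_adjoint (evm z L)) $$ (i, j) = (\<Sum>l<n. poly (K $$ (l, i)) z * cnj (poly (K $$ (l, j)) z))"
        using ij dK(2) by (simp add: scalar_prod_def L_def lessThan_atLeast0)
      also have "\<dots> = k * S i j z" using dK(4)[OF z(1) _ ij] z(2) by (simp add: k_def B'_def)
      finally show "(evm z L * mat_adjoint (evm z L)) $$ (i, j) = (k \<cdot>\<^sub>m S') $$ (i, j)" using ij by (simp add: S'_def S_def)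
    qed (use dK(2) in \<open>auto simp: S'_def L_def\<close>)
    let ?l = "poly (lead_coeff p) z"
    have "evm z C * S' * mat_adjoint (evm z C) = (?l * cnj ?l) \<cdot>\<^sub>m S'"
      using u.companion_schur_cohn[OF n] unfolding S'_def eC using deg(2)[of z] z(1) by simp
    then have "k \<cdot>\<^sub>m (evm z C * S' * mat_adjoint (evm z C)) = (?l * cnj ?l) \<cdot>\<^sub>m (k \<cdot>\<^sub>m S')"
      by (simp add: smult_smult_mat mult.commute)
    moreover have "evm z C * (k \<cdot>\<^sub>m S') * mat_adjoint (evm z C) = k \<cdot>\<^sub>m (evm z C * S' * mat_adjoint (evm z C))"
      unfolding mult_smult_distrib[OF ec(3) S']
      by (rule mult_smult_assoc_mat[OF mult_carrier_mat[OF ec(3) S'] mat_adjoint_carrier[OF ec(3)]])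
    ultimately have "evm z F * mat_adjoint (evm z F) = (poly (det L) z * cnj (poly (det L) z) * (?l * cnj ?l)) \<cdot>\<^sub>m 1\<^sub>m n"
      using z(2) by (intro similar_scaled_unitary[OF ec _ eLF[of z]]) (auto simp: LL det_evm B'_def)
    then show ?thesis by (simp add: q_def mult_ac)
  qed
  have "(\<Sum>c<n. poly (F $$ (a, c)) z * cnj (poly (F $$ (b, c)) z)) = (if a = b then poly q z * cnj (poly q z) else 0)"
    if z: "norm z = 1" and ab: "a < n" "b < n" for z a b
  proof (rule trig_eq_extend[OF _ _ finB' _ z])
    show "trig (\<lambda>z. \<Sum>c<n. poly (F $$ (a, c)) z * cnj (poly (F $$ (b, c)) z))"
      by (intro trig_sum trig_mult trig_cnj trig_poly)
    show "trig (\<lambda>z. if a = b then poly q z * cnj (poly q z) else 0)"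
      by (cases "a = b") (auto intro!: trig_mult trig_cnj trig_poly)
    fix z :: complex assume z: "norm z = 1" "z \<notin> B'"
    have "(evm z F * mat_adjoint (evm z F)) $$ (a, b) = (\<Sum>c<n. poly (F $$ (a, c)) z * cnj (poly (F $$ (b, c)) z))"
      using ab F by (simp add: scalar_prod_def lessThan_atLeast0)
    then show "(\<Sum>c<n. poly (F $$ (a, c)) z * cnj (poly (F $$ (b, c)) z)) = (if a = b then poly q z * cnj (poly q z) else 0)"
      unfolding unit[OF z] using ab by (cases "a = b") auto
  qed
  moreover have "poly q z \<noteq> 0" if "norm z < 1" for z using detL[OF that] lead[of z] that by (simp add: q_def)
  moreover have "(z, w) \<in> W_variety n F q \<longleftrightarrow> ev p z w = 0" if z: "norm z < 1" for z w
  proof -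
    let ?l = "poly (lead_coeff p) z" and ?D = "poly (det L) z"
    let ?X = "evm z F - (w * poly q z) \<cdot>\<^sub>m 1\<^sub>m n" and ?Y = "evm z C - (w * ?l) \<cdot>\<^sub>m 1\<^sub>m n"
    have XY: "?X \<in> carrier_mat n n" "?Y \<in> carrier_mat n n" by (intro minus_carrier_mat; simp)+
    have "evm z L * ?X = poly (det L) z \<cdot>\<^sub>m (evm z C * evm z L) - (w * poly q z) \<cdot>\<^sub>m evm z L"
      unfolding eLF[symmetric] using ec(1,2)[of z]
      by (subst mult_minus_distrib_mat[of _ n n _ n]) (auto simp: mult_smult_distrib[of _ n n _ n])
    also have "\<dots> = ?D \<cdot>\<^sub>m (evm z C * evm z L - (w * ?l) \<cdot>\<^sub>m evm z L)"
    proof -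
      have "c \<cdot>\<^sub>m M - (w * (c * l)) \<cdot>\<^sub>m N = c \<cdot>\<^sub>m (M - (w * l) \<cdot>\<^sub>m N)"
        if "M \<in> carrier_mat n n" "N \<in> carrier_mat n n" for M N :: "complex mat" and c l
        by (rule eq_matI) (use that in \<open>simp_all add: algebra_simps\<close>)
      then show ?thesis using ec[of z] by (simp add: q_def)
    qed
    also have "evm z C * evm z L - (w * ?l) \<cdot>\<^sub>m evm z L = ?Y * evm z L"
      using ec(1,3)[of z]
      by (subst minus_mult_distrib_mat[of _ n n _ _ n]) (auto simp: mult_smult_assoc_mat[of _ n n _ n])
    finally have e: "evm z L * ?X = ?D \<cdot>\<^sub>m (?Y * evm z L)" .
    \<comment> \<open>Over the disc det L is nonzero and can be cancelled, so both characteristic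
      equations have the same solutions w.\<close>
    have "det (evm z L) * det ?X = ?D ^ n * (det ?Y * det (evm z L))"
      using arg_cong[OF e, of det] L
      unfolding det_mult[OF ec(1)[of z] XY(1)] det_smult det_mult[OF XY(2) ec(1)[of z]] by simp
    then have "det ?X = 0 \<longleftrightarrow> det ?Y = 0" using detL[OF z] by (simp add: det_evm)
    also have "\<dots> \<longleftrightarrow> ev p z w = 0"
      using companion_det[of "slice z p" n w] deg[of z] z n unfolding eC by simp
    finally show ?thesis by (simp add: W_variety_def)
  qed
  ultimately show thesis using F that unfolding n_def by blast
qed

text \<open>Among all fractions equivalent to the given one, take a denominator of least degree; a
  nonconstant common factor could be cancelled.\<close>

lemma lowest_terms_exists:
  fixes F' :: "complex poly mat" and q' :: "complex poly"
  assumes F': "F' \<in> carrier_mat n n" and "q' \<noteq> 0"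
  obtains F q where "F \<in> carrier_mat n n" "q \<noteq> 0"
    "\<And>i j. i < n \<Longrightarrow> j < n \<Longrightarrow> q * F' $$ (i, j) = q' * F $$ (i, j)"
    "\<And>d. d dvd q \<Longrightarrow> (\<And>i j. i < n \<Longrightarrow> j < n \<Longrightarrow> d dvd F $$ (i, j)) \<Longrightarrow> degree d = 0"
proof -
  define P where "P = (\<lambda>(F, q). F \<in> carrier_mat n n \<and> q \<noteq> 0 \<and> (\<forall>i<n. \<forall>j<n. q * F' $$ (i, j) = q' * F $$ (i, j)))"
  have "P (F', q')" using assms by (simp add: P_def)
  from ex_has_least_nat[of P, OF this, of "\<lambda>(F, q). degree q"] obtain F q where
    Fq: "P (F, q)" and least: "\<And>G r. P (G, r) \<Longrightarrow> degree q \<le> degree r" by auto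
  have F: "F \<in> carrier_mat n n" "q \<noteq> 0" and eq: "\<And>i j. i < n \<Longrightarrow> j < n \<Longrightarrow> q * F' $$ (i, j) = q' * F $$ (i, j)"
    using Fq by (auto simp: P_def)
  have "degree d = 0" if d: "d dvd q" "\<And>i j. i < n \<Longrightarrow> j < n \<Longrightarrow> d dvd F $$ (i, j)" for d
  proof -
    obtain r where r: "q = d * r" using d(1) by blast
    have d0: "d \<noteq> 0" "r \<noteq> 0" using r F(2) by auto
    define G where "G = mat n n (\<lambda>(i, j). F $$ (i, j) div d)"
    have "P (G, r)"
    proof -
      have "r * F' $$ (i, j) = q' * G $$ (i, j)" if ij: "i < n" "j < n" for i j
      proof -
        have "d * (r * F' $$ (i, j)) = d * (q' * G $$ (i, j))"
          using eq[OF ij] d(2)[OF ij] ij by (simp add: r G_def mult_ac)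
        then show ?thesis using d0 by simp
      qed
      then show ?thesis using d0 by (simp add: P_def G_def)
    qed
    then have "degree q \<le> degree r" by (rule least)
    then show ?thesis using d0 by (simp add: r degree_mult_eq)
  qed
  then show thesis using that[OF F eq] by blast
qed

text \<open>The second identity of \<open>realization\<close> reads Q(z) (I - z D) = q(z) B. Solving
  it for Q(z) and inserting the result into the first identity gives F = q \<Psi>.\<close>

lemma (in inner_rational) rational_inner_exists:
  fixes G
  defines "G \<equiv> mat n n (\<lambda>(a, c). F a c)"
  assumes n: "n > 0" and low: "\<And>d. d dvd q \<Longrightarrow> (\<And>a c. a < n \<Longrightarrow> c < n \<Longrightarrow> d dvd F a c) \<Longrightarrow> degree d = 0"
  shows "\<exists>\<Psi>. rational_inner n \<Psi> \<and> lowest_terms n \<Psi> G q"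
proof -
  obtain m A B C D Q where c: "A \<in> carrier_mat n n" "B \<in> carrier_mat n m" "C \<in> carrier_mat m n" "D \<in> carrier_mat m m"
    and u: "unitary_mat (four_block_mat A B C D)"
    and Q: "\<And>z. Q z \<in> carrier_mat n m"
      "\<And>z. poly q z \<cdot>\<^sub>m A + z \<cdot>\<^sub>m (Q z * C) = mat n n (\<lambda>(a, c). poly (F a c) z)"
      "\<And>z. poly q z \<cdot>\<^sub>m B + z \<cdot>\<^sub>m (Q z * D) = Q z"
    using realization by blast
  define M where "M = (\<lambda>z. 1\<^sub>m m - z \<cdot>\<^sub>m D)"
  have M: "M z \<in> carrier_mat m m" for z unfolding M_def using c(4) by (intro minus_carrier_mat) simp
  define \<Psi> where "\<Psi> = (\<lambda>z. A + z \<cdot>\<^sub>m (B * the (mat_inverse (M z)) * C))"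
  have ex: "\<exists>R. mat_inverse (M z) = Some R \<and> R \<in> carrier_mat m m \<and> M z * R = 1\<^sub>m m" if z: "norm z < 1" for z
  proof -
    have "det (M z) \<noteq> 0" using realization_resolvent_det[OF c u z] by (simp add: M_def)
    then show ?thesis using mat_inverse_exists[OF M] by metis
  qed
  have "rational_inner n \<Psi>"
    unfolding rational_inner_def
  proof (intro conjI exI ballI)
    fix z :: complex assume "z \<in> unit_disc"
    then obtain R where "mat_inverse (M z) = Some R" using ex[of z] by auto
    then show "mat_inverse (1\<^sub>m m - z \<cdot>\<^sub>m D) = Some (the (mat_inverse (M z)))"
      "\<Psi> z = A + z \<cdot>\<^sub>m (B * the (mat_inverse (M z)) * C)" by (simp_all add: M_def \<Psi>_def)
  qed (use n c u in auto)
  moreover have "lowest_terms n \<Psi> G q"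
    unfolding lowest_terms_def
  proof (intro conjI ballI allI impI)
    show "G \<in> carrier_mat n n" by (simp add: G_def)
    show "q \<noteq> 0" using q[of 0] by auto
    fix z :: complex assume "z \<in> unit_disc"
    then obtain R where R: "mat_inverse (M z) = Some R" "R \<in> carrier_mat m m" "M z * R = 1\<^sub>m m" using ex[of z] by auto
    have BRC: "B * R * C \<in> carrier_mat n n" using c R(2) by simp
    have \<Psi>z: "\<Psi> z = A + z \<cdot>\<^sub>m (B * R * C)" using R(1) by (simp add: \<Psi>_def)
    show "\<Psi> z \<in> carrier_mat n n" unfolding \<Psi>z using c(1) BRC by simp
    have "Q z * M z = Q z - z \<cdot>\<^sub>m (Q z * D)"
      unfolding M_def using Q(1)[of z] c(4)
      by (subst mult_minus_distrib_mat[of _ n m _ m]) (auto simp: mult_smult_distrib[of _ n m _ m])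
    also have "\<dots> = poly q z \<cdot>\<^sub>m B"
    proof -
      have "X - Y = Z" if "X \<in> carrier_mat n m" "Y \<in> carrier_mat n m" "Z \<in> carrier_mat n m" "Z + Y = X"
        for X Y Z :: "complex mat"
        using that by (intro eq_matI) auto
      then show ?thesis using Q(1)[of z] Q(3)[of z] c(2,4) by auto
    qed
    finally have QM: "Q z * M z = poly q z \<cdot>\<^sub>m B" .
    have "Q z = Q z * (M z * R)" using R Q(1)[of z] by simp
    also have "\<dots> = Q z * M z * R" using Q(1)[of z] M[of z] R(2) by (simp add: assoc_mult_mat[of _ n m _ m _ m])
    also have "\<dots> = poly q z \<cdot>\<^sub>m (B * R)" unfolding QM by (rule mult_smult_assoc_mat[OF c(2) R(2)])
    finally have Qz: "Q z * C = poly q z \<cdot>\<^sub>m (B * R * C)"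
      using mult_smult_assoc_mat[OF mult_carrier_mat[OF c(2) R(2)] c(3)] by simp
    have "evm z G = mat n n (\<lambda>(a, c). poly (F a c) z)" by (rule eq_matI) (auto simp: G_def)
    also have "\<dots> = poly q z \<cdot>\<^sub>m A + z \<cdot>\<^sub>m (poly q z \<cdot>\<^sub>m (B * R * C))" unfolding Q(2)[symmetric] Qz ..
    also have "\<dots> = poly q z \<cdot>\<^sub>m \<Psi> z"
    proof -
      have "k \<cdot>\<^sub>m A + z \<cdot>\<^sub>m (k \<cdot>\<^sub>m P) = k \<cdot>\<^sub>m (A + z \<cdot>\<^sub>m P)" if "P \<in> carrier_mat n n" for P k
        by (rule eq_matI) (use that c(1) in \<open>simp_all add: distrib_left\<close>)
      then show ?thesis unfolding \<Psi>z using BRC by simp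
    qed
    finally show "poly q z \<cdot>\<^sub>m \<Psi> z = evm z G" ..
  next
    fix d assume "d dvd q \<and> (\<forall>i<n. \<forall>j<n. d dvd G $$ (i, j))"
    then show "degree d = 0" by (intro low) (auto simp: G_def)
  qed
  ultimately show ?thesis by blast
qed

lemma distinguished_variety_realization:
  assumes W: "distinguished_variety W"
  obtains n \<Psi> F q where "rational_inner n \<Psi>" "lowest_terms n \<Psi> F q" "W \<inter> bidisc = W_variety n F q \<inter> bidisc"
proof -
  obtain p where p: "inner_poly p" "W \<inter> bidisc = zero_set p \<inter> bidisc"
    using distinguished_variety_inner_poly[OF W] by blast
  define n where "n = degree p"
  have n: "n > 0" using p(1) by (simp add: inner_poly_def n_def)
  obtain F' q' where F': "F' \<in> carrier_mat n n" and q': "\<And>z. norm z < 1 \<Longrightarrow> poly q' z \<noteq> 0"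
    and unit': "\<And>z a b. norm z = 1 \<Longrightarrow> a < n \<Longrightarrow> b < n \<Longrightarrow>
      (\<Sum>c<n. poly (F' $$ (a, c)) z * cnj (poly (F' $$ (b, c)) z)) = (if a = b then poly q' z * cnj (poly q' z) else 0)"
    and W': "\<And>z w. norm z < 1 \<Longrightarrow> (z, w) \<in> W_variety n F' q' \<longleftrightarrow> ev p z w = 0"
    using inner_poly_matrix[OF p(1)] unfolding n_def by blast
  have "q' \<noteq> 0" using q'[of 0] by auto
  obtain F q where F: "F \<in> carrier_mat n n" and "q \<noteq> 0"
    and eq: "\<And>i j. i < n \<Longrightarrow> j < n \<Longrightarrow> q * F' $$ (i, j) = q' * F $$ (i, j)"
    and low: "\<And>d. d dvd q \<Longrightarrow> (\<And>i j. i < n \<Longrightarrow> j < n \<Longrightarrow> d dvd F $$ (i, j)) \<Longrightarrow> degree d = 0"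
    by (rule lowest_terms_exists[OF F' \<open>q' \<noteq> 0\<close>]) blast
  have eqz: "poly q z * poly (F' $$ (i, j)) z = poly q' z * poly (F $$ (i, j)) z" if "i < n" "j < n" for i j z
    using arg_cong[OF eq[OF that], of "\<lambda>p. poly p z"] by simp
  have unit: "(\<Sum>c<n. poly (F $$ (a, c)) z * cnj (poly (F $$ (b, c)) z)) = (if a = b then poly q z * cnj (poly q z) else 0)"
    if z: "norm z = 1" and ab: "a < n" "b < n" for z a b
  proof (rule trig_eq_extend[OF _ _ poly_roots_finite[OF \<open>q' \<noteq> 0\<close>] _ z])
    show "trig (\<lambda>z. \<Sum>c<n. poly (F $$ (a, c)) z * cnj (poly (F $$ (b, c)) z))"
      by (intro trig_sum trig_mult trig_cnj trig_poly)
    show "trig (\<lambda>z. if a = b then poly q z * cnj (poly q z) else 0)"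
      by (cases "a = b") (auto intro!: trig_mult trig_cnj trig_poly)
    fix z :: complex assume z: "norm z = 1" "z \<notin> {z. poly q' z = 0}"
    let ?k = "poly q z * cnj (poly q z)" and ?k' = "poly q' z * cnj (poly q' z)"
    have "?k' * (\<Sum>c<n. poly (F $$ (a, c)) z * cnj (poly (F $$ (b, c)) z)) =
      (\<Sum>c<n. (poly q' z * poly (F $$ (a, c)) z) * cnj (poly q' z * poly (F $$ (b, c)) z))"
      by (simp add: sum_distrib_left mult_ac)
    also have "\<dots> = (\<Sum>c<n. (poly q z * poly (F' $$ (a, c)) z) * cnj (poly q z * poly (F' $$ (b, c)) z))"
      using ab by (intro sum.cong refl) (simp only: eqz lessThan_iff)
    also have "\<dots> = ?k * (\<Sum>c<n. poly (F' $$ (a, c)) z * cnj (poly (F' $$ (b, c)) z))"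
      by (simp add: sum_distrib_left mult_ac)
    also have "\<dots> = ?k' * (if a = b then ?k else 0)" unfolding unit'[OF z(1) ab] by simp
    finally show "(\<Sum>c<n. poly (F $$ (a, c)) z * cnj (poly (F $$ (b, c)) z)) = (if a = b then ?k else 0)"
      using z(2) by simp
  qed
  \<comment> \<open>In the open disc a zero of q is a zero of F because q' has none there. On the
    circle the rows of F have norm |q|, so they vanish with q. Either way q and F have a common
    factor.\<close>
  have q: "poly q z \<noteq> 0" if z: "norm z \<le> 1" for z
  proof
    assume qz: "poly q z = 0"
    have "poly (F $$ (i, j)) z = 0" if ij: "i < n" "j < n" for i j
    proof (cases "norm z < 1")
      case True
      then show ?thesis using eqz[OF ij, of z] qz q' by simp
    next
      case False
      then have "(\<Sum>c<n. of_real ((norm (poly (F $$ (i, c)) z))\<^sup>2)) = (0 :: complex)"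
        using unit[of z i i] z ij qz by (simp add: complex_norm_square del: of_real_power)
      then have "(\<Sum>c<n. (norm (poly (F $$ (i, c)) z))\<^sup>2) = 0" by (simp only: of_real_sum[symmetric] of_real_eq_0_iff)
      then have "\<forall>c\<in>{..<n}. (norm (poly (F $$ (i, c)) z))\<^sup>2 = 0" by (subst (asm) sum_nonneg_eq_0_iff) auto
      then show ?thesis using ij by simp
    qed
    then have "degree [:- z, 1:] = 0" using qz by (intro low) (auto simp: poly_eq_0_iff_dvd)
    then show False by simp
  qed
  define N where "N = degree q + (\<Sum>a<n. \<Sum>c<n. degree (F $$ (a, c)))"
  have "degree (F $$ (a, c)) \<le> N" if "a < n" "c < n" for a c
  proof -
    have "degree (F $$ (a, c)) \<le> (\<Sum>c<n. degree (F $$ (a, c)))" using that by (intro member_le_sum) auto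
    also have "\<dots> \<le> (\<Sum>a<n. \<Sum>c<n. degree (F $$ (a, c)))"
      using that by (intro member_le_sum[of a "{..<n}" "\<lambda>a. \<Sum>c<n. degree (F $$ (a, c))"]) auto
    finally show ?thesis by (simp add: N_def)
  qed
  then interpret inner_rational n N "\<lambda>a c. F $$ (a, c)" q
    using q unit by unfold_locales (auto simp: N_def)
  have "mat n n (\<lambda>(a, c). F $$ (a, c)) = F" using F by (intro eq_matI) auto
  then obtain \<Psi> where \<Psi>: "rational_inner n \<Psi>" "lowest_terms n \<Psi> F q" using rational_inner_exists[OF n low] by auto
  have "(z, w) \<in> W_variety n F q \<longleftrightarrow> ev p z w = 0" if z: "norm z < 1" for z w
  proof -
    let ?X = "evm z F - (w * poly q z) \<cdot>\<^sub>m 1\<^sub>m n" and ?Y = "evm z F' - (w * poly q' z) \<cdot>\<^sub>m 1\<^sub>m n"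
    have "poly q' z \<cdot>\<^sub>m ?X = poly q z \<cdot>\<^sub>m ?Y"
      by (rule eq_matI) (use F F' eqz[of _ _ z] in \<open>auto simp: right_diff_distrib\<close>)
    from arg_cong[OF this, of det] have "poly q' z ^ n * det ?X = poly q z ^ n * det ?Y" by simp
    then have "det ?X = 0 \<longleftrightarrow> det ?Y = 0" using q'[OF z] q[of z] z by auto
    then show ?thesis using W'[OF z, of w] by (simp add: W_variety_def)
  qed
  then have "W \<inter> bidisc = W_variety n F q \<inter> bidisc" unfolding p(2) by auto
  then show thesis using that \<Psi> by blast
qed

theorem theorem2p1:
  shows
    "(\<forall>n \<Psi> F q. rational_inner n \<Psi> \<and> lowest_terms n \<Psi> F q \<longrightarrow>
        (distinguished_variety (W_variety n F q)
           \<longleftrightarrow> (\<forall>z\<in>unit_disc. numerical_radius (\<Psi> z) < 1)) \<and>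
        ((\<forall>z\<in>unit_disc. numerical_radius (\<Psi> z) < 1)
           \<longleftrightarrow> zero_set (xi_poly n F q) \<subseteq> bidisc \<union> torus \<union> biexterior) \<and>
        (zero_set (xi_poly n F q) \<subseteq> bidisc \<union> torus \<union> biexterior
           \<longleftrightarrow> distinguished_variety (zero_set (xi_poly n F q)))) \<and>
     (\<forall>W. distinguished_variety W \<longrightarrow>
        (\<exists>n \<Psi> F q. rational_inner n \<Psi> \<and> lowest_terms n \<Psi> F q \<and>
           W \<inter> bidisc = W_variety n F q \<inter> bidisc \<and>
           W_variety n F q \<inter> bidisc = zero_set (xi_poly n F q) \<inter> bidisc) \<and>
        (\<forall>n \<Psi> F q. rational_inner n \<Psi> \<and> lowest_terms n \<Psi> F q \<and>
           W \<inter> bidisc = W_variety n F q \<inter> bidisc \<and>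
           W_variety n F q \<inter> bidisc = zero_set (xi_poly n F q) \<inter> bidisc \<longrightarrow>
           (W = zero_set (xi_poly n F q) \<longleftrightarrow>
              W \<subseteq> bidisc \<union> torus \<union> biexterior \<and>
              zero_set (xi_poly n F q) \<subseteq> bidisc \<union> torus \<union> biexterior)))"
    (is "?equiv \<and> ?conv")
proof (rule conjI)
  show ?equiv
  proof (intro allI impI)
    fix n \<Psi> F q assume "rational_inner n \<Psi> \<and> lowest_terms n \<Psi> F q"
    then interpret lowest_inner n \<Psi> F q by unfold_locales auto
    show "(distinguished_variety (W_variety n F q) \<longleftrightarrow> (\<forall>z\<in>unit_disc. numerical_radius (\<Psi> z) < 1)) \<and>
        ((\<forall>z\<in>unit_disc. numerical_radius (\<Psi> z) < 1) \<longleftrightarrow> zero_set \<xi> \<subseteq> bidisc \<union> torus \<union> biexterior) \<and>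
        (zero_set \<xi> \<subseteq> bidisc \<union> torus \<union> biexterior \<longleftrightarrow> distinguished_variety (zero_set \<xi>))"
      unfolding strict_iff_distinguished_W strict_iff_distinguished_xi strict_iff_xi_subset
        strict_iff_numerical_radius[symmetric] by simp
  qed
  show ?conv
  proof (intro allI impI conjI)
    fix W assume "distinguished_variety W"
    then obtain n \<Psi> F q where Fq: "rational_inner n \<Psi>" "lowest_terms n \<Psi> F q" "W \<inter> bidisc = W_variety n F q \<inter> bidisc"
      by (rule distinguished_variety_realization)
    interpret lowest_inner n \<Psi> F q using Fq by unfold_locales
    have "W_variety n F q \<inter> bidisc = zero_set \<xi> \<inter> bidisc" using W_xi_regular q_nonzero by auto
    then show "\<exists>n \<Psi> F q. rational_inner n \<Psi> \<and> lowest_terms n \<Psi> F q \<and>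
           W \<inter> bidisc = W_variety n F q \<inter> bidisc \<and>
           W_variety n F q \<inter> bidisc = zero_set (xi_poly n F q) \<inter> bidisc" using Fq by blast
  next
    fix W n \<Psi> F q
    assume W: "distinguished_variety W" and H: "rational_inner n \<Psi> \<and> lowest_terms n \<Psi> F q \<and>
           W \<inter> bidisc = W_variety n F q \<inter> bidisc \<and>
           W_variety n F q \<inter> bidisc = zero_set (xi_poly n F q) \<inter> bidisc"
    interpret lowest_inner n \<Psi> F q using H by unfold_locales auto
    show "W = zero_set \<xi> \<longleftrightarrow> W \<subseteq> bidisc \<union> torus \<union> biexterior \<and> zero_set \<xi> \<subseteq> bidisc \<union> torus \<union> biexterior"
    proof
      assume "W = zero_set \<xi>"
      then show "W \<subseteq> bidisc \<union> torus \<union> biexterior \<and> zero_set \<xi> \<subseteq> bidisc \<union> torus \<union> biexterior"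
        using W strict_iff_distinguished_xi strict_iff_xi_subset by simp
    next
      assume U: "W \<subseteq> bidisc \<union> torus \<union> biexterior \<and> zero_set \<xi> \<subseteq> bidisc \<union> torus \<union> biexterior"
      obtain p where p: "W = zero_set p" using W by (auto simp: distinguished_variety_def)
      have "p \<noteq> 0"
      proof
        assume "p = 0"
        then have "(0, 1) \<in> W" by (simp add: p)
        then have "(0, 1 :: complex) \<in> bidisc \<union> torus \<union> biexterior" using U by blast
        then show False by simp
      qed
      have "W \<inter> bidisc = zero_set \<xi> \<inter> bidisc" using H by simp
      then have e: "zero_set p \<inter> bidisc \<subseteq> zero_set \<xi>" "zero_set \<xi> \<inter> bidisc \<subseteq> zero_set p" unfolding p by blast+
      \<comment> \<open>Each polynomial vanishes on the zeros of the other in the bidisc, and the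
        containment of the zero sets carries this over to all of C^2.\<close>
      have "zero_set p \<subseteq> zero_set \<xi>"
        using U by (intro zero_set_subset_from_bidisc \<open>p \<noteq> 0\<close> e) (simp add: p)
      moreover have "zero_set \<xi> \<subseteq> zero_set p"
        using U by (intro zero_set_subset_from_bidisc xi_nonzero e) simp
      ultimately show "W = zero_set \<xi>" by (simp add: p)
    qed
  qed
qed

end
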